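(* Let $X$ be a geodesic space with basepoint $\bullet$ and let $G$ be an Abelian group. The maps $\rho_r^{\pi_1}$ provide an isomorphism of persistences $$\{\pi_1(\mathrm{Rips}(X,r),\bullet)\}_{r>0}\cong\{\pi_1(X,\bullet)/\mathcal{S}(X,3r/2,\pi_1)\}_{r>0}.$$ The maps $\rho_r^{G}$ provide an isomorphism of persistences $$\{H_1(\mathrm{Rips}(X,r),G)\}_{r>0}\cong\{H_1(X,G)/\mathcal{S}(X,3r/2,G)\}_{r>0}.$$
   Context: A metric space $(X,d)$ is geodesic if any $x,y\in X$ are joined by a path of length $d(x,y)$. $\mathrm{Rips}(X,r)$ is the simplicial complex with vertex set $X$ in which a finite nonempty $\sigma\subset X$ is a simplex iff $\operatorname{diam}(\sigma)<r$. An $r$-sample of a loop $\alpha:[0,a]\to X$ is a choice $0\le t_0<\dots<t_m\le a$ with $\operatorname{diam}\alpha([t_i,t_{i+1}])<r$ for all $i<m$ and $\operatorname{diam}(\alpha([0,t_0]\cup[t_m,a]))<r$ (with $t_0=0$ if $\alpha$ is based at $\bullet$), identified with the simplicial loop $(\alpha(t_0),\dots,\alpha(t_m),\alpha(t_0))$ in $\mathrm{Rips}(X,r)$. The homomorphisms $\rho_r^{\pi_1}:\pi_1(X,\bullet)\to\pi_1(\mathrm{Rips}(X,r),\bullet)$ and $\rho_r^G:H_1(X,G)\to H_1(\mathrm{Rips}(X,r),G)$ map the class of a loop to the class of any of its $r$-samples (with coefficients: $g\cdot[\alpha]\mapsto g\cdot[L]$, $g\in G$, $L$ an $r$-sample of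 $\alpha$); they are well defined. A $U_d$-lasso is a based loop $\alpha*\beta*\alpha^-$, where $\alpha$ is a path starting at $\bullet$, $\alpha^-$ its reverse, and $\beta$ is a loop, based at the endpoint of $\alpha$, contained in some closed ball $\overline B(x,d)$. $\mathcal S(X,r,\pi_1)\le\pi_1(X,\bullet)$ is generated by all $U_d$-lassos with $d<r$ (it is a normal subgroup). $\mathcal S(X,r,G)\le H_1(X,G)$ is generated by the classes (with arbitrary coefficients in $G$) of all loops whose smallest closed enclosing ball has radius less than $r$, i.e. loops contained in some closed ball of radius $d<r$. Persistences have bonding maps for $p<q$ induced by inclusions $\mathrm{Rips}(X,p)\to\mathrm{Rips}(X,q)$ on the left, and natural quotient maps on the right. An isomorphism of persistences is a family of isomorphisms, one for each $r>0$, commuting with the bonding maps. *)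

theory Defs
  imports "HOL-Analysis.Analysis" "HOL-Homology.Homology"
begin

section \<open>Geodesic spaces\<close>

text \<open>A metric space is a set \<open>X\<close> of points of a type of class \<open>metric_space\<close>, with the restricted
  metric. Paths are parametrised by \<open>{0..1}\<close>, as in the library.\<close>

definition path_length :: "(real \<Rightarrow> 'a::metric_space) \<Rightarrow> ereal" where
  "path_length \<gamma> =
     (SUP ts \<in> {ts. sorted ts \<and> set ts \<subseteq> {0..1}}.
        ereal (\<Sum>i < length ts - 1. dist (\<gamma> (ts ! i)) (\<gamma> (ts ! Suc i))))"

definition geodesic_space :: "'a::metric_space set \<Rightarrow> bool" where
  "geodesic_space X \<longleftrightarrow>
     (\<forall>x\<in>X. \<forall>y\<in>X. \<exists>\<gamma>. path \<gamma> \<and> path_image \<gamma> \<subseteq> X \<and> pathstart \<gamma> = x \<and> pathfinish \<gamma> = y \<and>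
        path_length \<gamma> = ereal (dist x y))"

section \<open>Simplicial complexes and Rips complexes\<close>

text \<open>An abstract simplicial complex is given by the set of its simplices.\<close>

definition rips :: "'a::metric_space set \<Rightarrow> real \<Rightarrow> 'a set set" where
  "rips X r = {\<sigma>. finite \<sigma> \<and> \<sigma> \<noteq> {} \<and> \<sigma> \<subseteq> X \<and> diameter \<sigma> < r}"

text \<open>Points of the geometric realization are given by their barycentric coordinates.\<close>

definition geometric_simplex :: "'a set \<Rightarrow> ('a \<Rightarrow> real) set" where
  "geometric_simplex \<sigma> = {x. (\<forall>v. 0 \<le> x v) \<and> (\<forall>v. v \<notin> \<sigma> \<longrightarrow> x v = 0) \<and> (\<Sum>v\<in>\<sigma>. x v) = 1}"

text \<open>The weak topology: a set is open iff its trace on each closed simplex is open there.\<close>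

definition realization :: "'a set set \<Rightarrow> ('a \<Rightarrow> real) topology" where
  "realization K =
     topology (\<lambda>U. U \<subseteq> (\<Union>\<sigma>\<in>K. geometric_simplex \<sigma>) \<and>
       (\<forall>\<sigma>\<in>K. openin (top_of_set (geometric_simplex \<sigma>)) (U \<inter> geometric_simplex \<sigma>)))"

lemma openin_realization:
  "openin (realization K) U \<longleftrightarrow>
     U \<subseteq> (\<Union>\<sigma>\<in>K. geometric_simplex \<sigma>) \<and>
     (\<forall>\<sigma>\<in>K. openin (top_of_set (geometric_simplex \<sigma>)) (U \<inter> geometric_simplex \<sigma>))"
proof -
  have "istopology (\<lambda>U. U \<subseteq> (\<Union>\<sigma>\<in>K. geometric_simplex \<sigma>) \<and>
       (\<forall>\<sigma>\<in>K. openin (top_of_set (geometric_simplex \<sigma>)) (U \<inter> geometric_simplex \<sigma>)))"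
    (is "istopology ?P")
    unfolding istopology_def
  proof (intro conjI allI impI)
    fix S T assume S: "?P S" and T: "?P T"
    show "S \<inter> T \<subseteq> (\<Union>\<sigma>\<in>K. geometric_simplex \<sigma>)" using S by blast
    show "\<forall>\<sigma>\<in>K. openin (top_of_set (geometric_simplex \<sigma>)) (S \<inter> T \<inter> geometric_simplex \<sigma>)"
    proof
      fix \<sigma> assume "\<sigma> \<in> K"
      moreover have "S \<inter> T \<inter> geometric_simplex \<sigma> =
          (S \<inter> geometric_simplex \<sigma>) \<inter> (T \<inter> geometric_simplex \<sigma>)" by blast
      ultimately show "openin (top_of_set (geometric_simplex \<sigma>)) (S \<inter> T \<inter> geometric_simplex \<sigma>)"
        using S T by (metis openin_Int)
    qed
  next
    fix \<K> assume *: "\<forall>S\<in>\<K>. ?P S"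
    then show "\<Union>\<K> \<subseteq> (\<Union>\<sigma>\<in>K. geometric_simplex \<sigma>)" by blast
    show "\<forall>\<sigma>\<in>K. openin (top_of_set (geometric_simplex \<sigma>)) (\<Union>\<K> \<inter> geometric_simplex \<sigma>)"
    proof
      fix \<sigma> assume "\<sigma> \<in> K"
      moreover have "\<Union>\<K> \<inter> geometric_simplex \<sigma> = \<Union>((\<lambda>S. S \<inter> geometric_simplex \<sigma>) ` \<K>)" by blast
      ultimately show "openin (top_of_set (geometric_simplex \<sigma>)) (\<Union>\<K> \<inter> geometric_simplex \<sigma>)"
        using * by (metis (no_types, lifting) openin_Union imageE)
    qed
  qed
  then show ?thesis
    unfolding realization_def by (simp add: topology_inverse')
qed

definition vertex :: "'a \<Rightarrow> 'a \<Rightarrow> real" where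
  "vertex v = (\<lambda>w. if w = v then 1 else 0)"

text \<open>The path in the realization that runs linearly through the given vertices. Its
  parametrisation is immaterial, only its homotopy class is used.\<close>

fun edge_path :: "'a list \<Rightarrow> real \<Rightarrow> 'a \<Rightarrow> real" where
  "edge_path [] = undefined"
| "edge_path [v] = (\<lambda>t. vertex v)"
| "edge_path (u # v # vs) =
     (\<lambda>t w. (1 - t) * vertex u w + t * vertex v w) +++ edge_path (v # vs)"

section \<open>Samples of loops\<close>

definition r_sample :: "real \<Rightarrow> (real \<Rightarrow> 'a::metric_space) \<Rightarrow> real list \<Rightarrow> bool" where
  "r_sample r \<alpha> ts \<longleftrightarrow>
     ts \<noteq> [] \<and> sorted_wrt (<) ts \<and> set ts \<subseteq> {0..1} \<and>
     (\<forall>i. Suc i < length ts \<longrightarrow> diameter (\<alpha> ` {ts ! i .. ts ! Suc i}) < r) \<and>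
     diameter (\<alpha> ` ({0..hd ts} \<union> {last ts..1})) < r"

definition sample_loop :: "(real \<Rightarrow> 'a) \<Rightarrow> real list \<Rightarrow> 'a list" where
  "sample_loop \<alpha> ts = map \<alpha> ts @ [\<alpha> (hd ts)]"

section \<open>Fundamental groups\<close>

text \<open>The type class constraint on the type of points is an artefact of the library's \<open>(+++)\<close>; the
  topology considered is \<open>Y\<close>.\<close>

definition based_loops :: "'b::topological_space topology \<Rightarrow> 'b \<Rightarrow> (real \<Rightarrow> 'b) set" where
  "based_loops Y y = {f. pathin Y f \<and> f 0 = y \<and> f 1 = y}"

definition loop_class :: "'b::topological_space topology \<Rightarrow> 'b \<Rightarrow> (real \<Rightarrow> 'b) \<Rightarrow> (real \<Rightarrow> 'b) set"
  where
  "loop_class Y y f =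
     {g \<in> based_loops Y y. homotopic_with (\<lambda>h. h 0 = y \<and> h 1 = y) (top_of_set {0..1}) Y f g}"

lemma loop_class_top_of_set:
  assumes "f \<in> based_loops (top_of_set X) b"
  shows "loop_class (top_of_set X) b f = {g. homotopic_paths X f g}"
proof -
  have f: "pathstart f = b" "pathfinish f = b"
    using assms by (auto simp: based_loops_def pathstart_def pathfinish_def)
  have "g \<in> based_loops (top_of_set X) b" if "homotopic_paths X f g" for g
    using homotopic_paths_imp_path[OF that] homotopic_paths_imp_subset[OF that]
      homotopic_paths_imp_pathstart[OF that] homotopic_paths_imp_pathfinish[OF that] f
    by (auto simp: based_loops_def pathin_def path_def path_image_def pathstart_def pathfinish_def
        continuous_map_in_subtopology)
  with f show ?thesis
    by (auto simp: loop_class_def homotopic_paths_def pathstart_def pathfinish_def)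
qed

definition fundamental_group :: "'b::topological_space topology \<Rightarrow> 'b \<Rightarrow> (real \<Rightarrow> 'b) set monoid" where
  "fundamental_group Y y =
     \<lparr>carrier = loop_class Y y ` based_loops Y y,
      monoid.mult = (\<lambda>C D. \<Union>f\<in>C. \<Union>g\<in>D. loop_class Y y (f +++ g)),
      one = loop_class Y y (\<lambda>t. y)\<rparr>"

text \<open>The map induced by an inclusion of \<open>Y\<close> into \<open>Z\<close>; \<open>C\<close> is a homotopy class in \<open>Y\<close>.\<close>

definition fundamental_group_incl ::
    "'b::topological_space topology \<Rightarrow> 'b \<Rightarrow> (real \<Rightarrow> 'b) set \<Rightarrow> (real \<Rightarrow> 'b) set" where
  "fundamental_group_incl Z z C = (\<Union>f\<in>C. loop_class Z z f)"

abbreviation pi1_space :: "'a::metric_space set \<Rightarrow> 'a \<Rightarrow> (real \<Rightarrow> 'a) set monoid" where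
  "pi1_space X b \<equiv> fundamental_group (top_of_set X) b"

abbreviation pi1_rips :: "'a::metric_space set \<Rightarrow> 'a \<Rightarrow> real \<Rightarrow> (real \<Rightarrow> 'a \<Rightarrow> real) set monoid" where
  "pi1_rips X b r \<equiv> fundamental_group (realization (rips X r)) (vertex b)"

text \<open>The value at \<open>C\<close> is the common class of all samples of all loops in \<open>C\<close>.\<close>

definition rho_pi1 ::
    "'a::metric_space set \<Rightarrow> 'a \<Rightarrow> real \<Rightarrow> (real \<Rightarrow> 'a) set \<Rightarrow> (real \<Rightarrow> 'a \<Rightarrow> real) set" where
  "rho_pi1 X b r C =
     (\<Union>\<alpha>\<in>C. \<Union>ts\<in>{ts. r_sample r \<alpha> ts \<and> hd ts = 0}.
        loop_class (realization (rips X r)) (vertex b) (edge_path (sample_loop \<alpha> ts)))"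

definition loop_in_small_ball :: "'a::metric_space set \<Rightarrow> real \<Rightarrow> (real \<Rightarrow> 'a) \<Rightarrow> bool" where
  "loop_in_small_ball X r \<beta> \<longleftrightarrow>
     path \<beta> \<and> path_image \<beta> \<subseteq> X \<and> pathfinish \<beta> = pathstart \<beta> \<and>
     (\<exists>x\<in>X. \<exists>d<r. path_image \<beta> \<subseteq> cball x d)"

definition lassos :: "'a::metric_space set \<Rightarrow> 'a \<Rightarrow> real \<Rightarrow> (real \<Rightarrow> 'a) set" where
  "lassos X b r =
     {\<alpha> +++ \<beta> +++ reversepath \<alpha> | \<alpha> \<beta>.
        path \<alpha> \<and> path_image \<alpha> \<subseteq> X \<and> pathstart \<alpha> = b \<and>
        loop_in_small_ball X r \<beta> \<and> pathstart \<beta> = pathfinish \<alpha>}"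

definition S_pi1 :: "'a::metric_space set \<Rightarrow> 'a \<Rightarrow> real \<Rightarrow> (real \<Rightarrow> 'a) set set" where
  "S_pi1 X b r = generate (pi1_space X b) (loop_class (top_of_set X) b ` lassos X b r)"

section \<open>Homology with coefficients\<close>

text \<open>Homology of a family \<open>S\<close> of \<open>n\<close>-simplices with face maps \<open>d n k\<close>, for \<open>k \<le> n\<close>. The library's
  singular homology only has integer coefficients.\<close>

definition boundary ::
    "(nat \<Rightarrow> nat \<Rightarrow> 's \<Rightarrow> 's) \<Rightarrow> nat \<Rightarrow> ('s \<Rightarrow>\<^sub>0 'g::ab_group_add) \<Rightarrow> ('s \<Rightarrow>\<^sub>0 'g)" where
  "boundary d n c =
     (if n = 0 then 0 else
      \<Sum>s\<in>Poly_Mapping.keys c. \<Sum>k\<le>n.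
        Poly_Mapping.single (d n k s)
          (if even k then Poly_Mapping.lookup c s else - Poly_Mapping.lookup c s))"

definition cycles ::
    "(nat \<Rightarrow> 's set) \<Rightarrow> (nat \<Rightarrow> nat \<Rightarrow> 's \<Rightarrow> 's) \<Rightarrow> nat \<Rightarrow> ('s \<Rightarrow>\<^sub>0 'g::ab_group_add) monoid" where
  "cycles S d n =
     \<lparr>carrier = {c. Poly_Mapping.keys c \<subseteq> S n \<and> boundary d n c = 0}, monoid.mult = (+), one = 0\<rparr>"

definition boundaries ::
    "(nat \<Rightarrow> 's set) \<Rightarrow> (nat \<Rightarrow> nat \<Rightarrow> 's \<Rightarrow> 's) \<Rightarrow> nat \<Rightarrow> ('s \<Rightarrow>\<^sub>0 'g::ab_group_add) set" where
  "boundaries S d n = boundary d (Suc n) ` {c. Poly_Mapping.keys c \<subseteq> S (Suc n)}"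

definition homology ::
    "(nat \<Rightarrow> 's set) \<Rightarrow> (nat \<Rightarrow> nat \<Rightarrow> 's \<Rightarrow> 's) \<Rightarrow> nat \<Rightarrow> ('s \<Rightarrow>\<^sub>0 'g::ab_group_add) set monoid" where
  "homology S d n = cycles S d n Mod boundaries S d n"

definition homology_class ::
    "(nat \<Rightarrow> 's set) \<Rightarrow> (nat \<Rightarrow> nat \<Rightarrow> 's \<Rightarrow> 's) \<Rightarrow> nat \<Rightarrow> ('s \<Rightarrow>\<^sub>0 'g::ab_group_add) \<Rightarrow> ('s \<Rightarrow>\<^sub>0 'g) set"
  where
  "homology_class S d n z = boundaries S d n #>\<^bsub>cycles S d n\<^esub> z"

lemma boundary_singular_face: "boundary singular_face n c = chain_boundary n c"
proof (cases "n = 0")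
  case False
  have "Poly_Mapping.single x (if even k then a else - a)
          = frag_cmul a (frag_cmul ((-1) ^ k) (frag_of x))" for x :: "(nat \<Rightarrow> real) \<Rightarrow> 'a" and a k
    by (rule poly_mapping_eqI) (auto simp: lookup_single when_def)
  with False show ?thesis
    by (simp add: boundary_def chain_boundary_def frag_extend_def frag_cmul_sum)
qed (simp add: boundary_def chain_boundary_def)

text \<open>Singular homology \<open>H\<^sub>1(X, G)\<close>.\<close>

abbreviation sing :: "'a::metric_space set \<Rightarrow> nat \<Rightarrow> ((nat \<Rightarrow> real) \<Rightarrow> 'a) set" where
  "sing X n \<equiv> singular_simplex_set n (top_of_set X)"

abbreviation H1_space ::
    "'a::metric_space set \<Rightarrow> (((nat \<Rightarrow> real) \<Rightarrow> 'a) \<Rightarrow>\<^sub>0 'g::ab_group_add) set monoid" where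
  "H1_space X \<equiv> homology (sing X) singular_face 1"

text \<open>The class \<open>g \<cdot> [\<alpha>]\<close>.\<close>

definition loop_H1 ::
    "'a::metric_space set \<Rightarrow> 'g::ab_group_add \<Rightarrow> (real \<Rightarrow> 'a) \<Rightarrow> (((nat \<Rightarrow> real) \<Rightarrow> 'a) \<Rightarrow>\<^sub>0 'g) set" where
  "loop_H1 X g \<alpha> =
     homology_class (sing X) singular_face 1
       (Poly_Mapping.single (\<lambda>x\<in>standard_simplex 1. \<alpha> (x 1)) g)"

text \<open>Simplicial homology, defined by the ordered chain complex: its \<open>n\<close>-simplices are the
  \<open>(n+1)\<close>-tuples of (not necessarily distinct) vertices that span a simplex.\<close>

definition ordered_simplices :: "'a set set \<Rightarrow> nat \<Rightarrow> 'a list set" where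
  "ordered_simplices K n = {xs. length xs = Suc n \<and> set xs \<in> K}"

definition ordered_face :: "nat \<Rightarrow> nat \<Rightarrow> 'a list \<Rightarrow> 'a list" where
  "ordered_face n k xs = take k xs @ drop (Suc k) xs"

abbreviation H1_rips ::
    "'a::metric_space set \<Rightarrow> real \<Rightarrow> ('a list \<Rightarrow>\<^sub>0 'g::ab_group_add) set monoid" where
  "H1_rips X r \<equiv> homology (ordered_simplices (rips X r)) ordered_face 1"

text \<open>The class \<open>g \<cdot> [L]\<close> of a closed edge path \<open>L\<close>.\<close>

definition simplicial_loop_H1 ::
    "'a set set \<Rightarrow> 'g::ab_group_add \<Rightarrow> 'a list \<Rightarrow> ('a list \<Rightarrow>\<^sub>0 'g) set" where
  "simplicial_loop_H1 K g L =
     homology_class (ordered_simplices K) ordered_face 1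
       (\<Sum>i < length L - 1. Poly_Mapping.single [L ! i, L ! Suc i] g)"

text \<open>The map induced by an inclusion into \<open>K\<close>; \<open>Q\<close> is a homology class of a subcomplex.\<close>

definition simplicial_H1_incl ::
    "'a set set \<Rightarrow> ('a list \<Rightarrow>\<^sub>0 'g::ab_group_add) set \<Rightarrow> ('a list \<Rightarrow>\<^sub>0 'g) set" where
  "simplicial_H1_incl K Q = (\<Union>z\<in>Q. homology_class (ordered_simplices K) ordered_face 1 z)"

text \<open>\<open>extensional\<close> only fixes the values outside the carrier; the homomorphism is unique because the
  classes \<open>g \<cdot> [\<alpha>]\<close> generate \<open>H\<^sub>1(X, G)\<close>.\<close>

definition rho_H1 ::
    "'a::metric_space set \<Rightarrow> real \<Rightarrow>
       (((nat \<Rightarrow> real) \<Rightarrow> 'a) \<Rightarrow>\<^sub>0 'g::ab_group_add) set \<Rightarrow> ('a list \<Rightarrow>\<^sub>0 'g) set" where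
  "rho_H1 X r =
     (THE h. h \<in> hom (H1_space X) (H1_rips X r) \<and> h \<in> extensional (carrier (H1_space X)) \<and>
        (\<forall>g \<alpha> ts. path \<alpha> \<and> path_image \<alpha> \<subseteq> X \<and> pathfinish \<alpha> = pathstart \<alpha> \<and> r_sample r \<alpha> ts \<longrightarrow>
           h (loop_H1 X g \<alpha>) = simplicial_loop_H1 (rips X r) g (sample_loop \<alpha> ts)))"

definition S_H1 ::
    "'a::metric_space set \<Rightarrow> real \<Rightarrow> (((nat \<Rightarrow> real) \<Rightarrow> 'a) \<Rightarrow>\<^sub>0 'g::ab_group_add) set set" where
  "S_H1 X r = generate (H1_space X) {loop_H1 X g \<beta> | g \<beta>. loop_in_small_ball X r \<beta>}"

section \<open>Persistences\<close>

definition persistence :: "(real \<Rightarrow> 'a monoid) \<Rightarrow> (real \<Rightarrow> real \<Rightarrow> 'a \<Rightarrow> 'a) \<Rightarrow> bool" where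
  "persistence A \<phi> \<longleftrightarrow>
     (\<forall>r>0. group (A r)) \<and>
     (\<forall>p q. 0 < p \<and> p < q \<longrightarrow> \<phi> p q \<in> hom (A p) (A q)) \<and>
     (\<forall>p q s. 0 < p \<and> p < q \<and> q < s \<longrightarrow> (\<forall>x\<in>carrier (A p). \<phi> q s (\<phi> p q x) = \<phi> p s x))"

definition persistence_iso ::
    "(real \<Rightarrow> 'a monoid) \<Rightarrow> (real \<Rightarrow> real \<Rightarrow> 'a \<Rightarrow> 'a) \<Rightarrow>
     (real \<Rightarrow> 'b monoid) \<Rightarrow> (real \<Rightarrow> real \<Rightarrow> 'b \<Rightarrow> 'b) \<Rightarrow> (real \<Rightarrow> 'a \<Rightarrow> 'b) \<Rightarrow> bool" where
  "persistence_iso A \<phi> B \<psi> f \<longleftrightarrow>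
     persistence A \<phi> \<and> persistence B \<psi> \<and>
     (\<forall>r>0. f r \<in> iso (A r) (B r)) \<and>
     (\<forall>p q. 0 < p \<and> p < q \<longrightarrow> (\<forall>x\<in>carrier (A p). f q (\<phi> p q x) = \<psi> p q (f p x)))"

text \<open>The natural map to \<open>G Mod N\<close> from a quotient of \<open>G\<close> by a subgroup of \<open>N\<close>.\<close>

definition quotient_bond :: "'a monoid \<Rightarrow> 'a set \<Rightarrow> 'a set \<Rightarrow> 'a set" where
  "quotient_bond G N Q = (\<Union>a\<in>Q. N #>\<^bsub>G\<^esub> a)"

text \<open>The map on cosets induced by \<open>h\<close>, in the form used by the library's isomorphism theorem.\<close>

definition induced_on_cosets :: "('a \<Rightarrow> 'b) \<Rightarrow> 'a set \<Rightarrow> 'b" where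
  "induced_on_cosets h Q = the_elem (h ` Q)"

end

theory Submission
  imports Defs
begin

text \<open>A function \<open>e\<close> on pairs of points at distance less than \<open>r\<close> with values in a group \<open>Q\<close>
  such that \<open>e x y \<cdot> e y z = e x z\<close> for small triangles can be integrated along paths: a
  primitive \<open>\<kappa>\<close> along \<open>f\<close> satisfies \<open>\<kappa> s \<cdot> e (f s) (f t) = \<kappa> t\<close> for close \<open>s\<close> and \<open>t\<close>.
  Primitives exist on compact convex domains, so the holonomy \<open>\<kappa>(0)\<inverse> \<kappa>(1)\<close> is a homotopy
  invariant; on an \<open>r\<close>-sample it is the product of \<open>e\<close> over the edges. With values in
  \<open>\<pi>\<^sub>1(Rips(X, r))\<close>, or in the chains of \<open>Rips(X, r)\<close> modulo boundaries, this constructs the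
  maps \<open>\<rho>\<^sub>r\<close>. They kill the loops in balls of radius less than \<open>3r/2\<close>, since such a loop can be
  coned off by short edges through points at one third of the geodesics to the centre.
  Conversely, a geodesic triangle with sides shorter than \<open>r\<close> lies in a ball of radius less than
  \<open>3r/2\<close> around a vertex, so edges of \<open>Rips(X, r)\<close> may be replaced by geodesics modulo \<open>\<S>(X,
  3r/2)\<close>; on the realization this is again the holonomy of a cocycle, local with respect to the
  open stars of the vertices. The two constructions are mutually inverse. Naturality is clear on
  samples, and the statements about persistences follow formally from \<open>\<rho>\<^sub>q = \<psi> \<circ> \<rho>\<^sub>p\<close>.\<close>

section \<open>Path homotopy in abstract topologies\<close>

text \<open>The group \<open>pi1_rips\<close> belongs to a topological realization, and a Rips
  complex is in general not locally finite. Two facts about the realization carry the argument.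
  Every path runs locally in open stars, so its class is a product of classes of edges; this gives
  surjectivity. A cocycle on edges extends to a homomorphism on the fundamental group; this gives
  injectivity. With holonomy, a homotopy has to be cut into small pieces only once, in the existence
  of primitives. The constant 3/2 arises twice. Spokes of a ball of radius d, cut at a third of d,
  leave outer parts and chords between the cut points of length at most 2d/3, and 2d/3 < r means d <
  3r/2. Conversely, a point of a geodesic triangle is at most half the perimeter away from a vertex,
  and the perimeter is less than 3r. In both directions there is a definite radius below 3r/2, so
  strict inequalities survive. In homology a single edge is not a cycle; therefore the cocycle takes
  values in all chains modulo boundaries.\<close>

definition path_homotopic :: "'b::topological_space topology \<Rightarrow> (real \<Rightarrow> 'b) \<Rightarrow> (real \<Rightarrow> 'b) \<Rightarrow> bool"
    where
  "path_homotopic Y f g \<longleftrightarrow>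
     homotopic_with (\<lambda>h. h 0 = f 0 \<and> h 1 = f 1) (top_of_set {0..1}) Y f g"

lemma continuous_map_compose_on:
  assumes "continuous_map (top_of_set T) Y h" "continuous_on S f" "f ` S \<subseteq> T"
  shows "continuous_map (top_of_set S) Y (\<lambda>x. h (f x))"
proof -
  have "continuous_map (top_of_set S) (top_of_set T) f"
    using assms(2,3) by (auto simp: continuous_map_in_subtopology)
  from continuous_map_compose[OF this assms(1)] show ?thesis by (simp add: o_def)
qed

lemma path_homotopicD:
  assumes "path_homotopic Y f g"
  shows "pathin Y f" "pathin Y g" "g 0 = f 0" "g 1 = f 1"
  using homotopic_with_imp_continuous_maps[OF assms[unfolded path_homotopic_def]]
    homotopic_with_imp_property[OF assms[unfolded path_homotopic_def]]
  by (auto simp: pathin_def)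

lemma path_homotopic_refl: "pathin Y f \<Longrightarrow> path_homotopic Y f f"
  by (simp add: path_homotopic_def pathin_def)

lemma path_homotopic_sym: "path_homotopic Y f g \<Longrightarrow> path_homotopic Y g f"
  using path_homotopicD[of Y f g] by (simp add: path_homotopic_def homotopic_with_sym)

lemma path_homotopic_trans [trans]:
  "path_homotopic Y f g \<Longrightarrow> path_homotopic Y g h \<Longrightarrow> path_homotopic Y f h"
  using path_homotopicD[of Y f g] unfolding path_homotopic_def
  by (auto intro: homotopic_with_trans)

lemma path_homotopic_eq:
  assumes "pathin Y f" "\<And>t. t \<in> {0..1} \<Longrightarrow> f t = g t"
  shows "path_homotopic Y f g"
  unfolding path_homotopic_def using assms
  by (intro homotopic_with_equal) (auto simp: pathin_def)

lemma path_homotopic_compose: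
  assumes "path_homotopic Y f g" "continuous_map Y Z \<phi>"
  shows "path_homotopic Z (\<phi> \<circ> f) (\<phi> \<circ> g)"
  using assms unfolding path_homotopic_def
  by (auto intro: homotopic_with_compose_continuous_map_left)

lemma path_homotopic_iff:
  "path_homotopic Y f g \<longleftrightarrow>
     (\<exists>k. continuous_map (prod_topology (top_of_set {0..1::real}) (top_of_set {0..1::real})) Y k \<and>
        (\<forall>t\<in>{0..1}. k (0, t) = f t) \<and> (\<forall>t\<in>{0..1}. k (1, t) = g t) \<and>
        (\<forall>s\<in>{0..1}. k (s, 0) = f 0 \<and> k (s, 1) = f 1))"
  unfolding path_homotopic_def by (subst homotopic_with) simp_all

text \<open>Two paths in the unit interval with common ends are homotopic by straight lines, and
  \<open>F\<close> carries this homotopy to \<open>Y\<close>. The groupoid laws below are instances,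
  a join being written as one path composed with a piecewise linear map of the interval.\<close>

lemma path_homotopic_reparam:
  assumes "pathin Y F" "path p" "path q" "path_image p \<subseteq> {0..1}" "path_image q \<subseteq> {0..1}"
    "p 0 = q 0" "p 1 = q 1"
  shows "path_homotopic Y (F \<circ> p) (F \<circ> q)"
proof -
  have "homotopic_paths {0..1} p q"
  proof (rule homotopic_paths_linear)
    fix t :: real assume t: "t \<in> {0..1}"
    show "closed_segment (p t) (q t) \<subseteq> {0..1}"
      using t assms(4,5)
        by (intro closed_segment_subset) (auto simp: path_image_def image_subset_iff)
  qed (use assms in \<open>auto simp: pathstart_def pathfinish_def\<close>)
  then have "path_homotopic (top_of_set {0..1}) p q"
    by (simp add: path_homotopic_def homotopic_paths_def pathstart_def pathfinish_def)
  then show ?thesis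
    using assms(1) unfolding pathin_def by (rule path_homotopic_compose)
qed

lemma pathin_join:
  assumes "pathin Y f" "pathin Y g" "f 1 = g 0"
  shows "pathin Y (f +++ g)"
proof -
  have "continuous_map (top_of_set {0..1::real}) Y
    (\<lambda>x. if x \<le> 1/2 then f (2 * x) else g (2 * x - 1))"
  proof (rule continuous_map_cases_le)
    show "continuous_map
      (subtopology (top_of_set {0..1}) {x \<in> topspace (top_of_set {0..1::real}). x \<le> 1/2}) Y
        (\<lambda>x. f (2 * x))"
      using assms(1) unfolding pathin_def
      by (rule continuous_map_compose[where g = f, unfolded o_def, rotated])
        (simp_all add: continuous_map_in_subtopology subtopology_subtopology continuous_on_mult_left
          continuous_on_diff image_subset_iff)
    show "continuous_map
      (subtopology (top_of_set {0..1}) {x \<in> topspace (top_of_set {0..1::real}). 1/2 \<le> x}) Y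
        (\<lambda>x. g (2 * x - 1))"
      using assms(2) unfolding pathin_def
      by (rule continuous_map_compose[where g = g, unfolded o_def, rotated])
        (simp_all add: continuous_map_in_subtopology subtopology_subtopology continuous_on_mult_left
          continuous_on_diff image_subset_iff)
    show "f (2 * x) = g (2 * x - 1)" if "x \<in> topspace (top_of_set {0..1})" "x = 1/2" for x :: real
    proof -
      have "2 * x = 1" using that(2) by simp
      then show ?thesis using assms(3) by simp
    qed
  qed simp_all
  then show ?thesis by (simp add: pathin_def joinpaths_def)
qed

lemma pathin_reversepath:
  assumes "pathin Y f" shows "pathin Y (reversepath f)"
  using assms unfolding pathin_def reversepath_def
  by (rule continuous_map_compose[where g = f, unfolded o_def, rotated])
    (simp_all add: continuous_map_in_subtopology continuous_on_diff image_subset_iff)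

lemma joinpaths_0_1 [simp]: "(f +++ g) 0 = f 0" "(f +++ g) 1 = g 1"
  and reversepath_0_1 [simp]: "reversepath f 0 = f 1" "reversepath f 1 = f 0"
  by (auto simp: joinpaths_def reversepath_def)

text \<open>The two homotopies are glued along the time of the junction, where both rest at
  \<open>f 1 = g 0\<close>.\<close>

lemma path_homotopic_join:
  assumes "path_homotopic Y f f'" "path_homotopic Y g g'" "f 1 = g 0"
  shows "path_homotopic Y (f +++ g) (f' +++ g')"
proof -
  let ?I = "top_of_set {0..1::real}"
  obtain h where h: "continuous_map (prod_topology ?I ?I) Y h"
    "\<And>t. t \<in> {0..1} \<Longrightarrow> h (0, t) = f t" "\<And>t. t \<in> {0..1} \<Longrightarrow> h (1, t) = f' t"
    "\<And>s. s \<in> {0..1} \<Longrightarrow> h (s, 0) = f 0" "\<And>s. s \<in> {0..1} \<Longrightarrow> h (s, 1) = f 1"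
    using assms(1) unfolding path_homotopic_iff by blast
  obtain k where k: "continuous_map (prod_topology ?I ?I) Y k"
    "\<And>t. t \<in> {0..1} \<Longrightarrow> k (0, t) = g t" "\<And>t. t \<in> {0..1} \<Longrightarrow> k (1, t) = g' t"
    "\<And>s. s \<in> {0..1} \<Longrightarrow> k (s, 0) = g 0" "\<And>s. s \<in> {0..1} \<Longrightarrow> k (s, 1) = g 1"
    using assms(2) unfolding path_homotopic_iff by blast
  let ?m = "\<lambda>z::real\<times>real. if snd z \<le> 1/2 then h (fst z, 2 * snd z) else k (fst z, 2 * snd z - 1)"
  have I2: "prod_topology ?I ?I = top_of_set ({0..1} \<times> {0..1})"
    by simp
  have "continuous_map (prod_topology ?I ?I) Y ?m"
  proof (rule continuous_map_cases_le)
    have "continuous_map (top_of_set {z \<in> {0..1} \<times> {0..1}. snd z \<le> 1/2}) Y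
      (\<lambda>z. h (fst z, 2 * snd z))"
      using h(1)[unfolded I2]
      by (rule continuous_map_compose_on) (intro continuous_intros, auto)
    then show "continuous_map
      (subtopology (prod_topology ?I ?I) {x \<in> topspace (prod_topology ?I ?I). snd x \<le> 1/2}) Y
        (\<lambda>z. h (fst z, 2 * snd z))"
      unfolding I2 subtopology_subtopology by (simp add: Int_def)
    have "continuous_map (top_of_set {z \<in> {0..1} \<times> {0..1}. 1/2 \<le> snd z}) Y
      (\<lambda>z. k (fst z, 2 * snd z - 1))"
      using k(1)[unfolded I2]
      by (rule continuous_map_compose_on) (intro continuous_intros, auto)
    then show "continuous_map
      (subtopology (prod_topology ?I ?I) {x \<in> topspace (prod_topology ?I ?I). 1/2 \<le> snd x}) Y
        (\<lambda>z. k (fst z, 2 * snd z - 1))"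
      unfolding I2 subtopology_subtopology by (simp add: Int_def)
    show "h (fst x, 2 * snd x) = k (fst x, 2 * snd x - 1)"
      if "x \<in> topspace (prod_topology ?I ?I)" "snd x = 1/2" for x
    proof -
      have "2 * snd x = 1" using that(2) by simp
      then show ?thesis using that(1) h(5)[of "fst x"] k(4)[of "fst x"] assms(3) by (auto simp: I2)
    qed
  qed (auto simp: I2 intro: continuous_on_snd)
  then show ?thesis unfolding path_homotopic_iff
    by (intro exI[of _ ?m]) (auto simp: h k joinpaths_def assms(3))
qed

lemma path_homotopic_id_reparam:
  assumes "pathin Y F" "path p" "path_image p \<subseteq> {0..1}" "p 0 = 0" "p 1 = 1"
    "\<And>t. t \<in> {0..1} \<Longrightarrow> G t = F (p t)"
  shows "path_homotopic Y G F"
proof -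
  have "path_homotopic Y (F \<circ> p) (F \<circ> (\<lambda>t. t))"
    using assms by (intro path_homotopic_reparam) (auto simp: path_def path_image_def)
  moreover have "path_homotopic Y (F \<circ> p) G"
    using path_homotopicD(1)[OF calculation] assms(6) by (intro path_homotopic_eq) auto
  ultimately show ?thesis
    using path_homotopic_trans[OF path_homotopic_sym, of Y "F \<circ> p" G F] by (simp add: o_def)
qed

lemma path_homotopic_assoc:
  assumes "pathin Y f" "pathin Y g" "pathin Y h" "f 1 = g 0" "g 1 = h 0"
  shows "path_homotopic Y ((f +++ g) +++ h) (f +++ (g +++ h))"
proof (rule path_homotopic_id_reparam)
  \<comment> \<open>Stretches the two quarters and the half on which \<open>(f +++ g) +++ h\<close>
    runs through \<open>f\<close>, \<open>g\<close> and \<open>h\<close> to the half and the two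
    quarters on which the other bracketing does.\<close>
  let ?p = "(linepath 0 (1/2) +++ linepath (1/2) (3/4)) +++ linepath (3/4) (1::real)"
  show "pathin Y (f +++ (g +++ h))"
    using assms by (intro pathin_join) auto
  show "path_image ?p \<subseteq> {0..1}"
    by (auto simp: path_image_join closed_segment_eq_real_ivl)
  show "((f +++ g) +++ h) t = (f +++ (g +++ h)) (?p t)" if "t \<in> {0..1}" for t
  proof -
    consider "t \<le> 1/4" | "1/4 < t" "t \<le> 1/2" | "1/2 < t" by linarith
    then show ?thesis
    proof cases
      case 2
      then have "?p t = t + 1/4" by (simp add: joinpaths_def linepath_def field_simps)
      with 2 show ?thesis by (simp add: joinpaths_def algebra_simps)
    next
      case 3
      then have "?p t = t / 2 + 1/2" by (simp add: joinpaths_def linepath_def field_simps)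
      with 3 show ?thesis by (simp add: joinpaths_def algebra_simps)
    qed (simp add: joinpaths_def linepath_def)
  qed
qed (auto simp: linepath_0' linepath_1')

lemma path_homotopic_lid:
  assumes "pathin Y f" shows "path_homotopic Y ((\<lambda>t. f 0) +++ f) f"
  using assms
proof (rule path_homotopic_id_reparam[where p = "linepath 0 0 +++ linepath 0 (1::real)"])
  show "((\<lambda>t. f 0) +++ f) t = f ((linepath 0 0 +++ linepath 0 1) t)" for t
    by (simp add: joinpaths_def linepath_def)
qed (auto simp: path_image_join closed_segment_eq_real_ivl linepath_0' linepath_1')

lemma path_homotopic_rid:
  assumes "pathin Y f" shows "path_homotopic Y (f +++ (\<lambda>t. f 1)) f"
  using assms
proof (rule path_homotopic_id_reparam[where p = "linepath 0 1 +++ linepath 1 (1::real)"])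
  show "(f +++ (\<lambda>t. f 1)) t = f ((linepath 0 1 +++ linepath 1 1) t)" for t
    by (simp add: joinpaths_def linepath_def)
qed (auto simp: path_image_join closed_segment_eq_real_ivl linepath_0' linepath_1')

text \<open>The join is \<open>f\<close> composed with the path from 0 to 1 and back, which
  contracts in the interval to the constant path at 0.\<close>

lemma path_homotopic_rinv:
  assumes "pathin Y f" shows "path_homotopic Y (f +++ reversepath f) (\<lambda>t. f 0)"
proof -
  let ?p = "linepath 0 1 +++ linepath 1 (0::real)"
  have "path_homotopic Y (f \<circ> ?p) (f \<circ> linepath 0 0)"
    using assms by (intro path_homotopic_reparam)
      (auto simp: path_image_join closed_segment_eq_real_ivl linepath_0' linepath_1')
  moreover have "f +++ reversepath f = f \<circ> ?p"
    by (auto simp: joinpaths_def reversepath_def linepath_def fun_eq_iff algebra_simps)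
  moreover have "f \<circ> linepath 0 0 = (\<lambda>t. f 0)"
    by (auto simp: linepath_def)
  ultimately show ?thesis by simp
qed

lemma path_homotopic_linv:
  assumes "pathin Y f" shows "path_homotopic Y (reversepath f +++ f) (\<lambda>t. f 1)"
  using path_homotopic_rinv[OF pathin_reversepath[OF assms]] by simp

section \<open>Loop classes and the group law of the fundamental group\<close>

lemma loop_class_path_homotopic:
  assumes "f \<in> based_loops Y y"
  shows "loop_class Y y f = {g. path_homotopic Y f g}"
proof -
  have "f 0 = y" "f 1 = y" using assms by (auto simp: based_loops_def)
  moreover have "g \<in> based_loops Y y" if "path_homotopic Y f g" for g
    using path_homotopicD[OF that] assms by (simp add: based_loops_def)
  ultimately show ?thesis
    by (auto simp: loop_class_def path_homotopic_def)
qed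

lemma loop_class_eq:
  assumes "path_homotopic Y f g" "f \<in> based_loops Y y"
  shows "loop_class Y y f = loop_class Y y g"
proof -
  have "g \<in> based_loops Y y"
    using path_homotopicD[OF assms(1)] assms(2) by (auto simp: based_loops_def)
  then show ?thesis
    using assms
      by (auto simp: loop_class_path_homotopic intro: path_homotopic_trans path_homotopic_sym)
qed

lemma in_loop_class: "f \<in> based_loops Y y \<Longrightarrow> f \<in> loop_class Y y f"
  by (auto simp: loop_class_path_homotopic based_loops_def intro: path_homotopic_refl)

lemma based_loops_join:
  "f \<in> based_loops Y y \<Longrightarrow> g \<in> based_loops Y y \<Longrightarrow> f +++ g \<in> based_loops Y y"
  by (auto simp: based_loops_def intro: pathin_join)

text \<open>The product is defined as a union over all representatives; the united classes coincide
  because joins respect homotopy.\<close>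

lemma fundamental_group_mult:
  assumes "f \<in> based_loops Y y" "g \<in> based_loops Y y"
  shows "loop_class Y y f \<otimes>\<^bsub>fundamental_group Y y\<^esub> loop_class Y y g = loop_class Y y (f +++ g)"
proof -
  have "loop_class Y y (f' +++ g') = loop_class Y y (f +++ g)"
    if "f' \<in> loop_class Y y f" "g' \<in> loop_class Y y g" for f' g'
  proof -
    have "path_homotopic Y (f +++ g) (f' +++ g')"
      using that assms
        by (intro path_homotopic_join) (auto simp: loop_class_path_homotopic based_loops_def)
    then show ?thesis using loop_class_eq based_loops_join[OF assms] by metis
  qed
  then have "(\<Union>f'\<in>loop_class Y y f. \<Union>g'\<in>loop_class Y y g. loop_class Y y (f' +++ g')) =
      (\<Union>f'\<in>loop_class Y y f. \<Union>g'\<in>loop_class Y y g. loop_class Y y (f +++ g))"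
    by simp
  also have "\<dots> = loop_class Y y (f +++ g)"
    using in_loop_class[OF assms(1)] in_loop_class[OF assms(2)] by blast
  finally show ?thesis by (simp add: fundamental_group_def)
qed

lemma carrier_fundamental_group:
  "carrier (fundamental_group Y y) = loop_class Y y ` based_loops Y y"
  by (simp add: fundamental_group_def)

lemma one_fundamental_group: "\<one>\<^bsub>fundamental_group Y y\<^esub> = loop_class Y y (\<lambda>t. y)"
  by (simp add: fundamental_group_def)

lemma group_fundamental_group:
  assumes "y \<in> topspace Y" shows "group (fundamental_group Y y)"
proof (rule groupI)
  have 1: "(\<lambda>t. y) \<in> based_loops Y y" using assms by (simp add: based_loops_def)
  then show "\<one>\<^bsub>fundamental_group Y y\<^esub> \<in> carrier (fundamental_group Y y)"
    by (simp add: one_fundamental_group carrier_fundamental_group)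
  fix A assume "A \<in> carrier (fundamental_group Y y)"
  then obtain f where f: "f \<in> based_loops Y y" and A: "A = loop_class Y y f"
    by (auto simp: carrier_fundamental_group)
  have f': "pathin Y f" "f 0 = y" "f 1 = y" using f by (auto simp: based_loops_def)
  show "\<one>\<^bsub>fundamental_group Y y\<^esub> \<otimes>\<^bsub>fundamental_group Y y\<^esub> A = A"
    using loop_class_eq[OF _ based_loops_join[OF 1 f], of f] path_homotopic_lid[OF f'(1)] f' 1 f
    by (simp add: A one_fundamental_group fundamental_group_mult)
  have r: "reversepath f \<in> based_loops Y y"
    using f' by (auto simp: based_loops_def intro: pathin_reversepath)
  show "\<exists>B\<in>carrier (fundamental_group Y y). B \<otimes>\<^bsub>fundamental_group Y y\<^esub> A = \<one>\<^bsub>fundamental_group Y y\<^esub>"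
    using loop_class_eq[OF _ based_loops_join[OF r f], of "\<lambda>t. y"] path_homotopic_linv[OF f'(1)] f'
      f r
    by (intro bexI[of _ "loop_class Y y (reversepath f)"])
      (auto simp: A one_fundamental_group carrier_fundamental_group fundamental_group_mult)
  fix B assume "B \<in> carrier (fundamental_group Y y)"
  then obtain g where g: "g \<in> based_loops Y y" and B: "B = loop_class Y y g"
    by (auto simp: carrier_fundamental_group)
  show "A \<otimes>\<^bsub>fundamental_group Y y\<^esub> B \<in> carrier (fundamental_group Y y)"
    using f g by (auto simp: A B carrier_fundamental_group fundamental_group_mult based_loops_join)
  fix C assume "C \<in> carrier (fundamental_group Y y)"
  then obtain h where h: "h \<in> based_loops Y y" and C: "C = loop_class Y y h"
    by (auto simp: carrier_fundamental_group)
  have "path_homotopic Y ((f +++ g) +++ h) (f +++ (g +++ h))"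
    using f g h by (intro path_homotopic_assoc) (auto simp: based_loops_def)
  then show "A \<otimes>\<^bsub>fundamental_group Y y\<^esub> B \<otimes>\<^bsub>fundamental_group Y y\<^esub> C =
      A \<otimes>\<^bsub>fundamental_group Y y\<^esub> (B \<otimes>\<^bsub>fundamental_group Y y\<^esub> C)"
    using f g h loop_class_eq[of Y "(f +++ g) +++ h" "f +++ (g +++ h)" y]
    by (simp add: A B C fundamental_group_mult based_loops_join)
qed

section \<open>Paths between arbitrary points as elements of the fundamental group\<close>

definition tail_system :: "'b::topological_space topology \<Rightarrow> 'b \<Rightarrow> ('b \<Rightarrow> real \<Rightarrow> 'b) \<Rightarrow> bool" where
  "tail_system Y y T \<longleftrightarrow> y \<in> topspace Y \<and> T y = (\<lambda>t. y) \<and>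
     (\<forall>p\<in>topspace Y. pathin Y (T p) \<and> T p 0 = y \<and> T p 1 = p)"

text \<open>Closing a path by the tails at its two ends extends the formation of loop classes to the
  fundamental groupoid. As the tail at \<open>y\<close> is constant, a based loop keeps its own
  class.\<close>

definition path_class :: "'b::topological_space topology \<Rightarrow> 'b \<Rightarrow> ('b \<Rightarrow> real \<Rightarrow> 'b) \<Rightarrow>
    (real \<Rightarrow> 'b) \<Rightarrow> (real \<Rightarrow> 'b) set" where
  "path_class Y y T p = loop_class Y y (T (p 0) +++ (p +++ reversepath (T (p 1))))"

lemma pathin_ends: "pathin Y p \<Longrightarrow> p 0 \<in> topspace Y" "pathin Y p \<Longrightarrow> p 1 \<in> topspace Y"
  by (auto simp: path_start_in_topspace path_finish_in_topspace)

lemma tail_loop: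
  assumes "tail_system Y y T" "pathin Y p"
  shows "T (p 0) +++ (p +++ reversepath (T (p 1))) \<in> based_loops Y y"
  using assms pathin_ends[OF assms(2)]
  by (auto simp: tail_system_def based_loops_def intro!: pathin_join pathin_reversepath)

lemma path_class_closed:
  assumes "tail_system Y y T" "pathin Y p"
  shows "path_class Y y T p \<in> carrier (fundamental_group Y y)"
  using tail_loop[OF assms] by (auto simp: path_class_def carrier_fundamental_group)

lemma path_class_eq:
  assumes "tail_system Y y T" "path_homotopic Y p q"
  shows "path_class Y y T p = path_class Y y T q"
proof -
  note D = path_homotopicD[OF assms(2)]
  have T: "pathin Y (T (p 0))" "pathin Y (T (p 1))" "T (p 0) 1 = p 0" "T (p 1) 1 = p 1"
    using assms pathin_ends[OF D(1)] by (auto simp: tail_system_def)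
  have "path_homotopic Y (T (p 0) +++ (p +++ reversepath (T (p 1))))
    (T (p 0) +++ (q +++ reversepath (T (p 1))))"
    using assms T by (intro path_homotopic_join path_homotopic_refl pathin_reversepath) auto
  from loop_class_eq[OF this tail_loop[OF assms(1) D(1)]] show ?thesis
    by (simp add: path_class_def D)
qed

lemma path_class_loop:
  assumes "tail_system Y y T" "f \<in> based_loops Y y"
  shows "path_class Y y T f = loop_class Y y f"
proof -
  have f: "pathin Y f" "f 0 = y" "f 1 = y" using assms(2) by (auto simp: based_loops_def)
  have T: "T y = (\<lambda>t. y)" "pathin Y (T y)" using assms(1) by (auto simp: tail_system_def)
  have r: "reversepath (\<lambda>t. y) = (\<lambda>t. y)" by (auto simp: reversepath_def)
  have "path_homotopic Y ((\<lambda>t. y) +++ (f +++ (\<lambda>t. y))) ((\<lambda>t. y) +++ f)"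
    using f T path_homotopic_rid[OF f(1)] by (intro path_homotopic_join path_homotopic_refl) auto
  also have "path_homotopic Y \<dots> f" using path_homotopic_lid[OF f(1)] f by simp
  finally show ?thesis
    using loop_class_eq[of Y "(\<lambda>t. y) +++ (f +++ (\<lambda>t. y))" f y] tail_loop[OF assms(1) f(1)]
    by (simp add: path_class_def f T(1) r)
qed

lemma path_class_tail:
  assumes "tail_system Y y T" "p \<in> topspace Y"
  shows "path_class Y y T (T p) = \<one>\<^bsub>fundamental_group Y y\<^esub>"
proof -
  have T: "T y = (\<lambda>t. y)" "pathin Y (T y)" "pathin Y (T p)" "T p 0 = y" "T p 1 = p"
    using assms by (auto simp: tail_system_def)
  have "path_homotopic Y ((\<lambda>t. y) +++ (T p +++ reversepath (T p))) ((\<lambda>t. y) +++ (\<lambda>t. y))"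
    using T path_homotopic_rinv[of Y "T p"] by (intro path_homotopic_join path_homotopic_refl) auto
  also have "path_homotopic Y \<dots> (\<lambda>t. y)" using path_homotopic_lid[of Y "\<lambda>t. y"] T by simp
  finally show ?thesis
    using loop_class_eq[of Y "(\<lambda>t. y) +++ (T p +++ reversepath (T p))" "\<lambda>t. y" y]
      tail_loop[OF assms(1) T(3)]
    by (simp add: path_class_def T one_fundamental_group)
qed

text \<open>Between \<open>p\<close> and \<open>q\<close> the tail at their common point is run
  backwards and then forwards, and cancels; all other steps are rebracketing.\<close>

lemma path_class_join:
  assumes "tail_system Y y T" "pathin Y p" "pathin Y q" "p 1 = q 0"
  shows "path_class Y y T (p +++ q) = path_class Y y T p
      \<otimes>\<^bsub>fundamental_group Y y\<^esub> path_class Y y T q"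
proof -
  let ?A = "T (p 0)" and ?B = "T (q 0)" and ?C = "T (q 1)"
  have T: "pathin Y ?A" "?A 0 = y" "?A 1 = p 0" "pathin Y ?B" "?B 0 = y" "?B 1 = q 0"
    "pathin Y ?C" "?C 0 = y" "?C 1 = q 1"
    using assms(1,4) pathin_ends[OF assms(2)] pathin_ends[OF assms(3)]
      by (auto simp: tail_system_def)
  note [intro!] = pathin_join pathin_reversepath path_homotopic_refl T assms(2,3)
  note [simp] = T assms(4)
  have linv: "path_homotopic Y (reversepath ?B +++ ?B) (\<lambda>t. q 0)"
    using path_homotopic_linv[of Y ?B] by simp
  have lid: "path_homotopic Y ((\<lambda>t. q 0) +++ (q +++ reversepath ?C)) (q +++ reversepath ?C)"
    using path_homotopic_lid[of Y "q +++ reversepath ?C"] pathin_join[of Y q "reversepath ?C"]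
      pathin_reversepath[of Y ?C] assms(3) by simp
  have "path_homotopic Y ((?A +++ (p +++ reversepath ?B)) +++ (?B +++ (q +++ reversepath ?C)))
      (?A +++ ((p +++ reversepath ?B) +++ (?B +++ (q +++ reversepath ?C))))"
    by (rule path_homotopic_assoc) auto
  also have "path_homotopic Y \<dots>
    (?A +++ (p +++ (reversepath ?B +++ (?B +++ (q +++ reversepath ?C)))))"
    by (rule path_homotopic_join[OF _ path_homotopic_assoc]) auto
  also have "path_homotopic Y \<dots>
    (?A +++ (p +++ ((reversepath ?B +++ ?B) +++ (q +++ reversepath ?C))))"
    by (rule path_homotopic_join[OF _
      path_homotopic_join[OF _ path_homotopic_sym[OF path_homotopic_assoc]]]) auto
  also have "path_homotopic Y \<dots> (?A +++ (p +++ ((\<lambda>t. q 0) +++ (q +++ reversepath ?C))))"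
    by (rule path_homotopic_join[OF _ path_homotopic_join[OF _ path_homotopic_join[OF linv]]]) auto
  also have "path_homotopic Y \<dots> (?A +++ (p +++ (q +++ reversepath ?C)))"
    by (rule path_homotopic_join[OF _ path_homotopic_join[OF _ lid]]) auto
  also have "path_homotopic Y \<dots> (?A +++ ((p +++ q) +++ reversepath ?C))"
    by (rule path_homotopic_join[OF _ path_homotopic_sym[OF path_homotopic_assoc]]) auto
  finally have *:
    "path_homotopic Y ((?A +++ (p +++ reversepath ?B)) +++ (?B +++ (q +++ reversepath ?C)))
      (?A +++ ((p +++ q) +++ reversepath ?C))" .
  have 1: "?A +++ (p +++ reversepath ?B) \<in> based_loops Y y"
    "?B +++ (q +++ reversepath ?C) \<in> based_loops Y y"
    using tail_loop[OF assms(1,2)] tail_loop[OF assms(1,3)] assms(4) by simp_all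
  show ?thesis
    using loop_class_eq[OF * based_loops_join[OF 1]] 1
    by (simp add: path_class_def fundamental_group_mult)
qed

section \<open>Holonomy of local cocycles\<close>

lemma (in group) inv_cancel_assoc:
  assumes "x \<in> carrier G" "y \<in> carrier G"
  shows "inv x \<otimes> (x \<otimes> y) = y" "x \<otimes> (inv x \<otimes> y) = y"
  using assms by (simp_all flip: m_assoc)

text \<open>A flat transport: the law is required only inside the sets of some open cover, and
  \<open>c\<close> is arbitrary on pairs of points that share no such set.\<close>

definition local_cocycle :: "('q, 'm) monoid_scheme \<Rightarrow> 'y topology \<Rightarrow> ('y \<Rightarrow> 'y \<Rightarrow> 'q) \<Rightarrow> bool" where
  "local_cocycle Q Y c \<longleftrightarrow>
     (\<exists>\<U>. (\<forall>U\<in>\<U>. openin Y U) \<and> topspace Y \<subseteq> \<Union>\<U> \<and>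
        (\<forall>U\<in>\<U>. \<forall>x\<in>U. \<forall>y\<in>U. c x y \<in> carrier Q \<and> (\<forall>z\<in>U. c x y \<otimes>\<^bsub>Q\<^esub> c y z = c x z)))"

text \<open>One \<delta> serves the whole domain, so that primitives restrict to subsets and pull
  back along Lipschitz maps without any compactness. Membership in the carrier is part of the
  condition because \<open>c\<close> is unrestricted on distant pairs.\<close>

definition primitive :: "('q, 'm) monoid_scheme \<Rightarrow> ('y \<Rightarrow> 'y \<Rightarrow> 'q) \<Rightarrow> ('z::metric_space \<Rightarrow> 'y) \<Rightarrow>
    'z set \<Rightarrow> ('z \<Rightarrow> 'q) \<Rightarrow> bool" where
  "primitive Q c f A \<kappa> \<longleftrightarrow> \<kappa> \<in> A \<rightarrow> carrier Q \<and>
     (\<exists>\<delta>>0. \<forall>s\<in>A. \<forall>t\<in>A. dist s t < \<delta> \<longrightarrow>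
        c (f s) (f t) \<in> carrier Q \<and> \<kappa> s \<otimes>\<^bsub>Q\<^esub> c (f s) (f t) = \<kappa> t)"

text \<open>Two primitives differ by a left factor (\<open>primitive_unique\<close>), which cancels
  in this quotient.\<close>

definition holonomy :: "('q, 'm) monoid_scheme \<Rightarrow> ('y \<Rightarrow> 'y \<Rightarrow> 'q) \<Rightarrow> (real \<Rightarrow> 'y) \<Rightarrow> 'q" where
  "holonomy Q c f = (THE q. \<exists>\<kappa>. primitive Q c f {0..1} \<kappa> \<and> q = inv\<^bsub>Q\<^esub> \<kappa> 0 \<otimes>\<^bsub>Q\<^esub> \<kappa> 1)"

lemma diameter_le_dist:
  fixes S :: "'z::metric_space set"
  assumes "S \<noteq> {}" "\<And>x y. x \<in> S \<Longrightarrow> y \<in> S \<Longrightarrow> dist x y \<le> d"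
  shows "diameter S \<le> d"
  unfolding diameter_def using assms by (auto intro!: cSUP_least)

lemma diameter_triple_less:
  fixes s t u :: "'z::metric_space"
  assumes "dist s t < d / 2" "dist t u < d / 2" "dist s u < d / 2"
  shows "diameter {s, t, u} < d"
proof -
  have "0 < d" using assms(1) zero_le_dist[of s t] by linarith
  moreover have "diameter {s, t, u} \<le> d / 2"
    using assms by (intro diameter_le_dist) (auto simp: dist_commute less_imp_le \<open>0 < d\<close>)
  ultimately show ?thesis by linarith
qed

text \<open>The preimages of the sets of the cover are relatively open in the compact domain; half a
  Lebesgue number of them can be taken for \<delta>.\<close>

lemma local_cocycle_uniform:
  fixes f :: "'z::metric_space \<Rightarrow> 'y"
  assumes "local_cocycle Q Y c" "compact Z" "continuous_map (top_of_set Z) Y f"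
  obtains \<delta> where "\<delta> > 0"
    "\<And>s t u. s \<in> Z \<Longrightarrow> t \<in> Z \<Longrightarrow> u \<in> Z \<Longrightarrow> dist s t < \<delta> \<Longrightarrow> dist t u < \<delta> \<Longrightarrow> dist s u < \<delta> \<Longrightarrow>
       c (f s) (f t) \<in> carrier Q \<and> c (f s) (f t) \<otimes>\<^bsub>Q\<^esub> c (f t) (f u) = c (f s) (f u)"
proof -
  obtain \<U> where U: "\<And>U. U \<in> \<U> \<Longrightarrow> openin Y U" "topspace Y \<subseteq> \<Union>\<U>"
    "\<And>U x y z. U \<in> \<U> \<Longrightarrow> x \<in> U \<Longrightarrow> y \<in> U \<Longrightarrow> z \<in> U \<Longrightarrow> c x y \<in> carrier Q \<and> c x y \<otimes>\<^bsub>Q\<^esub> c y z = c x z"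
    using assms(1) unfolding local_cocycle_def by metis
  show thesis
  proof (cases "Z = {}")
    case True
    then show thesis by (intro that[of 1]) auto
  next
    case False
    have "\<exists>W. open W \<and> {x \<in> Z. f x \<in> U} = Z \<inter> W" if "U \<in> \<U>" for U
      using openin_continuous_map_preimage[OF assms(3) U(1)[OF that]] by (auto simp: openin_open)
    then obtain W where W: "\<And>U. U \<in> \<U> \<Longrightarrow> open (W U) \<and> {x \<in> Z. f x \<in> U} = Z \<inter> W U"
      by metis
    have cov: "Z \<subseteq> \<Union> (W ` \<U>)"
    proof
      fix x assume x: "x \<in> Z"
      then have "f x \<in> topspace Y" using assms(3) by (auto simp: continuous_map_def)
      then obtain U where "U \<in> \<U>" "f x \<in> U" using U(2) by auto
      then show "x \<in> \<Union> (W ` \<U>)" using W[of U] x by blast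
    qed
    obtain d where d: "0 < d" "\<And>T. T \<subseteq> Z \<Longrightarrow> diameter T < d \<Longrightarrow> \<exists>B\<in>W ` \<U>. T \<subseteq> B"
      by (rule Lebesgue_number_lemma[OF assms(2) _ cov]) (use cov False W in \<open>auto\<close>)
    show thesis
    proof (rule that[of "d / 2"])
      fix s t u assume *: "s \<in> Z" "t \<in> Z" "u \<in> Z" "dist s t < d / 2" "dist t u < d / 2"
        "dist s u < d / 2"
      then obtain U where "U \<in> \<U>" "{s, t, u} \<subseteq> W U"
        using d(2)[of "{s, t, u}"] diameter_triple_less[of s t d u] by auto
      then have "f s \<in> U" "f t \<in> U" "f u \<in> U" "U \<in> \<U>" using W[of U] * by blast+
      then show "c (f s) (f t) \<in> carrier Q \<and> c (f s) (f t) \<otimes>\<^bsub>Q\<^esub> c (f t) (f u) = c (f s) (f u)"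
        using U(3) by metis
    qed (use d in simp)
  qed
qed

primrec seq_prod :: "('q, 'm) monoid_scheme \<Rightarrow> (nat \<Rightarrow> 'q) \<Rightarrow> nat \<Rightarrow> 'q" where
  "seq_prod Q g 0 = \<one>\<^bsub>Q\<^esub>"
| "seq_prod Q g (Suc k) = seq_prod Q g k \<otimes>\<^bsub>Q\<^esub> g k"

text \<open>The primitive at \<open>z\<close> is the product of the cocycle along a fine subdivision of the segment
  from a base point to \<open>z\<close>; segments to nearby points form a ladder of small squares.\<close>

lemma primitive_exists:
  fixes f :: "'z::real_normed_vector \<Rightarrow> 'y"
  assumes "group Q" "local_cocycle Q Y c" "compact Z" "convex Z" "continuous_map (top_of_set Z) Y f"
  obtains \<kappa> where "primitive Q c f Z \<kappa>"
proof (cases "Z = {}")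
  case True
  then show thesis by (intro that[of undefined]) (auto simp: primitive_def intro: exI[of _ 1])
next
  case False
  interpret group Q by fact
  obtain \<delta> where \<delta>: "\<delta> > 0"
    "\<And>s t u. s \<in> Z \<Longrightarrow> t \<in> Z \<Longrightarrow> u \<in> Z \<Longrightarrow> dist s t < \<delta> \<Longrightarrow> dist t u < \<delta> \<Longrightarrow> dist s u < \<delta> \<Longrightarrow>
       c (f s) (f t) \<in> carrier Q \<and> c (f s) (f t) \<otimes>\<^bsub>Q\<^esub> c (f t) (f u) = c (f s) (f u)"
    using local_cocycle_uniform[OF assms(2,3,5)] by blast
  obtain z0 where z0: "z0 \<in> Z" using False by blast
  obtain D where D: "\<And>z. z \<in> Z \<Longrightarrow> dist z0 z \<le> D" "D > 0"
    using compact_imp_bounded[OF assms(3)] unfolding bounded_any_center[where a = z0]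
    by (metis dual_order.trans linorder_le_cases zero_less_one less_le_trans)
  \<comment> \<open>Chosen so that consecutive division points of any segment from \<open>z0\<close>
    are closer than \<delta>/2.\<close>
  obtain n :: nat where n: "D / n < \<delta> / 2" "n > 0"
  proof -
    obtain m :: nat where m: "2 * D / \<delta> < real m" using reals_Archimedean2 by blast
    moreover have "0 < 2 * D / \<delta>" using D \<delta> by simp
    ultimately have "0 < real m" by linarith
    then have "m > 0" by simp
    moreover have "D / m < \<delta> / 2" using m \<delta> \<open>m > 0\<close> by (simp add: field_simps)
    ultimately show ?thesis using that by blast
  qed
  define x where "x i z = z0 + (real i / real n) *\<^sub>R (z - z0)" for i z
  have xZ: "x i z \<in> Z" if "z \<in> Z" "i \<le> n" for i z
  proof -
    have "x i z = (1 - real i / real n) *\<^sub>R z0 + (real i / real n) *\<^sub>R z"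
      by (simp add: x_def algebra_simps)
    then show ?thesis using that z0 n assms(4) by (simp add: convexD)
  qed
  have d1: "dist (x i z) (x (Suc i) z) < \<delta> / 2" if "z \<in> Z" for i z
  proof -
    have "x (Suc i) z - x i z = (1 / real n) *\<^sub>R (z - z0)"
      by (simp add: x_def add_divide_distrib algebra_simps)
    then have "dist (x i z) (x (Suc i) z) = dist z0 z / n"
      by (metis dist_commute dist_norm norm_scaleR abs_divide abs_of_nat abs_one mult.left_neutral
        times_divide_eq_left)
    also have "\<dots> \<le> D / n" using D(1)[OF that] n by (simp add: divide_right_mono)
    finally show ?thesis using n by linarith
  qed
  have d2: "dist (x i z) (x i w) < \<delta> / 2" if "i \<le> n" "dist z w < \<delta> / 2" for i z w
  proof -
    have "x i z - x i w = (real i / real n) *\<^sub>R (z - w)"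
      by (simp add: x_def algebra_simps)
    then have "dist (x i z) (x i w) = (real i / real n) * dist z w"
      by (simp add: dist_norm)
    also have "\<dots> \<le> 1 * dist z w" using that n by (intro mult_right_mono) auto
    finally show ?thesis using that by linarith
  qed
  define g where "g z i = c (f (x i z)) (f (x (Suc i) z))" for z i
  have gc: "g z i \<in> carrier Q" if "z \<in> Z" "i < n" for z i
    unfolding g_def
      using \<delta>(2)[of "x i z" "x (Suc i) z" "x i z"] d1[OF that(1), of i] xZ[OF that(1)] that(2) \<delta>(1)
    by (auto simp: dist_commute)
  have pc: "seq_prod Q (g z) k \<in> carrier Q" if "z \<in> Z" "k \<le> n" for z k
    using that(2) by (induction k) (auto simp: gc[OF that(1)])
  have main: "seq_prod Q (g z) k \<otimes>\<^bsub>Q\<^esub> c (f (x k z)) (f (x k w)) = seq_prod Q (g w) k"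
    if zw: "z \<in> Z" "w \<in> Z" "dist z w < \<delta> / 2" and "k \<le> n" for z w k
    using \<open>k \<le> n\<close>
  proof (induction k)
    case 0
    \<comment> \<open>All segments start at \<open>z0\<close>, where the cocycle is idempotent and
      therefore trivial.\<close>
    have "c (f z0) (f z0) \<in> carrier Q \<and> c (f z0) (f z0) \<otimes>\<^bsub>Q\<^esub> c (f z0) (f z0) = c (f z0) (f z0)"
      using \<delta>(2)[OF z0 z0 z0] \<delta>(1) by simp
    then have "c (f z0) (f z0) = \<one>\<^bsub>Q\<^esub>" using l_cancel_one by blast
    then show ?case by (simp add: x_def)
  next
    case (Suc k)
    let ?a = "x k z" and ?b = "x (Suc k) z" and ?a' = "x k w" and ?b' = "x (Suc k) w"
    have Z: "?a \<in> Z" "?b \<in> Z" "?a' \<in> Z" "?b' \<in> Z" using xZ zw Suc.prems by auto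
    have e: "dist ?a ?b < \<delta> / 2" "dist ?a' ?b' < \<delta> / 2" "dist ?a ?a' < \<delta> / 2" "dist ?b ?b' < \<delta> / 2"
      using d1 d2 zw Suc.prems by auto
    \<comment> \<open>The diagonal cuts the square between the two segments into two triangles;
      sides below \<delta>/2 leave room for a diagonal below \<delta>.\<close>
    have e': "dist ?a ?b' < \<delta>" using dist_triangle[of ?a ?b' ?b] e by linarith
    have h1: "c (f ?a) (f ?b) \<otimes>\<^bsub>Q\<^esub> c (f ?b) (f ?b') = c (f ?a) (f ?b')"
      using \<delta>(2)[OF Z(1,2,4)] e e' \<delta>(1) by simp
    have h2: "c (f ?a) (f ?a') \<otimes>\<^bsub>Q\<^esub> c (f ?a') (f ?b') = c (f ?a) (f ?b')"
      using \<delta>(2)[OF Z(1,3,4)] e e' \<delta>(1) by simp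
    have cc: "c (f ?b) (f ?b') \<in> carrier Q" "c (f ?a) (f ?a') \<in> carrier Q"
      using \<delta>(2)[OF Z(2,4,4)] \<delta>(2)[OF Z(1,3,3)] e \<delta>(1) by auto
    have "seq_prod Q (g z) (Suc k) \<otimes>\<^bsub>Q\<^esub> c (f ?b) (f ?b') = seq_prod Q (g z) k
      \<otimes>\<^bsub>Q\<^esub> (g z k \<otimes>\<^bsub>Q\<^esub> c (f ?b) (f ?b'))"
      using pc[OF zw(1)] gc[OF zw(1)] cc Suc.prems by (simp add: m_assoc)
    also have "g z k \<otimes>\<^bsub>Q\<^esub> c (f ?b) (f ?b') = c (f ?a) (f ?a') \<otimes>\<^bsub>Q\<^esub> g w k"
      using h1 h2 by (simp add: g_def)
    also have "seq_prod Q (g z) k \<otimes>\<^bsub>Q\<^esub> (c (f ?a) (f ?a') \<otimes>\<^bsub>Q\<^esub> g w k)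
      = (seq_prod Q (g z) k \<otimes>\<^bsub>Q\<^esub> c (f ?a) (f ?a')) \<otimes>\<^bsub>Q\<^esub> g w k"
      using pc[OF zw(1)] gc[OF zw(2)] cc Suc.prems by (simp add: m_assoc)
    also have "\<dots> = seq_prod Q (g w) (Suc k)" using Suc by simp
    finally show ?case .
  qed
  have xn: "x n z = z" for z using n by (simp add: x_def)
  show thesis
  proof
    (rule that[of "\<lambda>z. seq_prod Q (g z) n"], unfold primitive_def, intro conjI exI[of _ "\<delta> / 2"]
      ballI impI)
    fix s t assume *: "s \<in> Z" "t \<in> Z" "dist s t < \<delta> / 2"
    show "seq_prod Q (g s) n \<otimes>\<^bsub>Q\<^esub> c (f s) (f t) = seq_prod Q (g t) n"
      using main[OF *, of n] by (simp add: xn)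
    show "c (f s) (f t) \<in> carrier Q" using \<delta>(2)[of s t t] * \<delta>(1) by auto
  qed (use pc \<delta>(1) in auto)
qed

lemma primitive_carrier: "primitive Q c f A \<kappa> \<Longrightarrow> t \<in> A \<Longrightarrow> \<kappa> t \<in> carrier Q"
  by (auto simp: primitive_def)

text \<open>Near each point both primitives change by the same right factor. Hence the product of
  \<kappa>' with the inverse of \<kappa> is locally constant, and constant by connectedness.\<close>

lemma primitive_unique:
  assumes "group Q" "primitive Q c f A \<kappa>" "primitive Q c f A \<kappa>'" "connected A" "a \<in> A" "b \<in> A"
  shows "inv\<^bsub>Q\<^esub> \<kappa> a \<otimes>\<^bsub>Q\<^esub> \<kappa> b = inv\<^bsub>Q\<^esub> \<kappa>' a \<otimes>\<^bsub>Q\<^esub> \<kappa>' b"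
proof -
  interpret group Q by fact
  obtain d where d: "d > 0" "\<And>s t. s \<in> A \<Longrightarrow> t \<in> A \<Longrightarrow> dist s t < d \<Longrightarrow>
      c (f s) (f t) \<in> carrier Q \<and> \<kappa> s \<otimes>\<^bsub>Q\<^esub> c (f s) (f t) = \<kappa> t"
    using assms(2) unfolding primitive_def by blast
  obtain d' where d': "d' > 0" "\<And>s t. s \<in> A \<Longrightarrow> t \<in> A \<Longrightarrow> dist s t < d' \<Longrightarrow>
      \<kappa>' s \<otimes>\<^bsub>Q\<^esub> c (f s) (f t) = \<kappa>' t"
    using assms(3) unfolding primitive_def by blast
  note K = primitive_carrier[OF assms(2)] primitive_carrier[OF assms(3)]
  define \<phi> where "\<phi> t = \<kappa>' t \<otimes>\<^bsub>Q\<^esub> inv\<^bsub>Q\<^esub> \<kappa> t" for t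
  have "\<phi> a = \<phi> b"
  proof (rule connected_local_const[OF assms(4-6)], intro ballI)
    fix s assume s: "s \<in> A"
    show "eventually (\<lambda>t. \<phi> s = \<phi> t) (at s within A)"
      unfolding eventually_at
    proof (intro exI[of _ "min d d'"] conjI ballI impI)
      fix t assume t: "t \<in> A" "t \<noteq> s \<and> dist t s < min d d'"
      let ?c = "c (f s) (f t)"
      have c: "?c \<in> carrier Q" "\<kappa> s \<otimes>\<^bsub>Q\<^esub> ?c = \<kappa> t" "\<kappa>' s \<otimes>\<^bsub>Q\<^esub> ?c = \<kappa>' t"
        using d(2)[OF s t(1)] d'(2)[OF s t(1)] t(2) by (auto simp: dist_commute)
      have "\<phi> t = (\<kappa>' s \<otimes>\<^bsub>Q\<^esub> ?c) \<otimes>\<^bsub>Q\<^esub> inv\<^bsub>Q\<^esub> (\<kappa> s \<otimes>\<^bsub>Q\<^esub> ?c)" using c by (simp add: \<phi>_def)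
      also have "\<dots> = \<phi> s" using K[OF s] c(1)
        by (simp add: \<phi>_def inv_mult_group m_assoc inv_cancel_assoc)
      finally show "\<phi> s = \<phi> t" by simp
    qed (use d d' in auto)
  qed
  have "\<kappa>' b = \<phi> b \<otimes>\<^bsub>Q\<^esub> \<kappa> b"
    using K[OF assms(6)] by (simp add: \<phi>_def m_assoc)
  then have "inv\<^bsub>Q\<^esub> \<kappa>' a \<otimes>\<^bsub>Q\<^esub> \<kappa>' b = inv\<^bsub>Q\<^esub> \<kappa>' a \<otimes>\<^bsub>Q\<^esub> (\<phi> a \<otimes>\<^bsub>Q\<^esub> \<kappa> b)"
    using \<open>\<phi> a = \<phi> b\<close> by simp
  also have "\<dots> = inv\<^bsub>Q\<^esub> \<kappa> a \<otimes>\<^bsub>Q\<^esub> \<kappa> b"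
    using K[OF assms(5)] K[OF assms(6)] by (simp add: \<phi>_def m_assoc inv_cancel_assoc)
  finally show ?thesis by simp
qed

lemma holonomy_primitive:
  assumes "group Q" "primitive Q c f {0..1} \<kappa>"
  shows "holonomy Q c f = inv\<^bsub>Q\<^esub> \<kappa> 0 \<otimes>\<^bsub>Q\<^esub> \<kappa> 1"
  unfolding holonomy_def
proof (rule the_equality)
  fix q assume "\<exists>\<kappa>. primitive Q c f {0..1} \<kappa> \<and> q = inv\<^bsub>Q\<^esub> \<kappa> 0 \<otimes>\<^bsub>Q\<^esub> \<kappa> 1"
  then obtain \<kappa>' where "primitive Q c f {0..1} \<kappa>'" "q = inv\<^bsub>Q\<^esub> \<kappa>' 0 \<otimes>\<^bsub>Q\<^esub> \<kappa>' 1" by blast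
  then show "q = inv\<^bsub>Q\<^esub> \<kappa> 0 \<otimes>\<^bsub>Q\<^esub> \<kappa> 1"
    using primitive_unique[OF assms(1) _ assms(2), of \<kappa>' 0 1] by simp
qed (use assms in blast)

text \<open>A Lipschitz bound turns the \<delta> of \<kappa> into \<delta>/\<open>L\<close>. The
  maps \<open>h\<close> that occur are embeddings of subintervals and of the sides of a
  square.\<close>

lemma primitive_compose:
  assumes "primitive Q c f A \<kappa>" "h ` B \<subseteq> A" "L > 0"
    "\<And>s t. s \<in> B \<Longrightarrow> t \<in> B \<Longrightarrow> dist (h s) (h t) \<le> L * dist s t" "\<And>s. s \<in> B \<Longrightarrow> g s = f (h s)"
  shows "primitive Q c g B (\<kappa> \<circ> h)"
proof -
  obtain d where d: "d > 0" "\<And>s t. s \<in> A \<Longrightarrow> t \<in> A \<Longrightarrow> dist s t < d \<Longrightarrow>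
      c (f s) (f t) \<in> carrier Q \<and> \<kappa> s \<otimes>\<^bsub>Q\<^esub> c (f s) (f t) = \<kappa> t"
    using assms(1) unfolding primitive_def by blast
  show ?thesis unfolding primitive_def
  proof (intro conjI exI[of _ "d / L"] ballI impI)
    fix s t assume *: "s \<in> B" "t \<in> B" "dist s t < d / L"
    have "L * dist s t < d" using *(3) assms(3) by (simp add: field_simps)
    then have "dist (h s) (h t) < d" using assms(4)[OF *(1,2)] by linarith
    then show "c (g s) (g t) \<in> carrier Q" "(\<kappa> \<circ> h) s \<otimes>\<^bsub>Q\<^esub> c (g s) (g t) = (\<kappa> \<circ> h) t"
      using d(2)[of "h s" "h t"] * assms(2,5) by auto
  qed (use assms(1-3) d in \<open>auto simp: primitive_def image_subset_iff Pi_iff\<close>)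
qed

lemma primitive_subset: "primitive Q c f A \<kappa> \<Longrightarrow> B \<subseteq> A \<Longrightarrow> primitive Q c f B \<kappa>"
  unfolding primitive_def by (meson Pi_anti_mono subset_eq)

lemma primitive_exists_path:
  assumes "group Q" "local_cocycle Q Y c" "pathin Y f"
  obtains \<kappa> where "primitive Q c f {0..1::real} \<kappa>"
  using primitive_exists[OF assms(1,2), of "{0..1}" f] assms(3) by (auto simp: pathin_def)

lemma holonomy_closed:
  assumes "group Q" "local_cocycle Q Y c" "pathin Y f"
  shows "holonomy Q c f \<in> carrier Q"
proof -
  interpret group Q by fact
  obtain \<kappa> where k: "primitive Q c f {0..1} \<kappa>" using primitive_exists_path[OF assms] by blast
  then show ?thesis using holonomy_primitive[OF assms(1) k] primitive_carrier[OF k] by simp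
qed

text \<open>A primitive along the join restricts to primitives along both halves, and its value at
  1/2 cancels.\<close>

lemma holonomy_join:
  assumes "group Q" "local_cocycle Q Y c" "pathin Y f" "pathin Y g" "f 1 = g 0"
  shows "holonomy Q c (f +++ g) = holonomy Q c f \<otimes>\<^bsub>Q\<^esub> holonomy Q c g"
proof -
  interpret group Q by fact
  obtain \<kappa> where k: "primitive Q c (f +++ g) {0..1} \<kappa>"
    using primitive_exists_path[OF assms(1,2) pathin_join[OF assms(3-5)]] by blast
  have f: "primitive Q c f {0..1} (\<kappa> \<circ> (\<lambda>t. t / 2))"
    by (rule primitive_compose[OF k, where L = 1]) (auto simp: joinpaths_def dist_real_def)
  have g: "primitive Q c g {0..1} (\<kappa> \<circ> (\<lambda>t. t / 2 + 1/2))"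
    by (rule primitive_compose[OF k, where L = 1])
      (use assms(5) in \<open>auto simp: joinpaths_def dist_real_def\<close>)
  have K: "\<kappa> 0 \<in> carrier Q" "\<kappa> 1 \<in> carrier Q" "\<kappa> (1 / 2) \<in> carrier Q"
    using primitive_carrier[OF k] by auto
  have "inv\<^bsub>Q\<^esub> \<kappa> 0 \<otimes>\<^bsub>Q\<^esub> \<kappa> 1 = inv\<^bsub>Q\<^esub> \<kappa> 0 \<otimes>\<^bsub>Q\<^esub> \<kappa> (1/2) \<otimes>\<^bsub>Q\<^esub> (inv\<^bsub>Q\<^esub> \<kappa> (1/2) \<otimes>\<^bsub>Q\<^esub> \<kappa> 1)"
    using K by (simp add: m_assoc inv_cancel_assoc)
  then show ?thesis
    using holonomy_primitive[OF assms(1) k] holonomy_primitive[OF assms(1) f]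
      holonomy_primitive[OF assms(1) g]
    by simp
qed

text \<open>The value is idempotent, and the unit is the only idempotent of a group.\<close>

lemma local_cocycle_refl:
  assumes "group Q" "local_cocycle Q Y c" "y \<in> topspace Y"
  shows "c y y = \<one>\<^bsub>Q\<^esub>"
proof -
  interpret group Q by fact
  obtain \<U> where U: "topspace Y \<subseteq> \<Union>\<U>"
    "\<forall>U\<in>\<U>. \<forall>x\<in>U. \<forall>y\<in>U. c x y \<in> carrier Q \<and> (\<forall>z\<in>U. c x y \<otimes>\<^bsub>Q\<^esub> c y z = c x z)"
    using assms(2) unfolding local_cocycle_def by auto
  then obtain U where "U \<in> \<U>" "y \<in> U" using assms(3) by auto
  with U(2) have "c y y \<in> carrier Q" "c y y \<otimes>\<^bsub>Q\<^esub> c y y = c y y" by auto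
  then show ?thesis using l_cancel_one by blast
qed

text \<open>The homotopy has a primitive on the square. On the two sides where it rests at an end
  point this primitive is constant, so the primitives that it induces along \<open>f\<close> and
  \<open>g\<close> agree at both ends.\<close>

lemma holonomy_homotopic:
  assumes "group Q" "local_cocycle Q Y c" "path_homotopic Y f g"
  shows "holonomy Q c f = holonomy Q c g"
proof -
  interpret group Q by fact
  obtain k where k: "continuous_map (top_of_set ({0..1::real} \<times> {0..1::real})) Y k"
    "\<And>t. t \<in> {0..1} \<Longrightarrow> k (0, t) = f t" "\<And>t. t \<in> {0..1} \<Longrightarrow> k (1, t) = g t"
    "\<And>s. s \<in> {0..1} \<Longrightarrow> k (s, 0) = f 0" "\<And>s. s \<in> {0..1} \<Longrightarrow> k (s, 1) = f 1"
    using assms(3) unfolding path_homotopic_iff by auto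
  obtain \<kappa> where \<kappa>: "primitive Q c k ({0..1} \<times> {0..1}) \<kappa>"
    using primitive_exists[OF assms(1,2) _ _ k(1)] by (auto simp: compact_Times convex_Times)
  have f: "primitive Q c f {0..1} (\<kappa> \<circ> (\<lambda>t. (0, t)))"
    by (rule primitive_compose[OF \<kappa>, where L = 1]) (auto simp: k dist_Pair_Pair)
  have g: "primitive Q c g {0..1} (\<kappa> \<circ> (\<lambda>t. (1, t)))"
    by (rule primitive_compose[OF \<kappa>, where L = 1]) (auto simp: k dist_Pair_Pair)
  have const: "\<kappa> (0, b) = \<kappa> (1, b)" if b: "b \<in> {0, 1}" for b :: real
  proof -
    have "k (0, b) \<in> topspace Y" using k(1) b by (auto simp: continuous_map_def)
    then have "c (k (0, b)) (k (0, b)) = \<one>\<^bsub>Q\<^esub>" by (rule local_cocycle_refl[OF assms(1,2)])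
    then have "primitive Q c (\<lambda>s. k (0, b)) {0..1::real} (\<lambda>t. \<one>\<^bsub>Q\<^esub>)"
      unfolding primitive_def by (auto intro: exI[of _ 1])
    moreover have "primitive Q c (\<lambda>s. k (0, b)) {0..1} (\<kappa> \<circ> (\<lambda>s. (s, b)))"
      by (rule primitive_compose[OF \<kappa>, where L = 1]) (use b in \<open>auto simp: k dist_Pair_Pair\<close>)
    ultimately have *: "inv\<^bsub>Q\<^esub> (\<kappa> (0, b)) \<otimes>\<^bsub>Q\<^esub> \<kappa> (1, b) = \<one>\<^bsub>Q\<^esub>"
      using primitive_unique[OF assms(1), of c "\<lambda>s. k (0, b)" "{0..1}" "\<lambda>t. \<one>\<^bsub>Q\<^esub>" _ 0 1]
        by fastforce
    have K: "\<kappa> (0, b) \<in> carrier Q" "\<kappa> (1, b) \<in> carrier Q"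
      using primitive_carrier[OF \<kappa>, of "(0, b)"] primitive_carrier[OF \<kappa>, of "(1, b)"] b by auto
    have "\<kappa> (0, b) = \<kappa> (0, b) \<otimes>\<^bsub>Q\<^esub> (inv\<^bsub>Q\<^esub> (\<kappa> (0, b)) \<otimes>\<^bsub>Q\<^esub> \<kappa> (1, b))"
      using * K by simp
    then show ?thesis using K by (simp add: inv_cancel_assoc)
  qed
  show ?thesis
    using holonomy_primitive[OF assms(1) f] holonomy_primitive[OF assms(1) g] const[of 0]
      const[of 1] by simp
qed

lemma holonomy_const:
  assumes "group Q" "local_cocycle Q Y c" "y \<in> topspace Y"
  shows "holonomy Q c (\<lambda>t. y) = \<one>\<^bsub>Q\<^esub>"
proof -
  interpret group Q by fact
  have "primitive Q c (\<lambda>t. y) {0..1::real} (\<lambda>t. \<one>\<^bsub>Q\<^esub>)"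
    using local_cocycle_refl[OF assms] unfolding primitive_def by (auto intro: exI[of _ 1])
  from holonomy_primitive[OF assms(1) this] show ?thesis by simp
qed

text \<open>Follows from homotopy invariance, as the join with the reversed path contracts; this
  avoids comparing \<open>c x y\<close> with \<open>c y x\<close>.\<close>

lemma holonomy_reversepath:
  assumes "group Q" "local_cocycle Q Y c" "pathin Y f"
  shows "holonomy Q c (reversepath f) = inv\<^bsub>Q\<^esub> holonomy Q c f"
proof -
  interpret group Q by fact
  note r = pathin_reversepath[OF assms(3)]
  have "holonomy Q c (f +++ reversepath f) = \<one>\<^bsub>Q\<^esub>"
    using holonomy_homotopic[OF assms(1,2) path_homotopic_rinv[OF assms(3)]]
      holonomy_const[OF assms(1,2)] pathin_ends[OF assms(3)] by simp
  then have "holonomy Q c f \<otimes>\<^bsub>Q\<^esub> holonomy Q c (reversepath f) = \<one>\<^bsub>Q\<^esub>"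
    using holonomy_join[OF assms(1,2,3) r] by simp
  then show ?thesis
    using holonomy_closed[OF assms(1,2,3)] holonomy_closed[OF assms(1,2) r]
      by (metis inv_equality inv_inv)
qed

text \<open>The chosen representative does not matter, by homotopy invariance.\<close>

definition holonomy_map :: "('q, 'm) monoid_scheme \<Rightarrow> ('y \<Rightarrow> 'y \<Rightarrow> 'q) \<Rightarrow> (real \<Rightarrow> 'y) set \<Rightarrow> 'q" where
  "holonomy_map Q c C = holonomy Q c (SOME f. f \<in> C)"

lemma holonomy_map_loop_class:
  assumes "group Q" "local_cocycle Q Y c" "f \<in> based_loops Y y"
  shows "holonomy_map Q c (loop_class Y y f) = holonomy Q c f"
proof -
  have "(SOME g. g \<in> loop_class Y y f) \<in> loop_class Y y f"
    using someI[of "\<lambda>g. g \<in> loop_class Y y f", OF in_loop_class[OF assms(3)]] .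
  then have "path_homotopic Y f (SOME g. g \<in> loop_class Y y f)"
    using loop_class_path_homotopic[OF assms(3)] by simp
  then show ?thesis
    using holonomy_homotopic[OF assms(1,2)] by (simp add: holonomy_map_def)
qed

lemma holonomy_map_hom:
  assumes "group Q" "local_cocycle Q Y c"
  shows "holonomy_map Q c \<in> hom (fundamental_group Y y) Q"
proof (rule homI)
  fix A assume "A \<in> carrier (fundamental_group Y y)"
  then obtain f where f: "f \<in> based_loops Y y" and A: "A = loop_class Y y f"
    by (auto simp: carrier_fundamental_group)
  have f': "pathin Y f" "f 0 = y" "f 1 = y" using f by (auto simp: based_loops_def)
  show "holonomy_map Q c A \<in> carrier Q"
    using holonomy_closed[OF assms f'(1)] by (simp add: A holonomy_map_loop_class[OF assms f])
  fix B assume "B \<in> carrier (fundamental_group Y y)"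
  then obtain g where g: "g \<in> based_loops Y y" and B: "B = loop_class Y y g"
    by (auto simp: carrier_fundamental_group)
  have g': "pathin Y g" "g 0 = y" "g 1 = y" using g by (auto simp: based_loops_def)
  show "holonomy_map Q c (A \<otimes>\<^bsub>fundamental_group Y y\<^esub> B) = holonomy_map Q c A
    \<otimes>\<^bsub>Q\<^esub> holonomy_map Q c B"
    using f g f' g' holonomy_join[OF assms f'(1) g'(1)]
    by (simp add: A B fundamental_group_mult holonomy_map_loop_class[OF assms] based_loops_join)
qed

section \<open>Rips cocycles, samples and geodesics\<close>

definition rips_cocycle ::
    "('q, 'm) monoid_scheme \<Rightarrow> 'a::metric_space set \<Rightarrow> real \<Rightarrow> ('a \<Rightarrow> 'a \<Rightarrow> 'q) \<Rightarrow> bool" where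
  "rips_cocycle Q X r e \<longleftrightarrow>
     (\<forall>x\<in>X. \<forall>y\<in>X. \<forall>z\<in>X. dist x y < r \<longrightarrow> dist y z < r \<longrightarrow> dist x z < r \<longrightarrow>
        e x y \<in> carrier Q \<and> e x y \<otimes>\<^bsub>Q\<^esub> e y z = e x z)"

lemma rips_cocycleD:
  assumes "rips_cocycle Q X r e" "x \<in> X" "y \<in> X" "z \<in> X" "dist x y < r" "dist y z < r"
      "dist x z < r"
  shows "e x y \<otimes>\<^bsub>Q\<^esub> e y z = e x z"
  using assms unfolding rips_cocycle_def by blast

lemma rips_cocycle_closed:
  assumes "rips_cocycle Q X r e" "x \<in> X" "y \<in> X" "dist x y < r"
  shows "e x y \<in> carrier Q"
proof -
  have "dist y y < r" using order_le_less_trans[OF zero_le_dist assms(4)] by simp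
  then show ?thesis using assms unfolding rips_cocycle_def by blast
qed

text \<open>Two points of a ball of radius r/2 are closer than r, so the balls of this radius form
  the required cover.\<close>

lemma local_cocycle_rips:
  assumes "rips_cocycle Q X r e" "r > 0"
  shows "local_cocycle Q (top_of_set X) e"
  unfolding local_cocycle_def
proof (intro exI[of _ "(\<lambda>x. X \<inter> ball x (r / 2)) ` X"] conjI ballI)
  fix U x y assume U: "U \<in> (\<lambda>x. X \<inter> ball x (r / 2)) ` X" and xy: "x \<in> U" "y \<in> U"
  have d: "dist u v < r" if "u \<in> U" "v \<in> U" for u v
  proof -
    obtain w where "U = X \<inter> ball w (r / 2)" using U by blast
    then show ?thesis using that dist_triangle_half_r[of w u r v] by auto
  qed
  have UX: "U \<subseteq> X" using U by auto
  show "e x y \<in> carrier Q"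
    using rips_cocycle_closed[OF assms(1)] d xy UX by blast
  fix z assume "z \<in> U"
  then show "e x y \<otimes>\<^bsub>Q\<^esub> e y z = e x z"
    using rips_cocycleD[OF assms(1)] d xy UX by blast
qed (use assms(2) in auto)

lemma rips_cocycle_refl:
  assumes "group Q" "rips_cocycle Q X r e" "r > 0" "x \<in> X"
  shows "e x x = \<one>\<^bsub>Q\<^esub>"
  using local_cocycle_refl[OF assms(1) local_cocycle_rips[OF assms(2,3)]] assms(4) by simp

section \<open>Samples of paths and the holonomy along them\<close>

fun edge_prod :: "('q, 'm) monoid_scheme \<Rightarrow> ('v \<Rightarrow> 'v \<Rightarrow> 'q) \<Rightarrow> 'v list \<Rightarrow> 'q" where
  "edge_prod Q e (u # v # vs) = e u v \<otimes>\<^bsub>Q\<^esub> edge_prod Q e (v # vs)"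
| "edge_prod Q e _ = \<one>\<^bsub>Q\<^esub>"

text \<open>In contrast to \<open>r_sample\<close> this does not close up, admits repeated times and
  bounds distances of pairs instead of a diameter. It passes to the tail of the list, as inductions
  require.\<close>

definition fine_sample :: "real \<Rightarrow> (real \<Rightarrow> 'a::metric_space) \<Rightarrow> real list \<Rightarrow> bool" where
  "fine_sample r f ts \<longleftrightarrow>
     successively (\<lambda>s t. s \<le> t \<and> (\<forall>u\<in>{s..t}. \<forall>v\<in>{s..t}. dist (f u) (f v) < r)) ts \<and> set ts \<subseteq> {0..1}"

lemma fine_sample_Cons:
  "fine_sample r f (s # t # ts) \<longleftrightarrow>
     s \<in> {0..1} \<and> s \<le> t \<and> (\<forall>u\<in>{s..t}. \<forall>v\<in>{s..t}. dist (f u) (f v) < r) \<and> fine_sample r f (t # ts)"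
  by (auto simp: fine_sample_def)

text \<open>All points of the interval have images within r of each other, so the cocycle measured
  from the starting point is a primitive without any subdivision.\<close>

lemma primitive_short:
  fixes s t :: real
  assumes "group Q" "rips_cocycle Q X r e" "f ` {s..t} \<subseteq> X"
    "\<And>u v. u \<in> {s..t} \<Longrightarrow> v \<in> {s..t} \<Longrightarrow> dist (f u) (f v) < r"
  shows "primitive Q e f {s..t} (\<lambda>u. e (f s) (f u))"
  unfolding primitive_def
proof (intro conjI exI[of _ 1] ballI impI)
  fix u v assume uv: "u \<in> {s..t}" "v \<in> {s..t}"
  then have s: "s \<in> {s..t}" by auto
  have X: "f s \<in> X" "f u \<in> X" "f v \<in> X" using s uv assms(3) by blast+
  show "e (f u) (f v) \<in> carrier Q" "e (f s) (f u) \<otimes>\<^bsub>Q\<^esub> e (f u) (f v) = e (f s) (f v)"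
    using rips_cocycle_closed[OF assms(2) X(2,3)] rips_cocycleD[OF assms(2) X] assms(4) s uv
      by blast+
next
  show "(\<lambda>u. e (f s) (f u)) \<in> {s..t} \<rightarrow> carrier Q"
  proof
    fix u assume u: "u \<in> {s..t}"
    then have s: "s \<in> {s..t}" by auto
    show "e (f s) (f u) \<in> carrier Q"
      using rips_cocycle_closed[OF assms(2)] assms(3,4) s u by blast
  qed
qed auto

text \<open>By uniqueness the increment of any primitive is that of \<open>primitive_short\<close>,
  the single edge between the ends, however long the time interval is.\<close>

lemma primitive_short_step:
  fixes s t :: real
  assumes "group Q" "rips_cocycle Q X r e" "f ` {0..1} \<subseteq> X" "primitive Q e f {0..1} \<kappa>"
    "0 \<le> s" "s \<le> t" "t \<le> 1" "\<And>u v. u \<in> {s..t} \<Longrightarrow> v \<in> {s..t} \<Longrightarrow> dist (f u) (f v) < r"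
  shows "\<kappa> t = \<kappa> s \<otimes>\<^bsub>Q\<^esub> e (f s) (f t)"
proof -
  interpret group Q by fact
  have st: "s \<in> {s..t}" "t \<in> {s..t}" "{s..t} \<subseteq> {0..1}" using assms(5-7) by auto
  have r: "r > 0" using assms(8)[OF st(1,1)] by simp
  have X: "f s \<in> X" "f t \<in> X" using assms(3) st by blast+
  have 1: "primitive Q e f {s..t} (\<lambda>u. e (f s) (f u))"
    using assms(3,8) st(3) by (intro primitive_short[OF assms(1,2)]) blast+
  have 2: "primitive Q e f {s..t} \<kappa>"
    by (rule primitive_subset[OF assms(4) st(3)])
  have "inv\<^bsub>Q\<^esub> (e (f s) (f s)) \<otimes>\<^bsub>Q\<^esub> e (f s) (f t) = inv\<^bsub>Q\<^esub> \<kappa> s \<otimes>\<^bsub>Q\<^esub> \<kappa> t"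
    using primitive_unique[OF assms(1) 1 2 _ st(1,2)] by simp
  moreover have "e (f s) (f s) = \<one>\<^bsub>Q\<^esub>" using rips_cocycle_refl[OF assms(1,2) r X(1)] .
  moreover have "e (f s) (f t) \<in> carrier Q" "\<kappa> s \<in> carrier Q" "\<kappa> t \<in> carrier Q"
    using rips_cocycle_closed[OF assms(2) X assms(8)[OF st(1,2)]] primitive_carrier[OF assms(4)] st
      by blast+
  ultimately show ?thesis by (simp add: inv_cancel_assoc)
qed

lemma edge_prod_closed:
  assumes "group Q" "rips_cocycle Q X r e" "successively (\<lambda>u v. dist u v < r) vs" "set vs \<subseteq> X"
  shows "edge_prod Q e vs \<in> carrier Q"
proof -
  interpret group Q by fact
  show ?thesis using assms(3,4)
  proof (induction vs rule: induct_list012)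
    case (3 u v vs)
    then show ?case using rips_cocycle_closed[OF assms(2), of u v] by auto
  qed auto
qed

lemma fine_successively:
  "fine_sample r f ts \<Longrightarrow> successively (\<lambda>u v. dist u v < r) (map f ts)"
  by (induction ts rule: induct_list012) (auto simp: fine_sample_Cons)

lemma primitive_fine:
  assumes "group Q" "rips_cocycle Q X r e" "f ` {0..1} \<subseteq> X" "primitive Q e f {0..1} \<kappa>"
    "fine_sample r f ts" "ts \<noteq> []"
  shows "\<kappa> (last ts) = \<kappa> (hd ts) \<otimes>\<^bsub>Q\<^esub> edge_prod Q e (map f ts)"
proof -
  interpret group Q by fact
  show ?thesis using assms(5,6)
  proof (induction ts rule: induct_list012)
    case (2 s)
    then show ?case using primitive_carrier[OF assms(4), of s] by (auto simp: fine_sample_def)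
  next
    case (3 s t ts)
    have t: "t \<le> 1" using 3(3) by (auto simp: fine_sample_def)
    have s: "0 \<le> s" "s \<le> t" using 3(3) by (auto simp: fine_sample_Cons)
    have X: "f s \<in> X" "f t \<in> X" using assms(3) s t by auto
    have d: "dist (f u) (f v) < r" if "u \<in> {s..t}" "v \<in> {s..t}" for u v
      using 3(3) that by (auto simp: fine_sample_Cons)
    have st: "\<kappa> t = \<kappa> s \<otimes>\<^bsub>Q\<^esub> e (f s) (f t)"
      by (rule primitive_short_step[OF assms(1-4)]) (use s t d in auto)
    have f: "fine_sample r f (t # ts)" using 3(3) by (simp add: fine_sample_Cons)
    have c: "edge_prod Q e (map f (t # ts)) \<in> carrier Q"
      using fine_successively[OF f] assms(3) f
      by (intro edge_prod_closed[OF assms(1,2)]) (auto simp: fine_sample_def)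
    have e: "e (f s) (f t) \<in> carrier Q" using rips_cocycle_closed[OF assms(2) X] d s by auto
    have k: "\<kappa> s \<in> carrier Q" using primitive_carrier[OF assms(4)] s t by auto
    have "\<kappa> (last (s # t # ts)) = (\<kappa> s \<otimes>\<^bsub>Q\<^esub> e (f s) (f t)) \<otimes>\<^bsub>Q\<^esub> edge_prod Q e (map f (t # ts))"
      using 3(2)[OF f] st by simp
    then show ?case using c e k by (simp add: m_assoc)
  qed auto
qed

lemma holonomy_fine:
  assumes "group Q" "rips_cocycle Q X r e" "r > 0" "pathin (top_of_set X) f"
    "fine_sample r f ts" "ts \<noteq> []" "hd ts = 0" "last ts = 1"
  shows "holonomy Q e f = edge_prod Q e (map f ts)"
proof -
  interpret group Q by fact
  have X: "f ` {0..1} \<subseteq> X" using assms(4) by (auto simp: pathin_def continuous_map_in_subtopology)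
  obtain \<kappa> where k: "primitive Q e f {0..1} \<kappa>"
    using primitive_exists_path[OF assms(1) local_cocycle_rips[OF assms(2,3)] assms(4)] by blast
  have "edge_prod Q e (map f ts) \<in> carrier Q"
    using fine_successively[OF assms(5)] X assms(5)
    by (intro edge_prod_closed[OF assms(1,2)]) (auto simp: fine_sample_def)
  then show ?thesis
    using holonomy_primitive[OF assms(1) k] primitive_fine[OF assms(1,2) X k assms(5,6)] assms(7,8)
      primitive_carrier[OF k, of 0] by (simp add: inv_cancel_assoc)
qed

lemma edge_prod_append:
  assumes "group Q" "rips_cocycle Q X r e" "successively (\<lambda>u v. dist u v < r) (vs @ [w])"
      "set (vs @ [w]) \<subseteq> X" "vs \<noteq> []"
  shows "edge_prod Q e (vs @ [w]) = edge_prod Q e vs \<otimes>\<^bsub>Q\<^esub> e (last vs) w"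
proof -
  interpret group Q by fact
  show ?thesis using assms(3-5)
  proof (induction vs rule: induct_list012)
    case (2 u)
    then show ?case using rips_cocycle_closed[OF assms(2), of u w] by auto
  next
    case (3 u v vs)
    have s: "dist u v < r" "successively (\<lambda>u v. dist u v < r) ((v # vs) @ [w])" using 3(3) by auto
    have s': "successively (\<lambda>u v. dist u v < r) (v # vs)" "dist (last (v # vs)) w < r"
      using s(2) unfolding successively_append_iff by auto
    have X: "u \<in> X" "v \<in> X" "last (v # vs) \<in> X" "w \<in> X" "set (v # vs) \<subseteq> X"
      using 3(4) last_in_set[of "v # vs"] by (auto split: if_splits)
    have "e u v \<in> carrier Q" "e (last (v # vs)) w \<in> carrier Q" "edge_prod Q e (v # vs) \<in> carrier Q"
      using rips_cocycle_closed[OF assms(2)] edge_prod_closed[OF assms(1,2)] s s' X by blast+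
    then show ?case using 3 by (simp add: m_assoc)
  qed auto
qed

lemma dist_less_diameter:
  assumes "path f" "T \<subseteq> {0..1}" "diameter (f ` T) < r" "s \<in> T" "t \<in> T"
  shows "dist (f s) (f t) < r"
proof -
  have "bounded (f ` T)"
    using bounded_subset[OF bounded_path_image[OF assms(1)]] assms(2)
      by (simp add: path_image_def image_mono)
  then have "dist (f s) (f t) \<le> diameter (f ` T)"
    using assms(4,5) by (intro diameter_bounded_bound) auto
  then show ?thesis using assms(3) by linarith
qed

lemma path_pathin_canon: "pathin (top_of_set X) f \<Longrightarrow> path f"
    "pathin (top_of_set X) f \<Longrightarrow> t \<in> {0..1} \<Longrightarrow> f t \<in> X"
  by (auto simp: pathin_canon_iff)

lemma r_sample_fine:
  assumes "path f" "r_sample r f ts"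
  shows "fine_sample r f ts"
proof -
  have s: "sorted_wrt (<) ts" "set ts \<subseteq> {0..1}" using assms(2) by (auto simp: r_sample_def)
  have "ts ! i \<le> ts ! Suc i
    \<and> (\<forall>u\<in>{ts ! i..ts ! Suc i}. \<forall>v\<in>{ts ! i..ts ! Suc i}. dist (f u) (f v) < r)"
    if "Suc i < length ts" for i
  proof (intro conjI ballI)
    show "ts ! i \<le> ts ! Suc i" using s(1) that by (simp add: sorted_wrt_nth_less less_imp_le)
    have 01: "{ts ! i..ts ! Suc i} \<subseteq> {0..1}"
    proof -
      have "ts ! i \<in> {0..1}" "ts ! Suc i \<in> {0..1}"
        using s(2) that nth_mem[of i ts] nth_mem[of "Suc i" ts] by (meson Suc_lessD subsetD)+
      then show ?thesis by auto
    qed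
    fix u v assume "u \<in> {ts ! i..ts ! Suc i}" "v \<in> {ts ! i..ts ! Suc i}"
    then show "dist (f u) (f v) < r"
      using dist_less_diameter[OF assms(1) 01] assms(2) that by (auto simp: r_sample_def)
  qed
  then show ?thesis using s(2) by (auto simp: fine_sample_def successively_conv_nth)
qed

text \<open>A sample may begin after time 0; hence the conjugation by the edge from
  \<open>f 0\<close> to its first point.\<close>

lemma r_sample_holonomy:
  assumes "group Q" "rips_cocycle Q X r e" "r > 0" "pathin (top_of_set X) f" "f 0 = f 1"
      "r_sample r f ts"
  defines "x \<equiv> e (f 0) (f (hd ts))"
  shows "x \<in> carrier Q" "edge_prod Q e (sample_loop f ts) = inv\<^bsub>Q\<^esub> x \<otimes>\<^bsub>Q\<^esub> holonomy Q e f \<otimes>\<^bsub>Q\<^esub> x"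
    "successively (\<lambda>u v. dist u v < r) (sample_loop f ts)"
proof -
  interpret group Q by fact
  note p = path_pathin_canon[OF assms(4)]
  have X: "f ` {0..1} \<subseteq> X" using p by auto
  obtain \<kappa> where k: "primitive Q e f {0..1} \<kappa>"
    using primitive_exists_path[OF assms(1) local_cocycle_rips[OF assms(2,3)] assms(4)] by blast
  note F = r_sample_fine[OF p(1) assms(6)]
  have ne: "ts \<noteq> []" using assms(6) by (auto simp: r_sample_def)
  let ?a = "hd ts" and ?z = "last ts"
  have a: "?a \<in> {0..1}" "?z \<in> {0..1}"
    using assms(6) hd_in_set[OF ne] last_in_set[OF ne] unfolding r_sample_def by blast+
  have d: "dist (f u) (f v) < r" if "u \<in> {0..?a} \<union> {?z..1}" "v \<in> {0..?a} \<union> {?z..1}" for u v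
    by (rule dist_less_diameter[OF p(1) _ _ that]) (use assms(6) a in \<open>auto simp: r_sample_def\<close>)
  have fX: "f 0 \<in> X" "f ?a \<in> X" "f ?z \<in> X" "f 1 \<in> X" using X a by auto
  have k0: "\<kappa> ?a = \<kappa> 0 \<otimes>\<^bsub>Q\<^esub> x" unfolding x_def
    by (rule primitive_short_step[OF assms(1,2) X k]) (use a d in auto)
  have k1: "\<kappa> 1 = \<kappa> ?z \<otimes>\<^bsub>Q\<^esub> e (f ?z) (f 1)"
    by (rule primitive_short_step[OF assms(1,2) X k]) (use a d in auto)
  have kz: "\<kappa> ?z = \<kappa> ?a \<otimes>\<^bsub>Q\<^esub> edge_prod Q e (map f ts)"
    by (rule primitive_fine[OF assms(1,2) X k F ne])
  have da: "dist (f 0) (f ?a) < r" "dist (f ?z) (f 1) < r" "dist (f 1) (f ?a) < r"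
    "dist (f ?z) (f ?a) < r"
    using d a by auto
  \<comment> \<open>The closing edge is split at \<open>f 0 = f 1\<close>; the three distances are
    below r by the last clause of \<open>r_sample\<close>.\<close>
  have ez: "e (f ?z) (f ?a) = e (f ?z) (f 1) \<otimes>\<^bsub>Q\<^esub> x"
    unfolding x_def using rips_cocycleD[OF assms(2) fX(3,4,2) da(2,3,4)] assms(5) by simp
  show x: "x \<in> carrier Q" unfolding x_def using rips_cocycle_closed[OF assms(2) fX(1,2) da(1)] .
  have e1: "e (f ?z) (f 1) \<in> carrier Q" using rips_cocycle_closed[OF assms(2) fX(3,4) da(2)] .
  have c: "\<kappa> 0 \<in> carrier Q" using primitive_carrier[OF k, of 0] by simp
  have P: "edge_prod Q e (map f ts) \<in> carrier Q"
    using fine_successively[OF F] X F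
    by (intro edge_prod_closed[OF assms(1,2)]) (auto simp: fine_sample_def)
  show s: "successively (\<lambda>u v. dist u v < r) (sample_loop f ts)"
    using fine_successively[OF F] da ne
      by (auto simp: sample_loop_def successively_append_iff last_map)
  have "edge_prod Q e (sample_loop f ts) = edge_prod Q e (map f ts) \<otimes>\<^bsub>Q\<^esub> e (f ?z) (f ?a)"
    unfolding sample_loop_def
    using edge_prod_append[OF assms(1,2), of "map f ts" "f ?a"] s ne F X fX
    by (auto simp: sample_loop_def last_map fine_sample_def)
  also have "\<dots> = inv\<^bsub>Q\<^esub> x \<otimes>\<^bsub>Q\<^esub> (inv\<^bsub>Q\<^esub> \<kappa> 0 \<otimes>\<^bsub>Q\<^esub> \<kappa> 1) \<otimes>\<^bsub>Q\<^esub> x"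
    unfolding k1 kz k0 ez using x e1 c P by (simp add: m_assoc inv_cancel_assoc)
  finally show "edge_prod Q e (sample_loop f ts) = inv\<^bsub>Q\<^esub> x \<otimes>\<^bsub>Q\<^esub> holonomy Q e f \<otimes>\<^bsub>Q\<^esub> x"
    using holonomy_primitive[OF assms(1) k] by simp
qed

lemma fine_exists:
  assumes "path f" "r > 0"
  obtains ts where "sorted_wrt (<) ts" "fine_sample r f ts" "hd ts = 0" "last ts = 1" "ts \<noteq> []"
proof -
  have "uniformly_continuous_on {0..1} f"
    using assms(1) by (intro compact_uniformly_continuous) (auto simp: path_def)
  then obtain d
    where d: "d > 0" "\<And>s t. s \<in> {0..1} \<Longrightarrow> t \<in> {0..1} \<Longrightarrow> dist s t < d \<Longrightarrow> dist (f s) (f t) < r"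
    using assms(2) unfolding uniformly_continuous_on_def by metis
  obtain n where n: "inverse (real (Suc n)) < d" using reals_Archimedean[OF d(1)] by blast
  let ?N = "Suc n"
  let ?ts = "map (\<lambda>i. real i / real ?N) [0..<Suc ?N]"
  show thesis
  proof (rule that[of ?ts])
    show "sorted_wrt (<) ?ts"
      unfolding sorted_wrt_map
      by (rule sorted_wrt_mono_rel[OF _ sorted_wrt_upt])
        (auto simp: divide_strict_right_mono simp del: upt_Suc)
    show "fine_sample r f ?ts"
      unfolding fine_sample_def successively_conv_nth
    proof (intro conjI allI impI ballI)
      fix i assume i: "Suc i < length ?ts"
      then have nth: "?ts ! i = real i / real ?N" "?ts ! Suc i = real (Suc i) / real ?N"
        by (simp_all del: upt_Suc of_nat_Suc add: nth_map)
      show "?ts ! i \<le> ?ts ! Suc i" unfolding nth by (rule divide_right_mono) auto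
      fix u v assume uv: "u \<in> {?ts ! i..?ts ! Suc i}" "v \<in> {?ts ! i..?ts ! Suc i}"
      have len: "real (Suc i) / real ?N = real i / real ?N + inverse (real ?N)"
        by (simp add: field_simps)
      have "dist u v \<le> inverse (real ?N)"
        using uv unfolding nth len dist_real_def by auto
      moreover have "0 \<le> real i / real ?N" "real (Suc i) / real ?N \<le> 1"
        using i by (auto simp del: upt_Suc of_nat_Suc simp: field_simps)
      ultimately show "dist (f u) (f v) < r"
        using uv n unfolding nth atLeastAtMost_iff
          by (intro d(2)) (unfold atLeastAtMost_iff, linarith+)
    qed (auto simp: field_simps)
    show "hd ?ts = 0" by (simp add: hd_map del: upt_Suc)
    show "last ?ts = 1" by (simp add: last_map)
    show "?ts \<noteq> []" by simp
  qed
qed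

text \<open>Distances below \<open>r'\<close> only bound the diameter by \<open>r'\<close> itself,
  hence the smaller scale. The part that closes up consists of the times 0 and 1, where
  \<open>f\<close> has one value.\<close>

lemma fine_r_sample:
  assumes "path f" "f 0 = f 1" "fine_sample r' f ts" "sorted_wrt (<) ts" "hd ts = 0" "last ts = 1"
      "ts \<noteq> []" "r' < r" "0 < r"
  shows "r_sample r f ts"
  unfolding r_sample_def
proof (intro conjI allI impI)
  fix i assume i: "Suc i < length ts"
  then have "\<forall>u\<in>{ts ! i..ts ! Suc i}. \<forall>v\<in>{ts ! i..ts ! Suc i}. dist (f u) (f v) < r'"
    "ts ! i \<le> ts ! Suc i"
    using assms(3) by (auto simp: fine_sample_def successively_conv_nth)
  then have "diameter (f ` {ts ! i..ts ! Suc i}) \<le> r'"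
    by (intro diameter_le_dist) (auto simp: less_imp_le)
  then show "diameter (f ` {ts ! i..ts ! Suc i}) < r" using assms(8) by linarith
next
  have "f ` ({0..hd ts} \<union> {last ts..1}) = {f 0}" using assms by auto
  then show "diameter (f ` ({0..hd ts} \<union> {last ts..1})) < r" using assms(9) by simp
qed (use assms in \<open>auto simp: fine_sample_def\<close>)

lemma r_sample_exists:
  assumes "path f" "f 0 = f 1" "r > 0"
  obtains ts where "r_sample r f ts" "hd ts = 0"
proof -
  obtain ts where "sorted_wrt (<) ts" "fine_sample (r / 2) f ts" "hd ts = 0" "last ts = 1" "ts \<noteq> []"
    using fine_exists[OF assms(1), of "r / 2"] assms(3) by auto
  then show thesis using fine_r_sample[OF assms(1,2), of "r / 2" ts r] assms(3) that by auto
qed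

section \<open>Geodesics and loops in small balls\<close>

definition is_geodesic :: "'a::metric_space set \<Rightarrow> 'a \<Rightarrow> 'a \<Rightarrow> (real \<Rightarrow> 'a) \<Rightarrow> bool" where
  "is_geodesic X x y \<gamma> \<longleftrightarrow> pathin (top_of_set X) \<gamma> \<and> \<gamma> 0 = x \<and> \<gamma> 1 = y \<and>
     (\<forall>s t. 0 \<le> s \<longrightarrow> s \<le> t \<longrightarrow> t \<le> 1 \<longrightarrow> dist x (\<gamma> s) + dist (\<gamma> s) (\<gamma> t) + dist (\<gamma> t) y \<le> dist x y)"

text \<open>Length is a supremum over inscribed polygons. The polygon with times 0, s, t, 1 yields
  the inequality of \<open>is_geodesic\<close>, through which lengths enter all later
  estimates.\<close>

lemma geodesic_exists:
  assumes "geodesic_space X" "x \<in> X" "y \<in> X"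
  obtains \<gamma> where "is_geodesic X x y \<gamma>"
proof -
  obtain \<gamma> where g: "path \<gamma>" "path_image \<gamma> \<subseteq> X" "pathstart \<gamma> = x" "pathfinish \<gamma> = y"
    "path_length \<gamma> = ereal (dist x y)"
    using assms unfolding geodesic_space_def by blast
  have e: "\<gamma> 0 = x" "\<gamma> 1 = y" using g by (auto simp: pathstart_def pathfinish_def)
  have "dist x (\<gamma> s) + dist (\<gamma> s) (\<gamma> t) + dist (\<gamma> t) y \<le> dist x y" if "0 \<le> s" "s \<le> t" "t \<le> 1"
    for s t
  proof -
    have "ereal (\<Sum>i<length [0, s, t, 1] - 1. dist (\<gamma> ([0, s, t, 1] ! i)) (\<gamma> ([0, s, t, 1] ! Suc i)))
      \<le> path_length \<gamma>"
      unfolding path_length_def by (rule SUP_upper) (use that in auto)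
    then show ?thesis by (simp add: g e eval_nat_numeral)
  qed
  then show thesis using that[of \<gamma>] g e unfolding is_geodesic_def
    by (auto simp: pathin_canon_iff path_image_def)
qed

lemma is_geodesic_dist:
  assumes "is_geodesic X x y \<gamma>" "s \<in> {0..1}" "t \<in> {0..1}"
  shows "dist (\<gamma> s) (\<gamma> t) \<le> dist x y"
proof -
  have *: "dist (\<gamma> s) (\<gamma> t) \<le> dist x y" if "0 \<le> s" "s \<le> t" "t \<le> 1" for s t
  proof -
    have "dist x (\<gamma> s) + dist (\<gamma> s) (\<gamma> t) + dist (\<gamma> t) y \<le> dist x y"
      using assms(1) that unfolding is_geodesic_def by blast
    then show ?thesis using zero_le_dist[of x "\<gamma> s"] zero_le_dist[of "\<gamma> t" y] by linarith
  qed
  show ?thesis using *[of s t] *[of t s] assms(2,3) by (cases "s \<le> t") (auto simp: dist_commute)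
qed

lemma is_geodesic_between:
  assumes "is_geodesic X x y \<gamma>" "t \<in> {0..1}"
  shows "dist x (\<gamma> t) + dist (\<gamma> t) y \<le> dist x y"
proof -
  have "dist x (\<gamma> t) + dist (\<gamma> t) (\<gamma> t) + dist (\<gamma> t) y \<le> dist x y"
    using assms unfolding is_geodesic_def by (meson atLeastAtMost_iff order_refl)
  then show ?thesis by simp
qed

text \<open>On a geodesic the distance from \<open>x\<close> takes the value
  \<open>dist x y / 3\<close> by continuity. The bounds are in terms of \<open>d\<close>, which will
  be the radius of a ball with centre \<open>x\<close>.\<close>

lemma geodesic_third:
  assumes "geodesic_space X" "x \<in> X" "y \<in> X" "dist x y \<le> d"
  shows "\<exists>a\<in>X. dist x a \<le> d / 3 \<and> dist a y \<le> 2 * d / 3"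
proof -
  obtain \<gamma> where g: "is_geodesic X x y \<gamma>" using geodesic_exists[OF assms(1-3)] .
  then have p: "pathin (top_of_set X) \<gamma>" "\<gamma> 0 = x" "\<gamma> 1 = y" by (auto simp: is_geodesic_def)
  have "continuous_on {0..1} (\<lambda>t. dist x (\<gamma> t))"
    using path_pathin_canon(1)[OF p(1)] unfolding path_def by (intro continuous_intros)
  then obtain t where t: "0 \<le> t" "t \<le> 1" "dist x (\<gamma> t) = dist x y / 3"
    using IVT'[of "\<lambda>t. dist x (\<gamma> t)" 0 "dist x y / 3" 1] p by auto
  then show ?thesis
    using is_geodesic_between[OF g, of t] path_pathin_canon(2)[OF p(1), of t] assms(4)
    by (intro bexI[of _ "\<gamma> t"]) auto
qed

text \<open>Coning off a loop in a ball of radius \<open>d < 3r/2\<close>: the geodesics to the centre are cut at a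
  third of the radius, so that both the inner and the outer parts consist of edges shorter than
  \<open>r\<close>.\<close>

lemma holonomy_small_ball:
  assumes "geodesic_space X" "group Q" "rips_cocycle Q X r e" "pathin (top_of_set X) f" "f 0 = f 1"
    "x \<in> X" "d < 3 * r / 2" "f ` {0..1} \<subseteq> cball x d"
  shows "holonomy Q e f = \<one>\<^bsub>Q\<^esub>"
proof -
  interpret group Q by fact
  have "f 0 \<in> cball x d" using assms(8) by (auto simp: image_subset_iff)
  then have "dist x (f 0) \<le> d" by simp
  then have d0: "0 \<le> d" using zero_le_dist[of x "f 0"] by linarith
  obtain a
    where a: "\<And>y. y \<in> X \<Longrightarrow> dist x y \<le> d \<Longrightarrow> a y \<in> X \<and> dist x (a y) \<le> d / 3 \<and> dist (a y) y \<le> 2 * d / 3"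
    using geodesic_third[OF assms(1,6)]
      bchoice[of "{y \<in> X. dist x y \<le> d}" "\<lambda>y a. a \<in> X \<and> dist x a \<le> d / 3 \<and> dist a y \<le> 2 * d / 3"]
    by (metis (no_types, lifting) mem_Collect_eq)
  \<comment> \<open>An outer edge has length at most 2d/3; moving its end by less than \<epsilon>
    keeps it below r.\<close>
  define \<epsilon> where "\<epsilon> = r - 2 * d / 3"
  have e: "\<epsilon> > 0" using assms(7) by (simp add: \<epsilon>_def)
  \<comment> \<open>Going out to y and on to z equals going out to z. The difference is filled by
    the triangles a(y) y z, then a(y) a(z) z, then x a(y) a(z), all with sides below r.\<close>
  have step: "(e x (a y) \<otimes>\<^bsub>Q\<^esub> e (a y) y) \<otimes>\<^bsub>Q\<^esub> e y z = e x (a z) \<otimes>\<^bsub>Q\<^esub> e (a z) z"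
    "e x (a y) \<in> carrier Q" "e (a y) y \<in> carrier Q" "e y z \<in> carrier Q"
    if X: "y \<in> X" "z \<in> X" and yz: "dist x y \<le> d" "dist x z \<le> d" "dist y z < \<epsilon>" for y z
  proof -
    let ?a = "a y" and ?b = "a z"
    have A: "?a \<in> X" "dist x ?a \<le> d / 3" "dist ?a y \<le> 2 * d / 3" using a[OF X(1) yz(1)] by auto
    have B: "?b \<in> X" "dist x ?b \<le> d / 3" "dist ?b z \<le> 2 * d / 3" using a[OF X(2) yz(2)] by auto
    have ab: "dist ?a ?b < r" using dist_triangle2[of ?a ?b x] A B assms(7) d0
      by (simp add: dist_commute)
    have xa: "dist x ?a < r" "dist x ?b < r" using A B assms(7) d0 by auto
    have ay: "dist ?a y < r" "dist ?b z < r" using A B assms(7) d0 by auto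
    have az: "dist ?a z < r" using dist_triangle[of ?a z y] A yz(3) by (simp add: \<epsilon>_def)
    have yz': "dist y z < r" using yz(3) d0 by (simp add: \<epsilon>_def)
    note c = rips_cocycle_closed[OF assms(3)] and m = rips_cocycleD[OF assms(3)]
    have cc: "e x ?a \<in> carrier Q" "e ?a y \<in> carrier Q" "e y z \<in> carrier Q" "e ?a ?b \<in> carrier Q"
      "e ?b z \<in> carrier Q"
      using c assms(6) A B X xa ay ab yz' by auto
    then show "e x (a y) \<in> carrier Q" "e (a y) y \<in> carrier Q" "e y z \<in> carrier Q" by auto
    have "(e x ?a \<otimes>\<^bsub>Q\<^esub> e ?a y) \<otimes>\<^bsub>Q\<^esub> e y z = e x ?a \<otimes>\<^bsub>Q\<^esub> e ?a z"
      using cc m[OF A(1) X ay(1) yz' az] by (simp add: m_assoc)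
    also have "\<dots> = e x ?a \<otimes>\<^bsub>Q\<^esub> (e ?a ?b \<otimes>\<^bsub>Q\<^esub> e ?b z)" using m[OF A(1) B(1) X(2) ab ay(2) az] by simp
    also have "\<dots> = e x ?b \<otimes>\<^bsub>Q\<^esub> e ?b z" using cc m[OF assms(6) A(1) B(1) xa(1) ab xa(2)]
      by (simp flip: m_assoc)
    finally show "(e x (a y) \<otimes>\<^bsub>Q\<^esub> e (a y) y) \<otimes>\<^bsub>Q\<^esub> e y z = e x (a z) \<otimes>\<^bsub>Q\<^esub> e (a z) z" .
  qed
  note p = path_pathin_canon[OF assms(4)]
  have ball: "dist x (f t) \<le> d" if "t \<in> {0..1}" for t using assms(8) that
    by (auto simp: image_subset_iff)
  have "uniformly_continuous_on {0..1} f"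
    using p(1) by (intro compact_uniformly_continuous) (auto simp: path_def)
  then obtain \<delta>
    where \<delta>: "\<delta> > 0" "\<And>s t. s \<in> {0..1} \<Longrightarrow> t \<in> {0..1} \<Longrightarrow> dist s t < \<delta> \<Longrightarrow> dist (f s) (f t) < \<epsilon>"
    using e unfolding uniformly_continuous_on_def by metis
  \<comment> \<open>This primitive depends on the point \<open>f t\<close> alone, so it has equal
    values at the two ends of a loop.\<close>
  define \<kappa> where "\<kappa> t = e x (a (f t)) \<otimes>\<^bsub>Q\<^esub> e (a (f t)) (f t)" for t
  have kc: "\<kappa> t \<in> carrier Q" if "t \<in> {0..1}" for t
    using step(2,3)[OF p(2)[OF that] p(2)[OF that] ball[OF that] ball[OF that]] e
      by (simp add: \<kappa>_def)
  have "primitive Q e f {0..1} \<kappa>"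
    unfolding primitive_def
  proof (intro conjI exI[of _ \<delta>] ballI impI)
    fix s t :: real assume st: "s \<in> {0..1}" "t \<in> {0..1}" "dist s t < \<delta>"
    note S = step[OF p(2)[OF st(1)] p(2)[OF st(2)] ball[OF st(1)] ball[OF st(2)] \<delta>(2)[OF st]]
    show "e (f s) (f t) \<in> carrier Q" "\<kappa> s \<otimes>\<^bsub>Q\<^esub> e (f s) (f t) = \<kappa> t"
      using S by (auto simp: \<kappa>_def)
  qed (use kc \<delta> in auto)
  from holonomy_primitive[OF assms(2) this] show ?thesis
    using kc[of 0] assms(5) by (simp add: \<kappa>_def)
qed

lemma loop_in_small_ballI:
  assumes "pathin (top_of_set X) f" "f 0 = f 1" "x \<in> X" "d < r" "\<And>t. t \<in> {0..1} \<Longrightarrow> dist x (f t) \<le> d"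
  shows "loop_in_small_ball X r f"
  using assms unfolding loop_in_small_ball_def pathin_canon_iff
  by (auto simp: path_image_def pathstart_def pathfinish_def intro!: bexI[of _ x] exI[of _ d])

lemma loop_in_small_ball_holonomy:
  assumes "geodesic_space X" "group Q" "rips_cocycle Q X r e" "loop_in_small_ball X (3 * r / 2) f"
  shows "holonomy Q e f = \<one>\<^bsub>Q\<^esub>"
proof -
  obtain x d where "x \<in> X" "d < 3 * r / 2" "f ` {0..1} \<subseteq> cball x d"
    using assms(4) by (auto simp: loop_in_small_ball_def path_image_def)
  moreover have "pathin (top_of_set X) f" "f 0 = f 1"
    using assms(4)
      by (auto simp: loop_in_small_ball_def pathin_canon_iff path_image_def pathstart_def
        pathfinish_def)
  ultimately show ?thesis using holonomy_small_ball[OF assms(1-3)] by blast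
qed

lemma loop_in_small_ball_mono: "loop_in_small_ball X p f \<Longrightarrow> p \<le> q \<Longrightarrow> loop_in_small_ball X q f"
  unfolding loop_in_small_ball_def by (meson order_less_le_trans)

lemma dist_joinpaths_le:
  fixes f g :: "real \<Rightarrow> 'a::metric_space"
  assumes "t \<in> {0..1}" "\<And>s. s \<in> {0..1} \<Longrightarrow> dist x (f s) \<le> d" "\<And>s. s \<in> {0..1} \<Longrightarrow> dist x (g s) \<le> d"
  shows "dist x ((f +++ g) t) \<le> d"
  using assms by (simp add: joinpaths_def)

text \<open>For a point on the side from y to z, the triangle inequalities through y and through z
  add up to twice its distance from x being at most the perimeter. With m the longest side, the
  radius 3m/2 works, and m < r makes it strictly smaller than 3r/2.\<close>

lemma geodesic_triangle_small:
  assumes "is_geodesic X x y \<alpha>" "is_geodesic X y z \<beta>" "is_geodesic X x z \<gamma>"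
    "dist x y < r" "dist y z < r" "dist x z < r"
  shows "loop_in_small_ball X (3 * r / 2) (\<alpha> +++ (\<beta> +++ reversepath \<gamma>))"
proof -
  have p: "pathin (top_of_set X) \<alpha>" "pathin (top_of_set X) \<beta>" "pathin (top_of_set X) \<gamma>"
    and [simp]: "\<alpha> 0 = x" "\<alpha> 1 = y" "\<beta> 0 = y" "\<beta> 1 = z" "\<gamma> 0 = x" "\<gamma> 1 = z"
    using assms by (auto simp: is_geodesic_def)
  define m where "m = max (dist x y) (max (dist y z) (dist x z))"
  have m: "m < r" "dist x y \<le> m" "dist y z \<le> m" "dist x z \<le> m" using assms by (auto simp: m_def)
  have m0: "0 \<le> m" using m(2) zero_le_dist[of x y] by linarith
  show ?thesis
  proof (rule loop_in_small_ballI[where x = x and d = "3 * m / 2"])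
    show "pathin (top_of_set X) (\<alpha> +++ (\<beta> +++ reversepath \<gamma>))"
      using p by (auto intro!: pathin_join pathin_reversepath)
    show "x \<in> X" using path_pathin_canon(2)[OF p(1), of 0] by simp
    fix t :: real assume t: "t \<in> {0..1}"
    show "dist x ((\<alpha> +++ (\<beta> +++ reversepath \<gamma>)) t) \<le> 3 * m / 2"
    proof (rule dist_joinpaths_le[OF t _ dist_joinpaths_le])
      fix s :: real assume s: "s \<in> {0..1}"
      show "dist x (\<alpha> s) \<le> 3 * m / 2" using is_geodesic_dist[OF assms(1), of 0 s] s m m0 by simp
      show "dist x (reversepath \<gamma> s) \<le> 3 * m / 2"
        using is_geodesic_dist[OF assms(3), of 0 "1 - s"] s m m0 by (simp add: reversepath_def)
      show "dist x (\<beta> s) \<le> 3 * m / 2"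
        using is_geodesic_between[OF assms(2) s] dist_triangle[of x "\<beta> s" y]
          dist_triangle[of x "\<beta> s" z] m
        by (simp add: dist_commute)
    qed
  qed (use m in auto)
qed

text \<open>The path has a point farthest from \<open>f 0\<close>, by compactness. Its distance is a
  radius strictly below r, and it bounds the geodesic as well because \<open>f 1\<close> lies on the
  path.\<close>

lemma short_path_geodesic_small:
  assumes "pathin (top_of_set X) f" "is_geodesic X (f 0) (f 1) \<gamma>"
    "\<And>s t. s \<in> {0..1} \<Longrightarrow> t \<in> {0..1} \<Longrightarrow> dist (f s) (f t) < r"
  shows "loop_in_small_ball X r (f +++ reversepath \<gamma>)"
proof -
  have g: "pathin (top_of_set X) \<gamma>" "\<gamma> 0 = f 0" "\<gamma> 1 = f 1" using assms(2)
    by (auto simp: is_geodesic_def)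
  note p = path_pathin_canon[OF assms(1)]
  have "continuous_on {0..1} (\<lambda>t. dist (f 0) (f t))"
    using p(1) unfolding path_def by (intro continuous_intros)
  then obtain u where u: "u \<in> {0..1}" "\<And>t. t \<in> {0..1} \<Longrightarrow> dist (f 0) (f t) \<le> dist (f 0) (f u)"
    using continuous_attains_sup[of "{0..1::real}" "\<lambda>t. dist (f 0) (f t)"] by auto
  show ?thesis
  proof (rule loop_in_small_ballI[where x = "f 0" and d = "dist (f 0) (f u)"])
    show "pathin (top_of_set X) (f +++ reversepath \<gamma>)"
      using assms(1) g by (auto intro!: pathin_join pathin_reversepath)
    show "f 0 \<in> X" using p(2)[of 0] by simp
    show "dist (f 0) (f u) < r" using assms(3) u by auto
    fix t :: real assume t: "t \<in> {0..1}"
    show "dist (f 0) ((f +++ reversepath \<gamma>) t) \<le> dist (f 0) (f u)"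
    proof (rule dist_joinpaths_le[OF t])
      fix s :: real assume s: "s \<in> {0..1}"
      show "dist (f 0) (f s) \<le> dist (f 0) (f u)" using u s by auto
      have "dist (\<gamma> 0) (\<gamma> (1 - s)) \<le> dist (f 0) (f 1)"
        using is_geodesic_dist[OF assms(2), of 0 "1 - s"] s by simp
      also have "\<dots> \<le> dist (f 0) (f u)" using u by auto
      finally show "dist (f 0) (reversepath \<gamma> s) \<le> dist (f 0) (f u)" using g
        by (simp add: reversepath_def)
    qed
  qed (use g in auto)
qed

section \<open>The realization of a simplicial complex\<close>

definition is_complex :: "'a set set \<Rightarrow> bool" where
  "is_complex K \<longleftrightarrow> (\<forall>\<sigma>\<in>K. finite \<sigma> \<and> \<sigma> \<noteq> {} \<and> (\<forall>\<tau>. \<tau> \<noteq> {} \<longrightarrow> \<tau> \<subseteq> \<sigma> \<longrightarrow> \<tau> \<in> K))"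

lemma is_complexD:
  assumes "is_complex K" "\<sigma> \<in> K"
  shows "finite \<sigma>" "\<sigma> \<noteq> {}" "\<tau> \<noteq> {} \<Longrightarrow> \<tau> \<subseteq> \<sigma> \<Longrightarrow> \<tau> \<in> K"
  using assms unfolding is_complex_def by blast+

definition support :: "('a \<Rightarrow> real) \<Rightarrow> 'a set" where
  "support x = {v. x v \<noteq> 0}"

lemma geometric_simplex_support:
  assumes "finite \<sigma>"
  shows "x \<in> geometric_simplex \<sigma> \<longleftrightarrow> (\<forall>v. 0 \<le> x v) \<and> support x \<subseteq> \<sigma> \<and> sum x (support x) = 1"
proof -
  have "sum x \<sigma> = sum x (support x)" if "support x \<subseteq> \<sigma>"
    using that assms by (intro sum.mono_neutral_right) (auto simp: support_def)
  moreover have "(\<forall>v. v \<notin> \<sigma> \<longrightarrow> x v = 0) \<longleftrightarrow> support x \<subseteq> \<sigma>" by (auto simp: support_def)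
  ultimately show ?thesis unfolding geometric_simplex_def by auto
qed

lemma support_nonempty: "finite \<sigma> \<Longrightarrow> x \<in> geometric_simplex \<sigma> \<Longrightarrow> support x \<noteq> {}"
  using geometric_simplex_support[of \<sigma> x] by force

lemma topspace_realization: "topspace (realization K) = (\<Union>\<sigma>\<in>K. geometric_simplex \<sigma>)"
proof
  show "topspace (realization K) \<subseteq> (\<Union>\<sigma>\<in>K. geometric_simplex \<sigma>)"
    using openin_topspace[of "realization K"] unfolding openin_realization by (rule conjunct1)
  have "(\<Union>\<sigma>\<in>K. geometric_simplex \<sigma>) \<inter> geometric_simplex \<tau> = geometric_simplex \<tau>" if "\<tau> \<in> K" for \<tau>
    using that by blast
  then have "openin (realization K) (\<Union>\<sigma>\<in>K. geometric_simplex \<sigma>)"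
    by (simp add: openin_realization)
  then show "(\<Union>\<sigma>\<in>K. geometric_simplex \<sigma>) \<subseteq> topspace (realization K)"
    by (rule openin_subset)
qed

text \<open>The support of a point is its carrier, the smallest simplex that contains it, and does
  not depend on the simplex in which the point is given.\<close>

lemma support_in_complex:
  assumes "is_complex K" "x \<in> topspace (realization K)"
  shows "support x \<in> K" "finite (support x)" "x \<in> geometric_simplex (support x)" "\<And>v. 0 \<le> x v"
      "sum x (support x) = 1"
proof -
  obtain \<sigma> where s: "\<sigma> \<in> K" "x \<in> geometric_simplex \<sigma>" using assms(2)
    by (auto simp: topspace_realization)
  note f = is_complexD[OF assms(1) s(1)]
  have g: "(\<forall>v. 0 \<le> x v) \<and> support x \<subseteq> \<sigma> \<and> sum x (support x) = 1"
    using s(2) geometric_simplex_support[OF f(1)] by blast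
  then show "support x \<in> K" "finite (support x)" "\<And>v. 0 \<le> x v" "sum x (support x) = 1"
    using f support_nonempty[OF f(1) s(2)] by (auto intro: finite_subset)
  then show "x \<in> geometric_simplex (support x)" by (simp add: geometric_simplex_support)
qed

lemma geometric_simplex_topspace: "\<sigma> \<in> K \<Longrightarrow> x \<in> geometric_simplex \<sigma> \<Longrightarrow> x \<in> topspace (realization K)"
  by (auto simp: topspace_realization)

lemma continuous_map_simplex_realization:
  "\<sigma> \<in> K \<Longrightarrow> continuous_map (top_of_set (geometric_simplex \<sigma>)) (realization K) (\<lambda>x. x)"
  unfolding continuous_map_def
proof (intro conjI allI impI)
  fix U assume "\<sigma> \<in> K" "openin (realization K) U"
  then have "openin (top_of_set (geometric_simplex \<sigma>)) (U \<inter> geometric_simplex \<sigma>)"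
    by (simp add: openin_realization)
  moreover have "U \<inter> geometric_simplex \<sigma> = {x \<in> topspace (top_of_set (geometric_simplex \<sigma>)). x \<in> U}"
    by auto
  ultimately
    show "openin (top_of_set (geometric_simplex \<sigma>))
      {x \<in> topspace (top_of_set (geometric_simplex \<sigma>)). x \<in> U}"
    by simp
qed (auto simp: topspace_realization)

lemma continuous_map_realization_euclidean:
  "continuous_map (realization K) euclidean (\<lambda>x. x)"
  unfolding continuous_map_def
proof (intro conjI allI impI)
  fix U :: "('a \<Rightarrow> real) set" assume U: "openin euclidean U"
  let ?V = "{x \<in> topspace (realization K). x \<in> U}"
  have "?V \<inter> geometric_simplex \<sigma> = geometric_simplex \<sigma> \<inter> U" if "\<sigma> \<in> K" for \<sigma>
    using that by (auto simp: topspace_realization)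
  then show "openin (realization K) ?V"
    using U by (auto simp: openin_realization topspace_realization openin_open_Int)
qed auto

lemma continuous_map_into_fun:
  fixes f :: "'z \<Rightarrow> 'a \<Rightarrow> real"
  shows "continuous_map Z euclidean f \<longleftrightarrow> (\<forall>v. continuous_map Z euclideanreal (\<lambda>z. f z v))"
  using continuous_map_componentwise_UNIV[of Z "\<lambda>_. euclideanreal" f]
    by (simp add: euclidean_product_topology)

lemma continuous_map_into_realizationD:
  assumes "continuous_map Z (realization K) f"
  shows "continuous_map Z euclideanreal (\<lambda>z. f z v)"
  using continuous_map_compose[OF assms continuous_map_realization_euclidean]
  by (simp add: continuous_map_into_fun o_def)

lemma closed_geometric_simplex: "closed (geometric_simplex \<sigma>)"
proof -
  have "geometric_simplex \<sigma> = (\<Inter>v. {x. 0 \<le> x v}) \<inter> (\<Inter>v\<in>-\<sigma>. {x. x v = 0}) \<inter> {x. (\<Sum>v\<in>\<sigma>. x v) = 1}"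
    by (auto simp: geometric_simplex_def)
  moreover have "closed {x::'a\<Rightarrow>real. 0 \<le> x v}" "closed {x::'a\<Rightarrow>real. x v = 0}"
    "closed {x::'a\<Rightarrow>real. (\<Sum>v\<in>\<sigma>. x v) = 1}" for v
    by (intro closed_Collect_le closed_Collect_eq continuous_on_sum continuous_on_const
      continuous_on_product_coordinates)+
  ultimately show ?thesis by (simp add: closed_INT closed_Int)
qed

text \<open>Over finitely many vertices it is enough that the coordinates are continuous. There are
  finitely many simplices on these vertices, their preimages are closed, and on each simplex the
  weak topology is the usual one; so the pieces can be pasted.\<close>

lemma continuous_map_into_realization:
  assumes "\<And>v. continuous_map Z euclideanreal (\<lambda>z. f z v)" "finite V" "is_complex K"
    "\<And>z. z \<in> topspace Z \<Longrightarrow> \<exists>\<sigma>\<in>K. \<sigma> \<subseteq> V \<and> f z \<in> geometric_simplex \<sigma>"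
  shows "continuous_map Z (realization K) f"
proof (rule pasting_lemma_closed)
  let ?I = "{\<sigma>\<in>K. \<sigma> \<subseteq> V}" and ?T = "\<lambda>\<sigma>. {z \<in> topspace Z. f z \<in> geometric_simplex \<sigma>}"
  show "finite ?I" by (rule finite_subset[of _ "Pow V"]) (use assms(2) in auto)
  have f: "continuous_map Z euclidean f" using assms(1) by (simp add: continuous_map_into_fun)
  show "closedin Z (?T \<sigma>)" for \<sigma>
    using closedin_continuous_map_preimage[OF f, of "geometric_simplex \<sigma>"] closed_geometric_simplex
    by auto
  show "continuous_map (subtopology Z (?T \<sigma>)) (realization K) f" if "\<sigma> \<in> ?I" for \<sigma>
  proof -
    have "continuous_map (subtopology Z (?T \<sigma>)) (top_of_set (geometric_simplex \<sigma>)) f"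
      using continuous_map_from_subtopology[OF f] by (auto simp: continuous_map_in_subtopology)
    from continuous_map_compose[OF this continuous_map_simplex_realization] that show ?thesis
      by (auto simp: o_def)
  qed
  show "\<exists>j. j \<in> ?I \<and> x \<in> ?T j \<and> f x = f x" if "x \<in> topspace Z" for x
    using assms(4)[OF that] that by auto
qed auto

text \<open>Choosing a point in the interior of each open simplex that a compact set meets gives a set
  all of whose subsets are closed in the weak topology; compactness makes it finite.\<close>

lemma compactin_realization_finite:
  assumes "is_complex K" "compactin (realization K) C"
  obtains V where "finite V" "\<And>x. x \<in> C \<Longrightarrow> support x \<subseteq> V"
proof -
  have CK: "C \<subseteq> topspace (realization K)" using assms(2) by (simp add: compactin_def)
  obtain P where P: "P \<subseteq> C" "inj_on support P" "support ` C = support ` P"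
    using subset_image_inj[of "support ` C" support C] by auto
  define U where "U p = topspace (realization K) - (P - {p})" for p
  have "openin (realization K) (U p)" for p
    unfolding openin_realization
  proof (intro conjI ballI)
    show "U p \<subseteq> (\<Union>\<sigma>\<in>K. geometric_simplex \<sigma>)" by (auto simp: U_def topspace_realization)
    fix \<sigma> assume s: "\<sigma> \<in> K"
    note fs = is_complexD(1)[OF assms(1) s]
    let ?A = "(P - {p}) \<inter> geometric_simplex \<sigma>"
    have "support ` ?A \<subseteq> Pow \<sigma>" using geometric_simplex_support[OF fs] by auto
    then have "finite (support ` ?A)" using fs by (meson finite_Pow_iff finite_subset)
    moreover have "inj_on support ?A" using P(2) by (rule inj_on_subset) auto
    ultimately have "finite ?A" by (rule finite_imageD)
    moreover have "closed {q}" for q :: "'a \<Rightarrow> real"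
    proof -
      have "{q} = (\<Inter>v. {x. x v = q v})" by (auto simp: fun_eq_iff)
      moreover have "closed {x::'a\<Rightarrow>real. x v = q v}" for v
        by (intro closed_Collect_eq continuous_on_const continuous_on_product_coordinates)
      ultimately show ?thesis by (simp add: closed_INT)
    qed
    ultimately have "closed (\<Union>q\<in>?A. {q})" by (intro closed_UN) auto
    then have "closed ?A" by (simp only: UN_singleton)
    then have "open (- ?A)" by (rule open_Compl)
    moreover have "U p \<inter> geometric_simplex \<sigma> = geometric_simplex \<sigma> \<inter> (- ?A)"
      using s by (auto simp: U_def topspace_realization)
    ultimately show "openin (top_of_set (geometric_simplex \<sigma>)) (U p \<inter> geometric_simplex \<sigma>)"
      by (simp add: openin_open_Int)
  qed
  moreover have "C \<subseteq> \<Union> (U ` P)"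
  proof
    fix x assume x: "x \<in> C"
    then obtain p where "p \<in> P" "support x = support p" using P(3) by blast
    then have "x \<in> U (if x \<in> P then x else p)" using x CK by (auto simp: U_def)
    moreover have "(if x \<in> P then x else p) \<in> P" using \<open>p \<in> P\<close> by simp
    ultimately show "x \<in> \<Union> (U ` P)" by blast
  qed
  ultimately obtain \<F> where F: "finite \<F>" "\<F> \<subseteq> U ` P" "C \<subseteq> \<Union>\<F>"
    using assms(2)[unfolded compactin_def, THEN conjunct2, rule_format, of "U ` P"] by blast
  obtain P0 where P0: "finite P0" "P0 \<subseteq> P" "\<F> = U ` P0" using finite_subset_image[OF F(1,2)]
    by metis
  have "P \<subseteq> P0"
  proof
    fix p assume p: "p \<in> P"
    then obtain q where "q \<in> P0" "p \<in> U q" using F(3) P0(3) P(1) by blast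
    then show "p \<in> P0" using p by (auto simp: U_def)
  qed
  then have "finite P" using P0 finite_subset by blast
  show thesis
  proof (rule that)
    show "finite (\<Union> (support ` P))"
      using \<open>finite P\<close> P(1) CK support_in_complex(2)[OF assms(1)] by auto
    show "support x \<subseteq> \<Union> (support ` P)" if "x \<in> C" for x
      using that P(3) by blast
  qed
qed

lemma pathin_realization_support:
  assumes "is_complex K" "pathin (realization K) f"
  obtains V where "finite V" "\<And>t. t \<in> {0..1} \<Longrightarrow> support (f t) \<subseteq> V"
proof -
  have "compactin (realization K) (f ` {0..1})"
    using assms(2) unfolding pathin_def
    by (rule image_compactin[rotated]) (simp add: compactin_subtopology)
  then show thesis using compactin_realization_finite[OF assms(1)] that
    by (metis imageI)
qed

lemma pathin_topspace: "pathin Y f \<Longrightarrow> t \<in> {0..1} \<Longrightarrow> f t \<in> topspace Y"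
  by (auto simp: pathin_def continuous_map_def)

section \<open>Linear homotopies and paths in open stars\<close>

lemma simplex_convex:
  assumes "x \<in> geometric_simplex \<sigma>" "y \<in> geometric_simplex \<sigma>" "0 \<le> s" "s \<le> 1"
  shows "(\<lambda>v. (1 - s) * x v + s * y v) \<in> geometric_simplex \<sigma>"
  using assms by (auto simp: geometric_simplex_def sum.distrib simp flip: sum_distrib_left)

text \<open>By compactness both paths live on finitely many vertices, and there the linear homotopy
  is continuous because its coordinates are.\<close>

lemma straight_homotopy:
  assumes K: "is_complex K" and f: "pathin (realization K) f" and g: "pathin (realization K) g"
    and ends: "f 0 = g 0" "f 1 = g 1"
    and common: "\<And>t. t \<in> {0..1} \<Longrightarrow> \<exists>\<sigma>\<in>K. f t \<in> geometric_simplex \<sigma> \<and> g t \<in> geometric_simplex \<sigma>"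
  shows "path_homotopic (realization K) f g"
proof -
  obtain V where V: "finite V" "\<And>t. t \<in> {0..1} \<Longrightarrow> support (f t) \<subseteq> V"
    using pathin_realization_support[OF K f] by blast
  obtain W where W: "finite W" "\<And>t. t \<in> {0..1} \<Longrightarrow> support (g t) \<subseteq> W"
    using pathin_realization_support[OF K g] by blast
  let ?I = "top_of_set {0..1::real}"
  let ?k = "\<lambda>z::real\<times>real. \<lambda>v. (1 - fst z) * f (snd z) v + fst z * g (snd z) v"
  have cf: "continuous_on ({0..1} \<times> {0..1}) (\<lambda>z::real\<times>real. h (snd z) v)"
    if "pathin (realization K) h" for h v
  proof -
    have "continuous_on {0..1} (\<lambda>t. h t v)"
      using continuous_map_into_realizationD[OF that[unfolded pathin_def], of v] by simp
    then show ?thesis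
      by (rule continuous_on_compose2) (auto intro!: continuous_intros)
  qed
  have "continuous_map (top_of_set ({0..1} \<times> {0..1})) (realization K) ?k"
  proof (rule continuous_map_into_realization[OF _ _ K])
    show "continuous_map (top_of_set ({0..1} \<times> {0..1})) euclideanreal (\<lambda>z. ?k z v)" for v
      using cf[OF f, of v] cf[OF g, of v] by (auto intro!: continuous_intros)
    show "finite (V \<union> W)" using V W by simp
    fix z :: "real \<times> real" assume "z \<in> topspace (top_of_set ({0..1} \<times> {0..1}))"
    then have z: "0 \<le> fst z" "fst z \<le> 1" "snd z \<in> {0..1}" by auto
    let ?x = "f (snd z)" and ?y = "g (snd z)"
    obtain \<sigma> where s: "\<sigma> \<in> K" "?x \<in> geometric_simplex \<sigma>" "?y \<in> geometric_simplex \<sigma>"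
      using common[OF z(3)] by blast
    note C = is_complexD[OF K s(1)]
    \<comment> \<open>The given \<sigma> may leave \<open>V \<union> W\<close>; the union of the two
      supports is a face of \<sigma> that does not.\<close>
    let ?t = "support ?x \<union> support ?y"
    have "?t \<subseteq> \<sigma>" using s(2,3) unfolding geometric_simplex_support[OF C(1)] by simp
    moreover have "?t \<noteq> {}" using support_nonempty[OF C(1) s(2)] by simp
    ultimately have t: "?t \<in> K" using C(3)[of ?t] by simp
    have ft: "finite ?t" using \<open>?t \<subseteq> \<sigma>\<close> C(1) by (rule finite_subset)
    have "?x \<in> geometric_simplex ?t" "?y \<in> geometric_simplex ?t"
      using s(2,3) unfolding geometric_simplex_support[OF C(1)] geometric_simplex_support[OF ft]
        by auto
    then have "?k z \<in> geometric_simplex ?t" using z by (intro simplex_convex) auto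
    then show "\<exists>\<sigma>\<in>K. \<sigma> \<subseteq> V \<union> W \<and> ?k z \<in> geometric_simplex \<sigma>"
      using t V(2)[OF z(3)] W(2)[OF z(3)] by (intro bexI[of _ ?t]) auto
  qed
  moreover have "prod_topology ?I ?I = top_of_set ({0..1} \<times> {0..1})" by simp
  ultimately have c: "continuous_map (prod_topology ?I ?I) (realization K) ?k" by metis
  show ?thesis
    unfolding path_homotopic_iff
  proof (intro exI[of _ ?k] conjI ballI c)
    fix s :: real assume "s \<in> {0..1}"
    have "(1 - s) * a + s * a = a" for a by (simp add: algebra_simps)
    then show "?k (s, 0) = f 0" "?k (s, 1) = f 1" using ends by auto
  qed auto
qed

definition seg :: "('a \<Rightarrow> real) \<Rightarrow> ('a \<Rightarrow> real) \<Rightarrow> real \<Rightarrow> 'a \<Rightarrow> real" where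
  "seg p q = (\<lambda>t v. (1 - t) * p v + t * q v)"

lemma seg_0_1 [simp]: "seg p q 0 = p" "seg p q 1 = q"
  by (auto simp: seg_def)

lemma seg_same [simp]: "seg p p = (\<lambda>t. p)"
  by (auto simp: seg_def algebra_simps)

lemma seg_in_simplex:
  "p \<in> geometric_simplex \<sigma> \<Longrightarrow> q \<in> geometric_simplex \<sigma> \<Longrightarrow> t \<in> {0..1} \<Longrightarrow> seg p q t \<in> geometric_simplex \<sigma>"
  unfolding seg_def by (rule simplex_convex) auto

lemma pathin_seg:
  assumes "is_complex K" "\<sigma> \<in> K" "p \<in> geometric_simplex \<sigma>" "q \<in> geometric_simplex \<sigma>"
  shows "pathin (realization K) (seg p q)"
  unfolding pathin_def
proof (rule continuous_map_into_realization[OF _ is_complexD(1)[OF assms(1,2)] assms(1)])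
  show "continuous_map (top_of_set {0..1}) euclideanreal (\<lambda>t. seg p q t v)" for v
    by (simp add: seg_def) (intro continuous_intros)
  show "\<exists>\<tau>\<in>K. \<tau> \<subseteq> \<sigma> \<and> seg p q t \<in> geometric_simplex \<tau>" if "t \<in> topspace (top_of_set {0..1})" for t
    using seg_in_simplex[OF assms(3,4), of t] assms(2) that by auto
qed

lemma seg_triangle:
  assumes "is_complex K" "\<sigma> \<in> K" "p \<in> geometric_simplex \<sigma>" "q \<in> geometric_simplex \<sigma>"
      "x \<in> geometric_simplex \<sigma>"
  shows "path_homotopic (realization K) (seg p q +++ seg q x) (seg p x)"
proof (rule straight_homotopy[OF assms(1)])
  show "pathin (realization K) (seg p q +++ seg q x)" "pathin (realization K) (seg p x)"
    using assms by (auto intro!: pathin_join pathin_seg)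
  fix t :: real assume t: "t \<in> {0..1}"
  have "(seg p q +++ seg q x) t \<in> geometric_simplex \<sigma>"
    using t assms by (auto simp: joinpaths_def intro!: seg_in_simplex)
  then show "\<exists>\<sigma>\<in>K. (seg p q +++ seg q x) t \<in> geometric_simplex \<sigma> \<and> seg p x t \<in> geometric_simplex \<sigma>"
    using assms seg_in_simplex[OF assms(3,5) t] by blast
qed auto

lemma support_vertex [simp]: "support (vertex v) = {v}"
  by (auto simp: support_def vertex_def)

lemma vertex_in_simplex: "finite \<sigma> \<Longrightarrow> vertex v \<in> geometric_simplex \<sigma> \<longleftrightarrow> v \<in> \<sigma>"
  by (simp add: geometric_simplex_support) (simp add: vertex_def)

lemma common_simplex_vertex:
  assumes "is_complex K" "x \<in> topspace (realization K)" "x v > 0"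
  shows "\<exists>\<sigma>\<in>K. x \<in> geometric_simplex \<sigma> \<and> vertex v \<in> geometric_simplex \<sigma>"
  using support_in_complex[OF assms(1,2)] assms(3)
  by (intro bexI[of _ "support x"]) (auto simp: vertex_in_simplex support_def)

text \<open>Inside an open star the ends determine the path up to homotopy: it may be pulled into
  the centre \<open>v\<close>.\<close>

lemma star_path_homotopic:
  assumes K: "is_complex K" and f: "pathin (realization K) f" and v: "\<And>t. t \<in> {0..1} \<Longrightarrow> f t v > 0"
  shows "path_homotopic (realization K) f (seg (f 0) (vertex v) +++ seg (vertex v) (f 1))"
proof -
  let ?R = "realization K"
  let ?a = "seg (f 0) (vertex v)" and ?b = "seg (vertex v) (f 1)"
  have c: "\<exists>\<sigma>\<in>K. f t \<in> geometric_simplex \<sigma> \<and> vertex v \<in> geometric_simplex \<sigma>" if "t \<in> {0..1}" for t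
    using common_simplex_vertex[OF K pathin_topspace[OF f that] v[OF that]] .
  obtain \<sigma> where s: "\<sigma> \<in> K" "f 0 \<in> geometric_simplex \<sigma>" "vertex v \<in> geometric_simplex \<sigma>"
    using c[of 0] by auto
  obtain \<tau> where t: "\<tau> \<in> K" "f 1 \<in> geometric_simplex \<tau>" "vertex v \<in> geometric_simplex \<tau>"
    using c[of 1] by auto
  have a: "pathin ?R ?a" using s by (auto intro: pathin_seg[OF K])
  have b: "pathin ?R ?b" using t by (auto intro: pathin_seg[OF K])
  have cc: "pathin ?R (\<lambda>t. x)" if "x \<in> {f 0, vertex v, f 1}" for x
    using that s t by (auto simp: intro: geometric_simplex_topspace)
  have 1: "path_homotopic ?R (((\<lambda>t. f 0) +++ f) +++ (\<lambda>t. f 1)) f"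
  proof -
    have "path_homotopic ?R (((\<lambda>t. f 0) +++ f) +++ (\<lambda>t. f 1)) ((\<lambda>t. f 0) +++ f)"
      using path_homotopic_rid[of ?R "(\<lambda>t. f 0) +++ f"] pathin_join[OF cc f, of "f 0"] by simp
    then show ?thesis using path_homotopic_lid[OF f] path_homotopic_trans by blast
  qed
  \<comment> \<open>Padded by rests at both ends, \<open>f\<close> shares a simplex with the detour
    at all times: with a slide to or from \<open>v\<close> while \<open>f\<close> rests, and with
    the vertex \<open>v\<close> itself while \<open>f\<close> moves.\<close>
  have 2: "path_homotopic ?R (((\<lambda>t. f 0) +++ f) +++ (\<lambda>t. f 1)) ((?a +++ (\<lambda>t. vertex v)) +++ ?b)"
  proof (rule straight_homotopy[OF K])
    show "pathin ?R (((\<lambda>t. f 0) +++ f) +++ (\<lambda>t. f 1))" using cc f by (auto intro!: pathin_join)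
    show "pathin ?R ((?a +++ (\<lambda>t. vertex v)) +++ ?b)" using a b cc by (auto intro!: pathin_join)
    fix u :: real assume u: "u \<in> {0..1}"
    consider "u \<le> 1/4" | "1/4 < u" "u \<le> 1/2" | "1/2 < u" by linarith
    then show "\<exists>\<sigma>\<in>K. (((\<lambda>t. f 0) +++ f) +++ (\<lambda>t. f 1)) u \<in> geometric_simplex \<sigma> \<and>
        ((?a +++ (\<lambda>t. vertex v)) +++ ?b) u \<in> geometric_simplex \<sigma>"
    proof cases
      case 1
      then have "?a (4 * u) \<in> geometric_simplex \<sigma>" using seg_in_simplex[OF s(2,3)] u by simp
      with 1 s show ?thesis by (intro bexI[of _ \<sigma>]) (auto simp: joinpaths_def)
    next
      case 2
      then have "4 * u - 1 \<in> {0..1}" by auto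
      from c[OF this] 2 show ?thesis by (simp add: joinpaths_def)
    next
      case 3
      then have "?b (2 * u - 1) \<in> geometric_simplex \<tau>" using seg_in_simplex[OF t(3,2)] u by simp
      with 3 t show ?thesis by (intro bexI[of _ \<tau>]) (auto simp: joinpaths_def)
    qed
  qed auto
  have "path_homotopic ?R (?a +++ (\<lambda>t. vertex v)) ?a"
    using path_homotopic_rid[OF a] by simp
  then have "path_homotopic ?R ((?a +++ (\<lambda>t. vertex v)) +++ ?b) (?a +++ ?b)"
    using b by (intro path_homotopic_join path_homotopic_refl) auto
  then show ?thesis using 1 2 path_homotopic_sym path_homotopic_trans by blast
qed

section \<open>Cocycles on edges and their holonomy on the realization\<close>

definition complex_cocycle :: "('q, 'm) monoid_scheme \<Rightarrow> 'a set set \<Rightarrow> ('a \<Rightarrow> 'a \<Rightarrow> 'q) \<Rightarrow> bool" where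
  "complex_cocycle Q K e \<longleftrightarrow>
     (\<forall>x y z. {x, y, z} \<in> K \<longrightarrow> e x y \<in> carrier Q \<and> e x y \<otimes>\<^bsub>Q\<^esub> e y z = e x z)"

lemma complex_cocycleD:
  assumes "complex_cocycle Q K e" "is_complex K" "\<sigma> \<in> K" "x \<in> \<sigma>" "y \<in> \<sigma>" "z \<in> \<sigma>"
  shows "e x y \<in> carrier Q" "e x y \<otimes>\<^bsub>Q\<^esub> e y z = e x z"
proof -
  have "{x, y, z} \<in> K" using is_complexD(3)[OF assms(2,3), of "{x, y, z}"] assms(4-6) by blast
  then show "e x y \<in> carrier Q" "e x y \<otimes>\<^bsub>Q\<^esub> e y z = e x z"
    using assms(1) unfolding complex_cocycle_def by blast+
qed

lemma complex_cocycle_refl: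
  assumes "group Q" "complex_cocycle Q K e" "is_complex K" "\<sigma> \<in> K" "x \<in> \<sigma>"
  shows "e x x = \<one>\<^bsub>Q\<^esub>"
proof -
  interpret group Q by fact
  show ?thesis using complex_cocycleD[OF assms(2-5,5,5)] l_cancel_one by blast
qed

definition some_vertex :: "('a \<Rightarrow> real) \<Rightarrow> 'a" where
  "some_vertex x = (SOME v. x v > 0)"

text \<open>Transport from \<open>x\<close> to \<open>y\<close> through any vertex whose open star contains both points.\<close>

definition star_cocycle ::
    "('q, 'm) monoid_scheme \<Rightarrow> ('a \<Rightarrow> 'a \<Rightarrow> 'q) \<Rightarrow> ('a \<Rightarrow> real) \<Rightarrow> ('a \<Rightarrow> real) \<Rightarrow> 'q" where
  "star_cocycle Q e x y =
     (let w = SOME w. x w > 0 \<and> y w > 0 in e (some_vertex x) w \<otimes>\<^bsub>Q\<^esub> e w (some_vertex y))"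

lemma some_vertex_pos:
  assumes "is_complex K" "x \<in> topspace (realization K)"
  shows "x (some_vertex x) > 0" "some_vertex x \<in> support x"
proof -
  note S = support_in_complex[OF assms]
  obtain v where "v \<in> support x" using is_complexD(2)[OF assms(1) S(1)] by blast
  then have "x v > 0" using S(4)[of v] by (auto simp: support_def)
  then show "x (some_vertex x) > 0" unfolding some_vertex_def by (rule someI)
  then show "some_vertex x \<in> support x" by (simp add: support_def)
qed

lemma some_vertex_vertex [simp]: "some_vertex (vertex v) = v"
  by (simp add: some_vertex_def vertex_def)

text \<open>The vertices \<open>v\<close> and \<open>w\<close> both lie in the supports of
  \<open>x\<close> and of \<open>y\<close>. These are simplices, so the cocycle law in the first
  inserts the edge from \<open>v\<close> to \<open>w\<close> and in the second absorbs it.\<close>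

lemma star_cocycle_eq:
  assumes "group Q" "complex_cocycle Q K e" "is_complex K"
    "x \<in> topspace (realization K)" "y \<in> topspace (realization K)" "x v > 0" "y v > 0"
  shows "star_cocycle Q e x y = e (some_vertex x) v \<otimes>\<^bsub>Q\<^esub> e v (some_vertex y)"
    "e (some_vertex x) v \<in> carrier Q" "e v (some_vertex y) \<in> carrier Q"
proof -
  interpret group Q by fact
  define w where "w = (SOME w. x w > 0 \<and> y w > 0)"
  have w: "x w > 0 \<and> y w > 0" unfolding w_def by (rule someI[of _ v]) (use assms in simp)
  have X: "some_vertex x \<in> support x" "w \<in> support x" "v \<in> support x"
    using some_vertex_pos[OF assms(3,4)] w assms(6) by (auto simp: support_def)
  have Y: "some_vertex y \<in> support y" "w \<in> support y" "v \<in> support y"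
    using some_vertex_pos[OF assms(3,5)] w assms(7) by (auto simp: support_def)
  note cx = complex_cocycleD[OF assms(2,3) support_in_complex(1)[OF assms(3,4)]]
  note cy = complex_cocycleD[OF assms(2,3) support_in_complex(1)[OF assms(3,5)]]
  show c: "e (some_vertex x) v \<in> carrier Q" "e v (some_vertex y) \<in> carrier Q"
    using cx(1)[OF X(1,3,3)] cy(1)[OF Y(3,1,1)] .
  have d: "e v w \<in> carrier Q" "e w (some_vertex y) \<in> carrier Q"
    using cx(1)[OF X(3,2,2)] cy(1)[OF Y(2,1,1)] .
  have "star_cocycle Q e x y = e (some_vertex x) w \<otimes>\<^bsub>Q\<^esub> e w (some_vertex y)"
    by (simp add: star_cocycle_def w_def Let_def)
  also have "\<dots> = (e (some_vertex x) v \<otimes>\<^bsub>Q\<^esub> e v w) \<otimes>\<^bsub>Q\<^esub> e w (some_vertex y)"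
    using cx(2)[OF X(1,3,2)] by simp
  also have "\<dots> = e (some_vertex x) v \<otimes>\<^bsub>Q\<^esub> (e v w \<otimes>\<^bsub>Q\<^esub> e w (some_vertex y))"
    using c d by (simp add: m_assoc)
  also have "e v w \<otimes>\<^bsub>Q\<^esub> e w (some_vertex y) = e v (some_vertex y)"
    using cy(2)[OF Y(3,2,1)] .
  finally show "star_cocycle Q e x y = e (some_vertex x) v \<otimes>\<^bsub>Q\<^esub> e v (some_vertex y)" .
qed

lemma openin_star: "openin (realization K) {x \<in> topspace (realization K). x v > 0}"
proof -
  have "openin (realization K) {x \<in> topspace (realization K). x v \<in> {0<..}}"
    by
      (rule
        openin_continuous_map_preimage[OF
          continuous_map_into_realizationD[OF continuous_map_id[unfolded id_def]]]) auto
  then show ?thesis by simp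
qed

text \<open>The open stars form the cover. Inside the star of \<open>v\<close> all transport may
  pass through \<open>v\<close>, and the excursion to the vertex chosen for the middle point
  cancels.\<close>

lemma local_cocycle_star:
  assumes "group Q" "complex_cocycle Q K e" "is_complex K"
  shows "local_cocycle Q (realization K) (star_cocycle Q e)"
  unfolding local_cocycle_def
proof (intro exI[of _ "range (\<lambda>v. {x \<in> topspace (realization K). x v > 0})"] conjI ballI)
  interpret group Q by fact
  fix U x y assume "U \<in> range (\<lambda>v. {x \<in> topspace (realization K). x v > 0})" "x \<in> U" "y \<in> U"
  then obtain v where U: "U = {x \<in> topspace (realization K). x v > 0}" by blast
  have xy: "x \<in> topspace (realization K)" "x v > 0" "y \<in> topspace (realization K)" "y v > 0"
    using \<open>x \<in> U\<close> \<open>y \<in> U\<close> U by auto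
  note Exy = star_cocycle_eq[OF assms xy(1,3,2,4)]
  show "star_cocycle Q e x y \<in> carrier Q" using Exy by simp
  fix z assume "z \<in> U"
  then have z: "z \<in> topspace (realization K)" "z v > 0" using U by auto
  note Eyz = star_cocycle_eq[OF assms xy(3) z(1) xy(4) z(2)]
  note Exz = star_cocycle_eq[OF assms xy(1) z(1) xy(2) z(2)]
  have Y: "some_vertex y \<in> support y" "v \<in> support y"
    using some_vertex_pos[OF assms(3) xy(3)] xy(4) by (auto simp: support_def)
  have K: "support y \<in> K" using support_in_complex(1)[OF assms(3) xy(3)] .
  have "e v (some_vertex y) \<otimes>\<^bsub>Q\<^esub> e (some_vertex y) v = \<one>\<^bsub>Q\<^esub>"
    using complex_cocycleD(2)[OF assms(2,3) K Y(2,1,2)] complex_cocycle_refl[OF assms K Y(2)]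
      by simp
  moreover have "star_cocycle Q e x y \<otimes>\<^bsub>Q\<^esub> star_cocycle Q e y z =
      e (some_vertex x) v \<otimes>\<^bsub>Q\<^esub> (e v (some_vertex y) \<otimes>\<^bsub>Q\<^esub> e (some_vertex y) v) \<otimes>\<^bsub>Q\<^esub> e v
        (some_vertex z)"
    using Exy Eyz by (simp add: m_assoc)
  ultimately show "star_cocycle Q e x y \<otimes>\<^bsub>Q\<^esub> star_cocycle Q e y z = star_cocycle Q e x z"
    using Exy Eyz Exz by simp
next
  show "topspace (realization K) \<subseteq> \<Union> (range (\<lambda>v. {x \<in> topspace (realization K). x v > 0}))"
    using some_vertex_pos[OF assms(3)] by blast
qed (auto intro: openin_star)

lemma vertex_topspace: "is_complex K \<Longrightarrow> \<sigma> \<in> K \<Longrightarrow> v \<in> \<sigma> \<Longrightarrow> vertex v \<in> topspace (realization K)"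
  using vertex_in_simplex[OF is_complexD(1), of K \<sigma> v] by (auto simp: topspace_realization)

lemma pathin_edge:
  assumes "is_complex K" "{u, v} \<in> K"
  shows "pathin (realization K) (seg (vertex u) (vertex v))"
  by (rule pathin_seg[OF assms]) (auto simp: vertex_in_simplex)

lemma holonomy_edge:
  assumes "group Q" "complex_cocycle Q K e" "is_complex K" "{u, v} \<in> K"
  shows "holonomy Q (star_cocycle Q e) (seg (vertex u) (vertex v)) = e u v"
proof -
  interpret group Q by fact
  let ?f = "seg (vertex u) (vertex v)"
  note c = complex_cocycleD[OF assms(2,3,4)]
  have top: "?f t \<in> topspace (realization K)" if "t \<in> {0..1}" for t
    using pathin_topspace[OF pathin_edge[OF assms(3,4)] that] .
  have sv: "some_vertex (?f t) \<in> {u, v}" if "t \<in> {0..1}" for t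
    using some_vertex_pos(1)[OF assms(3) top[OF that]]
    by (rule contrapos_pp) (auto simp: seg_def vertex_def)
  \<comment> \<open>Along the edge the chosen vertex is always \<open>u\<close> or \<open>v\<close>;
    the cocycle from \<open>u\<close> to that vertex is a primitive, although the choice may
    jump.\<close>
  have "primitive Q (star_cocycle Q e) ?f {0..1} (\<lambda>t. e u (some_vertex (?f t)))"
    unfolding primitive_def
  proof (intro conjI exI[of _ 1] ballI impI)
    show "(\<lambda>t. e u (some_vertex (?f t))) \<in> {0..1} \<rightarrow> carrier Q"
      using sv c(1)[of u _ u] by auto
    fix s t :: real assume st: "s \<in> {0..1}" "t \<in> {0..1}" "dist s t < 1"
    \<comment> \<open>Times at distance less than 1 cannot be the two ends, so both points lie in
      the open star of \<open>u\<close> or both in that of \<open>v\<close>.\<close>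
    define w where "w = (if s < 1 \<and> t < 1 then u else v)"
    have w: "w \<in> {u, v}" "?f s w > 0" "?f t w > 0"
      using st by (auto simp: w_def seg_def vertex_def dist_real_def)
    let ?a = "some_vertex (?f s)" and ?b = "some_vertex (?f t)"
    note E = star_cocycle_eq[OF assms(1-3) top[OF st(1)] top[OF st(2)] w(2,3)]
    show "star_cocycle Q e (?f s) (?f t) \<in> carrier Q" using E by simp
    have "e u ?a \<otimes>\<^bsub>Q\<^esub> star_cocycle Q e (?f s) (?f t) = e u ?a \<otimes>\<^bsub>Q\<^esub> (e ?a w \<otimes>\<^bsub>Q\<^esub> e w ?b)"
      using E by simp
    also have "\<dots> = e u ?b"
      using c(2)[OF sv[OF st(1)] w(1) sv[OF st(2)]] c(2)[OF _ sv[OF st(1)] sv[OF st(2)], of u]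
        by simp
    finally show "e u ?a \<otimes>\<^bsub>Q\<^esub> star_cocycle Q e (?f s) (?f t) = e u ?b" .
  qed auto
  from holonomy_primitive[OF assms(1) this] show ?thesis
    using complex_cocycle_refl[OF assms, of u] c(1)[of u v u] by simp
qed

lemma edge_path_Cons: "edge_path (u # v # vs) = seg (vertex u) (vertex v) +++ edge_path (v # vs)"
  by (simp add: seg_def)

lemma edge_path_facts:
  assumes "is_complex K" "vs \<noteq> []" "successively (\<lambda>u v. {u, v} \<in> K) vs" "{hd vs} \<in> K"
  shows "pathin (realization K) (edge_path vs)" "edge_path vs 0 = vertex (hd vs)"
      "edge_path vs 1 = vertex (last vs)"
proof -
  have "pathin (realization K) (edge_path vs) \<and> edge_path vs 0 = vertex (hd vs) \<and> edge_path vs 1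
    = vertex (last vs)"
    using assms(2-4)
  proof (induction vs rule: induct_list012)
    case (2 v)
    then show ?case using vertex_topspace[OF assms(1), of "{v}" v] by simp
  next
    case (3 u v vs)
    have uv: "{u, v} \<in> K" "successively (\<lambda>u v. {u, v} \<in> K) (v # vs)" using 3(4) by auto
    then have "{v} \<in> K" using is_complexD(3)[OF assms(1) uv(1), of "{v}"] by simp
    with 3(2) uv have IH: "pathin (realization K) (edge_path (v # vs))"
      "edge_path (v # vs) 0 = vertex v"
      "edge_path (v # vs) 1 = vertex (last (v # vs))" by auto
    show ?case unfolding edge_path_Cons
      using pathin_join[OF pathin_edge[OF assms(1) uv(1)] IH(1)] IH by simp
  qed simp
  then show "pathin (realization K) (edge_path vs)" "edge_path vs 0 = vertex (hd vs)"
    "edge_path vs 1 = vertex (last vs)"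
    by auto
qed

lemma holonomy_edge_path:
  assumes "group Q" "complex_cocycle Q K e" "is_complex K" "vs \<noteq> []"
      "successively (\<lambda>u v. {u, v} \<in> K) vs" "{hd vs} \<in> K"
  shows "holonomy Q (star_cocycle Q e) (edge_path vs) = edge_prod Q e vs"
  using assms(4-6)
proof (induction vs rule: induct_list012)
  case (2 v)
  then show ?case
    using holonomy_const[OF assms(1) local_cocycle_star[OF assms(1-3)]
      vertex_topspace[OF assms(3), of "{v}" v]] by simp
next
  case (3 u v vs)
  have uv: "{u, v} \<in> K" "successively (\<lambda>u v. {u, v} \<in> K) (v # vs)" using 3(4) by auto
  then have v: "{v} \<in> K" using is_complexD(3)[OF assms(3) uv(1), of "{v}"] by simp
  note F = edge_path_facts[OF assms(3) _ uv(2)]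
  show ?case unfolding edge_path_Cons
    using holonomy_join[OF assms(1) local_cocycle_star[OF assms(1-3)] pathin_edge[OF assms(3) uv(1)]
      F(1)] F(2)
      holonomy_edge[OF assms(1-3) uv(1)] 3(2) uv v by simp
qed simp

section \<open>Classes of edges in the fundamental group of the realization\<close>

definition edge_class ::
    "'a set set \<Rightarrow> 'a \<Rightarrow> (('a \<Rightarrow> real) \<Rightarrow> real \<Rightarrow> 'a \<Rightarrow> real) \<Rightarrow> 'a \<Rightarrow> 'a \<Rightarrow> (real \<Rightarrow> 'a \<Rightarrow> real) set" where
  "edge_class K b T u v = path_class (realization K) (vertex b) T (seg (vertex u) (vertex v))"

text \<open>The cocycle law is the homotopy, inside a simplex, of two sides of a triangle to the
  third.\<close>

lemma complex_cocycle_edge_class: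
  assumes K: "is_complex K" and T: "tail_system (realization K) (vertex b) T"
  shows "complex_cocycle (fundamental_group (realization K) (vertex b)) K (edge_class K b T)"
  unfolding complex_cocycle_def
proof (intro allI impI)
  fix x y z assume xyz: "{x, y, z} \<in> K"
  have V: "vertex u \<in> geometric_simplex {x, y, z}" if "u \<in> {x, y, z}" for u
    using that by (auto simp: vertex_in_simplex)
  have p: "pathin (realization K) (seg (vertex u) (vertex v))" if "u \<in> {x, y, z}" "v \<in> {x, y, z}"
    for u v
    using pathin_seg[OF K xyz] V that by blast
  show "edge_class K b T x y \<in> carrier (fundamental_group (realization K) (vertex b)) \<and>
      edge_class K b T x y \<otimes>\<^bsub>fundamental_group (realization K)
        (vertex b)\<^esub> edge_class K b T y z = edge_class K b T x z"
    using path_class_closed[OF T p] path_class_join[OF T p p, of x y y z]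
      path_class_eq[OF T seg_triangle[OF K xyz V V V], of x y z]
    by (simp add: edge_class_def)
qed

lemma path_class_const:
  assumes "tail_system Y y T" "p \<in> topspace Y"
  shows "path_class Y y T (\<lambda>t. p) = \<one>\<^bsub>fundamental_group Y y\<^esub>"
proof -
  have "y \<in> topspace Y" using assms(1) by (simp add: tail_system_def)
  then interpret group "fundamental_group Y y" by (rule group_fundamental_group)
  have "(\<lambda>t. p) +++ (\<lambda>t. p) = (\<lambda>t. p)" by (simp add: joinpaths_def)
  then show ?thesis
    using path_class_join[OF assms(1), of "\<lambda>t. p" "\<lambda>t. p"]
      path_class_closed[OF assms(1), of "\<lambda>t. p"] assms(2)
      l_cancel_one[of "path_class Y y T (\<lambda>t. p)"] by auto
qed

lemma path_class_edge_path:
  assumes K: "is_complex K" and T: "tail_system (realization K) (vertex b) T"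
    and vs: "vs \<noteq> []" "successively (\<lambda>u v. {u, v} \<in> K) vs" "{hd vs} \<in> K"
  shows "path_class (realization K) (vertex b) T (edge_path vs) =
    edge_prod (fundamental_group (realization K) (vertex b)) (edge_class K b T) vs"
  using vs
proof (induction vs rule: induct_list012)
  case (2 v)
  then show ?case
    using path_class_const[OF T vertex_topspace[OF K, of "{v}" v]] by simp
next
  case (3 u v vs)
  have uv: "{u, v} \<in> K" "successively (\<lambda>u v. {u, v} \<in> K) (v # vs)" using 3(4) by auto
  then have v: "{v} \<in> K" using is_complexD(3)[OF K uv(1), of "{v}"] by simp
  note F = edge_path_facts[OF K _ uv(2)]
  show ?case unfolding edge_path_Cons
    using path_class_join[OF T pathin_edge[OF K uv(1)] F(1)] F(2) 3(2) uv v
      by (simp add: edge_class_def)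
qed simp

section \<open>Isomorphisms of persistences from surjections with given kernels\<close>

lemma quotient_bond_coset:
  assumes "M \<lhd> G" "N \<lhd> G" "N \<subseteq> M" "a \<in> carrier G"
  shows "quotient_bond G M (N #>\<^bsub>G\<^esub> a) = M #>\<^bsub>G\<^esub> a"
proof -
  interpret M: normal M G by fact
  interpret N: normal N G by fact
  have "M #>\<^bsub>G\<^esub> c = M #>\<^bsub>G\<^esub> a" if "c \<in> N #>\<^bsub>G\<^esub> a" for c
  proof -
    have "c \<in> M #>\<^bsub>G\<^esub> a" using that assms(3) by (auto simp: r_coset_def)
    then show ?thesis using M.repr_independence[OF _ assms(4) M.subgroup_axioms] by simp
  qed
  moreover have "a \<in> N #>\<^bsub>G\<^esub> a" using M.rcos_self[OF assms(4) N.subgroup_axioms] .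
  ultimately show ?thesis unfolding quotient_bond_def by blast
qed

lemma induced_on_cosets_coset:
  assumes "group_hom G H h" "a \<in> carrier G"
  shows "induced_on_cosets h (kernel G H h #>\<^bsub>G\<^esub> a) = h a"
proof -
  interpret group_hom G H h by fact
  have N: "kernel G H h \<subseteq> carrier G" by (auto simp: kernel_def)
  have "h c = h a" if "c \<in> kernel G H h #>\<^bsub>G\<^esub> a" for c
    using that assms(2) by (auto simp: r_coset_def kernel_def)
  moreover have "a \<in> kernel G H h #>\<^bsub>G\<^esub> a"
    using G.rcos_self[OF assms(2) subgroup_kernel] .
  ultimately have "h ` (kernel G H h #>\<^bsub>G\<^esub> a) = {h a}" by blast
  then show ?thesis by (simp add: induced_on_cosets_def)
qed

text \<open>All structure is inherited from the surjections of the single group \<open>G\<close>: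
  they induce the isomorphisms, and since every element of \<open>H p\<close> is some
  \<open>\<rho> p a\<close>, the maps \<psi> are homomorphisms that compose correctly.\<close>

lemma persistence_iso_kernels:
  fixes G :: "'a monoid" and H :: "real \<Rightarrow> 'b monoid"
  assumes G: "group G" and H: "\<And>r. r > 0 \<Longrightarrow> group (H r)"
    and \<rho>: "\<And>r. r > 0 \<Longrightarrow> \<rho> r \<in> hom G (H r)"
    and onto: "\<And>r. r > 0 \<Longrightarrow> \<rho> r ` carrier G = carrier (H r)"
    and ker: "\<And>r. r > 0 \<Longrightarrow> kernel G (H r) (\<rho> r) = N r"
    and \<psi>: "\<And>p q c. 0 < p \<Longrightarrow> p < q \<Longrightarrow> c \<in> carrier G \<Longrightarrow> \<psi> p q (\<rho> p c) = \<rho> q c"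
  shows "persistence_iso (\<lambda>r. G Mod N r) (\<lambda>p q. quotient_bond G (N q)) H \<psi>
      (\<lambda>r. induced_on_cosets (\<rho> r))"
proof -
  have gh: "group_hom G (H r) (\<rho> r)" if "r > 0" for r
    using G H \<rho> that by (simp add: group_hom_def group_hom_axioms_def)
  have norm: "N r \<lhd> G" if "r > 0" for r
    using group_hom.normal_kernel[OF gh[OF that]] ker[OF that] by simp
  have sub: "N p \<subseteq> N q" if pq: "0 < p" "p < q" for p q
  proof
    fix c assume "c \<in> N p"
    then have c: "c \<in> carrier G" "\<rho> p c = \<one>\<^bsub>H p\<^esub>" using ker[of p] pq by (auto simp: kernel_def)
    have q: "0 < q" using pq by linarith
    \<comment> \<open>\<open>c\<close> and the unit of \<open>G\<close> have the same image under
      \<open>\<rho> p\<close>, hence under \<open>\<rho> q\<close>; so the kernels increase.\<close>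
    have "\<rho> q c = \<psi> p q (\<rho> p \<one>\<^bsub>G\<^esub>)"
      using \<psi>[OF pq c(1)] c(2) group_hom.hom_one[OF gh[OF pq(1)]] by simp
    also have "\<dots> = \<one>\<^bsub>H q\<^esub>"
      using \<psi>[OF pq, of "\<one>\<^bsub>G\<^esub>"] group_hom.hom_one[OF gh[OF q]] group.is_monoid[OF G]
        monoid.one_closed by fastforce
    finally show "c \<in> N q" using ker[OF q] c by (auto simp: kernel_def)
  qed
  have bond: "quotient_bond G (N q) (N p #>\<^bsub>G\<^esub> a) = N q #>\<^bsub>G\<^esub> a" if "0 < p" "p < q" "a \<in> carrier G"
    for p q a
    using quotient_bond_coset[OF norm norm sub] that by simp
  have carr: "carrier (G Mod N r) = (\<lambda>a. N r #>\<^bsub>G\<^esub> a) ` carrier G" for r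
    by (rule carrier_FactGroup)
  have Nhom: "(\<lambda>a. N r #>\<^bsub>G\<^esub> a) \<in> hom G (G Mod N r)" if "r > 0" for r
    using normal.r_coset_hom_Mod[OF norm[OF that]] .
  have ind: "induced_on_cosets (\<rho> r) (N r #>\<^bsub>G\<^esub> a) = \<rho> r a" if "r > 0" "a \<in> carrier G" for r a
    using induced_on_cosets_coset[OF gh[OF that(1)] that(2)] ker[OF that(1)] by simp
  have mult: "a \<otimes>\<^bsub>G\<^esub> b \<in> carrier G" if "a \<in> carrier G" "b \<in> carrier G" for a b
    using G that by (simp add: group.is_monoid monoid.m_closed)
  show ?thesis
    unfolding persistence_iso_def persistence_def
  proof (intro conjI allI impI ballI)
    fix r :: real assume r: "r > 0"
    show "group (G Mod N r)" using normal.factorgroup_is_group[OF norm[OF r]] .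
    show "group (H r)" using H[OF r] .
    have "induced_on_cosets (\<rho> r) = (\<lambda>Q. the_elem (\<rho> r ` Q))" by (auto simp: induced_on_cosets_def)
    then show "induced_on_cosets (\<rho> r) \<in> iso (G Mod N r) (H r)"
      using group_hom.FactGroup_iso_set[OF gh[OF r] onto[OF r]] ker[OF r] by simp
  next
    fix p q :: real assume pq: "0 < p \<and> p < q"
    then have p: "0 < p" and pq': "p < q" and q: "0 < q" by auto
    show "quotient_bond G (N q) \<in> hom (G Mod N p) (G Mod N q)"
    proof (rule homI)
      fix A assume "A \<in> carrier (G Mod N p)"
      then obtain a where a: "a \<in> carrier G" "A = N p #>\<^bsub>G\<^esub> a" by (auto simp: carr)
      show "quotient_bond G (N q) A \<in> carrier (G Mod N q)" using bond[OF p pq'] a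
        by (auto simp: carr)
      fix B assume "B \<in> carrier (G Mod N p)"
      then obtain b where b: "b \<in> carrier G" "B = N p #>\<^bsub>G\<^esub> b" by (auto simp: carr)
      show "quotient_bond G (N q) (A \<otimes>\<^bsub>G Mod N p\<^esub> B) = quotient_bond G (N q) A
        \<otimes>\<^bsub>G Mod N q\<^esub> quotient_bond G (N q) B"
        using hom_mult[OF Nhom[OF p] a(1) b(1)] hom_mult[OF Nhom[OF q] a(1) b(1)] bond[OF p pq'] a b
          mult by metis
    qed
    show "\<psi> p q \<in> hom (H p) (H q)"
    proof (rule homI)
      fix A assume "A \<in> carrier (H p)"
      then obtain a where a: "a \<in> carrier G" "A = \<rho> p a" using onto[OF p] by auto
      show "\<psi> p q A \<in> carrier (H q)" using \<psi>[OF p pq'] a onto[OF q] by auto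
      fix B assume "B \<in> carrier (H p)"
      then obtain b where b: "b \<in> carrier G" "B = \<rho> p b" using onto[OF p] by auto
      show "\<psi> p q (A \<otimes>\<^bsub>H p\<^esub> B) = \<psi> p q A \<otimes>\<^bsub>H q\<^esub> \<psi> p q B"
        using hom_mult[OF \<rho>[OF p] a(1) b(1)] hom_mult[OF \<rho>[OF q] a(1) b(1)] \<psi>[OF p pq'] a b mult
          by metis
    qed
    fix A assume "A \<in> carrier (G Mod N p)"
    then obtain a where a: "a \<in> carrier G" "A = N p #>\<^bsub>G\<^esub> a" by (auto simp: carr)
    show "induced_on_cosets (\<rho> q) (quotient_bond G (N q) A) = \<psi> p q (induced_on_cosets (\<rho> p) A)"
      using bond[OF p pq'] ind p q \<psi>[OF p pq'] a by simp
  next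
    fix p q s :: real assume pqs: "0 < p \<and> p < q \<and> q < s"
    then have p: "0 < p" "p < q" "p < s" "0 < q" "q < s" by auto
    fix A assume "A \<in> carrier (G Mod N p)"
    then obtain a where a: "a \<in> carrier G" "A = N p #>\<^bsub>G\<^esub> a" by (auto simp: carr)
    show "quotient_bond G (N s) (quotient_bond G (N q) A) = quotient_bond G (N s) A"
      using bond p a by simp
  next
    fix p q s :: real assume pqs: "0 < p \<and> p < q \<and> q < s"
    then have p: "0 < p" "p < q" "p < s" "0 < q" "q < s" by auto
    fix A assume "A \<in> carrier (H p)"
    then obtain a where a: "a \<in> carrier G" "A = \<rho> p a" using onto[OF p(1)] by auto
    show "\<psi> q s (\<psi> p q A) = \<psi> p s A"
      using \<psi> p a by simp
  qed
qed

text \<open>A version of \<open>subpath\<close> without type class constraints on the points.\<close>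

definition restrict_path :: "real \<Rightarrow> real \<Rightarrow> (real \<Rightarrow> 'b) \<Rightarrow> real \<Rightarrow> 'b" where
  "restrict_path a b f = f \<circ> linepath a b"

lemma path_homotopic_restrict_path_join:
  assumes "pathin Y f" "a \<in> {0..1}" "b \<in> {0..1}" "c \<in> {0..1}"
  shows "path_homotopic Y (restrict_path a b f +++ restrict_path b c f) (restrict_path a c f)"
proof -
  have "restrict_path a b f +++ restrict_path b c f = f \<circ> (linepath a b +++ linepath b c)"
    by (auto simp: joinpaths_def restrict_path_def)
  moreover have "path_homotopic Y (f \<circ> (linepath a b +++ linepath b c)) (f \<circ> linepath a c)"
    using assms by (intro path_homotopic_reparam)
      (auto simp: path_image_join linepath_0' linepath_1' closed_segment_eq_real_ivl split:
        if_splits)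
  ultimately show ?thesis by (simp add: restrict_path_def)
qed

lemma linepath_in_01: "a \<in> {0..1} \<Longrightarrow> b \<in> {0..1} \<Longrightarrow> t \<in> {0..1} \<Longrightarrow> linepath a b t \<in> {0..1::real}"
  using closed_segment_subset[of a "{0..1}" b] linepath_in_path[of t a b] by auto

lemma pathin_restrict_path:
  assumes "pathin Y f" "a \<in> {0..1}" "b \<in> {0..1}"
  shows "pathin Y (restrict_path a b f)"
  unfolding pathin_def restrict_path_def o_def
  by (rule continuous_map_compose_on[OF assms(1)[unfolded pathin_def]])
    (use linepath_in_01[OF assms(2,3)] in blast)+

lemma restrict_path_simps [simp]:
  "restrict_path a b f 0 = f a" "restrict_path a b f 1 = f b" "restrict_path 0 1 f = f"
  by (auto simp: restrict_path_def linepath_def)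

lemma path_class_reversepath:
  assumes "tail_system Y y T" "pathin Y p"
  shows "path_class Y y T (reversepath p) = inv\<^bsub>fundamental_group Y y\<^esub> path_class Y y T p"
proof -
  have "y \<in> topspace Y" using assms(1) by (simp add: tail_system_def)
  then interpret group "fundamental_group Y y" by (rule group_fundamental_group)
  note r = pathin_reversepath[OF assms(2)]
  have "path_class Y y T (reversepath p +++ p) = \<one>\<^bsub>fundamental_group Y y\<^esub>"
    using path_class_eq[OF assms(1) path_homotopic_linv[OF assms(2)]] path_class_const[OF assms(1)]
      pathin_ends(2)[OF assms(2)] by simp
  then have "path_class Y y T (reversepath p) \<otimes>\<^bsub>fundamental_group Y y\<^esub> path_class Y y T p
    = \<one>\<^bsub>fundamental_group Y y\<^esub>"
    using path_class_join[OF assms(1) r assms(2)] by simp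
  then show ?thesis
    using path_class_closed[OF assms(1) r] path_class_closed[OF assms] inv_equality by metis
qed

lemma fundamental_group_incl_class:
  assumes "continuous_map Y Z (\<lambda>x. x)" "f \<in> based_loops Y y"
  shows "fundamental_group_incl Z y (loop_class Y y f) = loop_class Z y f"
proof -
  have f: "f \<in> based_loops Z y"
    using assms pathin_compose[of Y f Z "\<lambda>x. x"] by (auto simp: based_loops_def o_def)
  have "loop_class Z y g = loop_class Z y f" if "g \<in> loop_class Y y f" for g
  proof -
    have "path_homotopic Y f g" using that loop_class_path_homotopic[OF assms(2)] by simp
    then have "path_homotopic Z f g" using path_homotopic_compose[OF _ assms(1), of f g]
      by (simp add: o_def)
    then show ?thesis using loop_class_eq[OF _ f] by metis
  qed
  then show ?thesis using in_loop_class[OF assms(2)] unfolding fundamental_group_incl_def by blast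
qed

text \<open>Runs along edges to a vertex of the carrier of \<open>z\<close>, then straight to
  \<open>z\<close>. The base vertex is treated apart because a \<open>tail_system\<close> has a
  constant tail there.\<close>

definition complex_tail :: "'a \<Rightarrow> ('a \<Rightarrow> 'a list) \<Rightarrow> ('a \<Rightarrow> real) \<Rightarrow> real \<Rightarrow> 'a \<Rightarrow> real" where
  "complex_tail b L z =
     (if z = vertex b then (\<lambda>t. vertex b)
      else edge_path (L (some_vertex z)) +++ seg (vertex (some_vertex z)) z)"

text \<open>\<open>L\<close> witnesses that the 1-skeleton is connected. It is a parameter so that
  the edge paths can later be taken as samples of prescribed paths in a space.\<close>

locale edge_connected_complex =
  fixes K :: "'a set set" and b :: 'a and L :: "'a \<Rightarrow> 'a list"
  assumes complex: "is_complex K" and base: "{b} \<in> K" and Lb: "L b = [b]"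
    and L: "\<And>v. {v} \<in> K \<Longrightarrow>
      L v \<noteq> [] \<and> hd (L v) = b \<and> last (L v) = v \<and> successively (\<lambda>u v. {u, v} \<in> K) (L v)"
begin

abbreviation "R \<equiv> realization K"
abbreviation "T \<equiv> complex_tail b L"
abbreviation "P \<equiv> fundamental_group R (vertex b)"
abbreviation "pc \<equiv> path_class R (vertex b) T"
abbreviation "E \<equiv> edge_class K b T"

lemma edge_path_L:
  assumes "{v} \<in> K"
  shows "pathin R (edge_path (L v))" "edge_path (L v) 0 = vertex b" "edge_path (L v) 1 = vertex v"
  using edge_path_facts[OF complex, of "L v"] L[OF assms] base by auto

lemma some_vertex_seg:
  assumes "z \<in> topspace R"
  shows "{some_vertex z} \<in> K" "pathin R (seg (vertex (some_vertex z)) z)"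
proof -
  note S = support_in_complex[OF complex assms]
  have v: "some_vertex z \<in> support z" using some_vertex_pos[OF complex assms] by simp
  then show "{some_vertex z} \<in> K" using is_complexD(3)[OF complex S(1), of "{some_vertex z}"]
    by simp
  show "pathin R (seg (vertex (some_vertex z)) z)"
    using pathin_seg[OF complex S(1)] S(3) v vertex_in_simplex[OF S(2)] by blast
qed

lemma tail: "tail_system R (vertex b) T"
  unfolding tail_system_def
proof (intro conjI ballI)
  show b: "vertex b \<in> topspace R" using vertex_topspace[OF complex base] by simp
  show "T (vertex b) = (\<lambda>t. vertex b)" by (simp add: complex_tail_def)
  fix z assume z: "z \<in> topspace R"
  note s = some_vertex_seg[OF z] and l = edge_path_L[OF some_vertex_seg(1)[OF z]]
  show "pathin R (T z)" "T z 0 = vertex b" "T z 1 = z"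
    using b s l by (auto simp: complex_tail_def intro!: pathin_join)
qed

sublocale group P
  using tail by (intro group_fundamental_group) (simp add: tail_system_def)

lemma tail_homotopic:
  assumes "z \<in> topspace R"
  shows "path_homotopic R (T z) (edge_path (L (some_vertex z)) +++ seg (vertex (some_vertex z)) z)"
proof (cases "z = vertex b")
  case True
  have "(\<lambda>t. vertex b) +++ (\<lambda>t. vertex b) = (\<lambda>t. vertex b)" by (simp add: joinpaths_def)
  then show ?thesis using True assms Lb by (simp add: complex_tail_def path_homotopic_refl)
next
  case False
  have "pathin R (T z)" using tail assms by (simp add: tail_system_def)
  from path_homotopic_refl[OF this] False show ?thesis by (simp add: complex_tail_def)
qed

lemma path_class_L:
  assumes "{v} \<in> K" shows "pc (edge_path (L v)) = \<one>\<^bsub>P\<^esub>"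
proof -
  have v: "vertex v \<in> topspace R" using vertex_topspace[OF complex assms] by simp
  note l = edge_path_L[OF assms]
  have "path_homotopic R (T (vertex v)) (edge_path (L v) +++ (\<lambda>t. vertex v))"
    using tail_homotopic[OF v] by simp
  also have "path_homotopic R \<dots> (edge_path (L v))" using path_homotopic_rid[OF l(1)] l(3) by simp
  finally show ?thesis using path_class_eq[OF tail] path_class_tail[OF tail v] by metis
qed

text \<open>The tail to \<open>z\<close> and its part along edges both have trivial class, so the
  last segment has trivial class too.\<close>

lemma path_class_seg_some_vertex:
  assumes "z \<in> topspace R" shows "pc (seg (vertex (some_vertex z)) z) = \<one>\<^bsub>P\<^esub>"
proof -
  note s = some_vertex_seg[OF assms] and l = edge_path_L[OF some_vertex_seg(1)[OF assms]]
  have "\<one>\<^bsub>P\<^esub> = pc (edge_path (L (some_vertex z)) +++ seg (vertex (some_vertex z)) z)"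
    using path_class_eq[OF tail tail_homotopic[OF assms]] path_class_tail[OF tail assms] by simp
  also have "\<dots> = pc (seg (vertex (some_vertex z)) z)"
    using path_class_join[OF tail l(1) s(2)] l path_class_L[OF s(1)] path_class_closed[OF tail s(2)]
      by simp
  finally show ?thesis by simp
qed

lemma path_class_seg_vertex:
  assumes "z \<in> topspace R" "z v > 0"
  shows "{some_vertex z, v} \<in> K" "pc (seg z (vertex v)) = E (some_vertex z) v"
    "pc (seg (vertex v) z) = E v (some_vertex z)"
proof -
  note S = support_in_complex[OF complex assms(1)]
  let ?n = "some_vertex z"
  have n: "?n \<in> support z" using some_vertex_pos[OF complex assms(1)] by simp
  have v: "v \<in> support z" using assms(2) by (simp add: support_def)
  have V: "vertex ?n \<in> geometric_simplex (support z)" "vertex v \<in> geometric_simplex (support z)"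
    using n v vertex_in_simplex[OF S(2)] by auto
  show "{?n, v} \<in> K" using is_complexD(3)[OF complex S(1), of "{?n, v}"] n v by simp
  note p = pathin_seg[OF complex S(1)]
  have one: "pc (seg (vertex ?n) z) = \<one>\<^bsub>P\<^esub>" using path_class_seg_some_vertex[OF assms(1)] .
  have r: "reversepath (seg x y) = seg y x" for x y :: "'a \<Rightarrow> real"
    by (simp add: reversepath_def seg_def add.commute)
  have one': "pc (seg z (vertex ?n)) = \<one>\<^bsub>P\<^esub>"
    using path_class_reversepath[OF tail p[OF V(1) S(3)]] one by (simp add: r)
  show "pc (seg z (vertex v)) = E ?n v"
    using path_class_eq[OF tail seg_triangle[OF complex S(1) V(1) S(3) V(2)]]
      path_class_join[OF tail p[OF V(1) S(3)] p[OF S(3) V(2)]] one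
        path_class_closed[OF tail p[OF S(3) V(2)]]
    by (simp add: edge_class_def)
  show "pc (seg (vertex v) z) = E v ?n"
    using path_class_eq[OF tail seg_triangle[OF complex S(1) V(2) S(3) V(1)]]
      path_class_join[OF tail p[OF V(2) S(3)] p[OF S(3) V(1)]] one'
        path_class_closed[OF tail p[OF V(2) S(3)]]
    by (simp add: edge_class_def)
qed

text \<open>This takes the place of simplicial approximation. By bisection it suffices to treat
  short pieces of the path; each lies in an open star, where it is homotopic to two segments whose
  classes are classes of edges.\<close>

lemma path_class_in_subgroup:
  assumes "subgroup H P" "\<And>u v. {u, v} \<in> K \<Longrightarrow> E u v \<in> H" "pathin R f"
  shows "pc f \<in> H"
proof -
  interpret H: subgroup H P by fact
  have "(0::real) \<le> 1" by simp
  then have "0 \<le> (0::real) \<longrightarrow> (1::real) \<le> 1 \<longrightarrow> (0::real) \<le> 1 \<longrightarrow> pc (restrict_path 0 1 f) \<in> H"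
  proof
    (induction rule: Bolzano[of 0 1 "\<lambda>a c. 0 \<le> a \<longrightarrow> c \<le> 1 \<longrightarrow> a \<le> c \<longrightarrow> pc (restrict_path a c f) \<in> H"])
    case (trans a b c)
    show ?case
    proof (intro impI)
      assume ac: "0 \<le> a" "c \<le> 1" "a \<le> c"
      then have i: "a \<in> {0..1}" "b \<in> {0..1}" "c \<in> {0..1}" using trans by auto
      have "pc (restrict_path a c f) = pc (restrict_path a b f) \<otimes>\<^bsub>P\<^esub> pc (restrict_path b c f)"
        using path_class_eq[OF tail path_homotopic_restrict_path_join[OF assms(3) i]]
          path_class_join[OF tail pathin_restrict_path[OF assms(3) i(1,2)]
            pathin_restrict_path[OF assms(3) i(2,3)]] by simp
      then show "pc (restrict_path a c f) \<in> H" using trans ac i by auto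
    qed
  next
    case (local x)
    define v where "v = some_vertex (f x)"
    have fx: "f x \<in> topspace R" using pathin_topspace[OF assms(3), of x] local by simp
    have fv: "f x v > 0" using some_vertex_pos[OF complex fx] by (simp add: v_def)
    have "continuous_on {0..1} (\<lambda>t. f t v)"
      using continuous_map_into_realizationD[OF assms(3)[unfolded pathin_def], of v] by simp
    \<comment> \<open>While the coordinate of \<open>v\<close> changes by less than its value at
      \<open>x\<close>, it stays positive and the path stays in the open star of
      \<open>v\<close>.\<close>
    then obtain d where d: "d > 0" "\<And>t. t \<in> {0..1} \<Longrightarrow> dist t x < d \<Longrightarrow> dist (f t v) (f x v) < f x v"
      using fv local unfolding continuous_on_iff by (metis atLeastAtMost_iff)
    have "pc (restrict_path a c f) \<in> H" if "a \<le> x" "x \<le> c" "c - a < d" "0 \<le> a" "c \<le> 1" for a c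
    proof -
      have i: "a \<in> {0..1}" "c \<in> {0..1}" using that by auto
      have pos: "f t v > 0" if "a \<le> t" "t \<le> c" for t
      proof -
        have "dist t x < d" "t \<in> {0..1}"
          using that \<open>a \<le> x\<close> \<open>x \<le> c\<close> \<open>c - a < d\<close> i by (auto simp: dist_real_def)
        then have "\<bar>f t v - f x v\<bar> < f x v" using d(2) by (simp add: dist_real_def)
        then show ?thesis by linarith
      qed
      have ps: "pathin R (restrict_path a c f)" using pathin_restrict_path[OF assms(3) i] .
      have "restrict_path a c f t v > 0" if "t \<in> {0..1}" for t
        using linepath_in_path[OF that, of a c] pos \<open>a \<le> x\<close> \<open>x \<le> c\<close>
        by (simp add: restrict_path_def closed_segment_eq_real_ivl)
      from path_class_eq[OF tail star_path_homotopic[OF complex ps this]]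
      have "pc (restrict_path a c f) = pc (seg (f a) (vertex v) +++ seg (vertex v) (f c))" by simp
      also have "\<dots> = pc (seg (f a) (vertex v)) \<otimes>\<^bsub>P\<^esub> pc (seg (vertex v) (f c))"
      proof (rule path_class_join[OF tail])
        have "\<exists>\<sigma>\<in>K. f t \<in> geometric_simplex \<sigma> \<and> vertex v \<in> geometric_simplex \<sigma>" if "t \<in> {a, c}"
          for t
          using common_simplex_vertex[OF complex pathin_topspace[OF assms(3), of t] pos[of t]] that
            i \<open>a \<le> x\<close> \<open>x \<le> c\<close> by auto
        then show "pathin R (seg (f a) (vertex v))" "pathin R (seg (vertex v) (f c))"
          using pathin_seg[OF complex] by blast+
      qed simp
      also have "\<dots> \<in> H"
        using path_class_seg_vertex[OF pathin_topspace[OF assms(3) i(1)] pos[of a]]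
          path_class_seg_vertex[OF pathin_topspace[OF assms(3) i(2)] pos[of c]] assms(2) that
        by (auto simp: insert_commute)
      finally show ?thesis .
    qed
    then show ?case using d(1) by blast
  qed
  then have "pc (restrict_path 0 1 f) \<in> H" by simp
  then show ?thesis by simp
qed

end

section \<open>The fundamental group of the Rips complex\<close>

text \<open>A finite set attains its diameter, so strict bounds for the pairs give a strict bound
  for the diameter.\<close>

lemma rips_iff:
  assumes "finite \<sigma>" "\<sigma> \<noteq> {}" "\<sigma> \<subseteq> X"
  shows "\<sigma> \<in> rips X r \<longleftrightarrow> (\<forall>x\<in>\<sigma>. \<forall>y\<in>\<sigma>. dist x y < r)"
proof
  assume "\<sigma> \<in> rips X r"
  then have "diameter \<sigma> < r" by (simp add: rips_def)
  then show "\<forall>x\<in>\<sigma>. \<forall>y\<in>\<sigma>. dist x y < r"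
    using diameter_bounded_bound[OF finite_imp_bounded[OF assms(1)]] by fastforce
next
  assume *: "\<forall>x\<in>\<sigma>. \<forall>y\<in>\<sigma>. dist x y < r"
  let ?D = "(\<lambda>(x, y). dist x y) ` (\<sigma> \<times> \<sigma>)"
  have D: "finite ?D" "?D \<noteq> {}" using assms by auto
  then have "Max ?D \<in> ?D" by (rule Max_in)
  then have "Max ?D < r" using * by auto
  moreover have "diameter \<sigma> \<le> Max ?D"
    using assms(2) D(1) by (intro diameter_le_dist Max_ge) auto
  ultimately have "diameter \<sigma> < r" by linarith
  then show "\<sigma> \<in> rips X r" using assms by (auto simp: rips_def)
qed

lemma is_complex_rips: "is_complex (rips X r)"
  unfolding is_complex_def
proof (intro ballI conjI allI impI)
  fix \<sigma> \<tau> assume s: "\<sigma> \<in> rips X r" and t: "\<tau> \<noteq> {}" "\<tau> \<subseteq> \<sigma>"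
  then have "finite \<sigma>" "\<sigma> \<noteq> {}" "\<sigma> \<subseteq> X" by (auto simp: rips_def)
  then show "\<tau> \<in> rips X r" using s t rips_iff[of \<sigma> X r] rips_iff[of \<tau> X r] finite_subset[OF t(2)]
    by blast
qed (auto simp: rips_def)

lemma rips_subset_carrier: "\<sigma> \<in> rips X r \<Longrightarrow> \<sigma> \<subseteq> X"
  by (auto simp: rips_def)

lemma rips_mono: "p \<le> q \<Longrightarrow> rips X p \<subseteq> rips X q"
  by (auto simp: rips_def)

lemma rips_triangle:
  assumes "r > 0"
  shows "{x, y, z} \<in> rips X r \<longleftrightarrow> x \<in> X \<and> y \<in> X \<and> z \<in> X \<and> dist x y < r \<and> dist y z < r \<and> dist x z < r"
proof (cases "{x, y, z} \<subseteq> X")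
  case True
  have "{x, y, z} \<in> rips X r \<longleftrightarrow> (\<forall>u\<in>{x, y, z}. \<forall>v\<in>{x, y, z}. dist u v < r)"
    by (rule rips_iff) (use True in simp_all)
  also have "\<dots> \<longleftrightarrow> dist x y < r \<and> dist y z < r \<and> dist x z < r"
    using assms dist_commute[of x y] dist_commute[of y z] dist_commute[of x z] by fastforce
  finally show ?thesis using True by simp
next
  case False
  then have "{x, y, z} \<notin> rips X r" using rips_subset_carrier by metis
  then show ?thesis using False by blast
qed

lemma rips_edge: "r > 0 \<Longrightarrow> {x, y} \<in> rips X r \<longleftrightarrow> x \<in> X \<and> y \<in> X \<and> dist x y < r"
  using rips_triangle[of r x x y X] by simp

lemma complex_cocycle_rips:
  assumes "r > 0"
  shows "complex_cocycle Q (rips X r) e \<longleftrightarrow> rips_cocycle Q X r e"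
  unfolding complex_cocycle_def rips_cocycle_def rips_triangle[OF assms] by blast

lemma successively_rips:
  assumes "r > 0" "set vs \<subseteq> X"
  shows "successively (\<lambda>u v. {u, v} \<in> rips X r) vs \<longleftrightarrow> successively (\<lambda>u v. dist u v < r) vs"
  using assms by (intro successively_cong) (auto simp: rips_edge)

definition geodesic :: "'a::metric_space set \<Rightarrow> 'a \<Rightarrow> 'a \<Rightarrow> real \<Rightarrow> 'a" where
  "geodesic X x y = (SOME \<gamma>. is_geodesic X x y \<gamma>)"

lemma is_geodesic_geodesic:
  assumes "geodesic_space X" "x \<in> X" "y \<in> X"
  shows "is_geodesic X x y (geodesic X x y)"
proof -
  obtain \<gamma> where "is_geodesic X x y \<gamma>" using geodesic_exists[OF assms] .
  then show ?thesis unfolding geodesic_def by (rule someI[of "is_geodesic X x y"])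
qed

lemma geodesic_facts:
  assumes "geodesic_space X" "x \<in> X" "y \<in> X"
  shows "pathin (top_of_set X) (geodesic X x y)" "geodesic X x y 0 = x" "geodesic X x y 1 = y"
    "s \<in> {0..1} \<Longrightarrow> t \<in> {0..1} \<Longrightarrow> dist (geodesic X x y s) (geodesic X x y t) \<le> dist x y"
  using is_geodesic_geodesic[OF assms] is_geodesic_dist[OF is_geodesic_geodesic[OF assms]]
  by (auto simp: is_geodesic_def)

lemma holonomy_short:
  assumes "group Q" "rips_cocycle Q X r e" "r > 0" "pathin (top_of_set X) f"
    "\<And>s t. s \<in> {0..1} \<Longrightarrow> t \<in> {0..1} \<Longrightarrow> dist (f s) (f t) < r"
  shows "holonomy Q e f = e (f 0) (f 1)"
proof -
  interpret group Q by fact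
  have "fine_sample r f [0, 1]" using assms(5) by (simp add: fine_sample_def)
  from holonomy_fine[OF assms(1-4) this] have "holonomy Q e f = e (f 0) (f 1) \<otimes>\<^bsub>Q\<^esub> \<one>\<^bsub>Q\<^esub>" by simp
  moreover have "e (f 0) (f 1) \<in> carrier Q"
    using path_pathin_canon(2)[OF assms(4)] assms(5)
      by (intro rips_cocycle_closed[OF assms(2)]) auto
  ultimately show ?thesis by simp
qed

lemma r_sample_holonomy_based:
  assumes "group Q" "rips_cocycle Q X r e" "r > 0" "pathin (top_of_set X) f" "f 0 = f 1"
      "r_sample r f ts" "hd ts = 0"
  shows "edge_prod Q e (sample_loop f ts) = holonomy Q e f"
proof -
  interpret group Q by fact
  have "e (f 0) (f 0) = \<one>\<^bsub>Q\<^esub>"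
    using rips_cocycle_refl[OF assms(1-3)] path_pathin_canon(2)[OF assms(4)] by simp
  then show ?thesis
    using r_sample_holonomy(2)[OF assms(1-6)]
      holonomy_closed[OF assms(1) local_cocycle_rips[OF assms(2,3)] assms(4)] assms(7)
    by simp
qed

section \<open>The maps on fundamental groups\<close>

locale based_geodesic_space =
  fixes X :: "'a::metric_space set" and b :: 'a
  assumes geodesic_space: "geodesic_space X" and base: "b \<in> X"
begin

definition tail :: "'a \<Rightarrow> real \<Rightarrow> 'a" where
  "tail x = (if x = b then (\<lambda>t. b) else geodesic X b x)"

lemma tail_system: "tail_system (top_of_set X) b tail"
  using geodesic_facts[OF geodesic_space base] base by (auto simp: tail_system_def tail_def)

abbreviation "PX \<equiv> pi1_space X b"
abbreviation "pc \<equiv> path_class (top_of_set X) b tail"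

sublocale PX: group PX
  using base by (intro group_fundamental_group) simp

text \<open>The edge paths to the vertices sample the tails in \<open>X\<close>. With these matching
  choices the tails of \<open>X\<close> have trivial holonomy in \<open>P r\<close>, so that no
  conjugation appears in \<open>rho_pi1_path_class\<close>.\<close>

definition tail_list :: "real \<Rightarrow> 'a \<Rightarrow> 'a list" where
  "tail_list r x = (if x = b then [b]
     else map (tail x) (SOME ts. fine_sample r (tail x) ts \<and> ts \<noteq> [] \<and> hd ts = 0 \<and> last ts = 1))"

lemma tail_facts:
  assumes "x \<in> X"
  shows "pathin (top_of_set X) (tail x)" "tail x 0 = b" "tail x 1 = x"
  using tail_system assms by (auto simp: tail_system_def)

lemma tail_list_sample:
  assumes "r > 0" "x \<in> X" "x \<noteq> b"
  obtains ts where "tail_list r x = map (tail x) ts" "fine_sample r (tail x) ts" "ts \<noteq> []"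
    "hd ts = 0" "last ts = 1"
proof -
  have "\<exists>ts. fine_sample r (tail x) ts \<and> ts \<noteq> [] \<and> hd ts = 0 \<and> last ts = 1"
    using fine_exists[OF path_pathin_canon(1)[OF tail_facts(1)[OF assms(2)]] assms(1)] by metis
  from someI_ex[OF this] show thesis using that assms(3) unfolding tail_list_def by auto
qed

lemma edge_connected_rips:
  assumes "r > 0" shows "edge_connected_complex (rips X r) b (tail_list r)"
proof
  show "is_complex (rips X r)" by (rule is_complex_rips)
  show "{b} \<in> rips X r" using rips_edge[OF assms, of b b X] base assms by simp
  show "tail_list r b = [b]" by (simp add: tail_list_def)
  fix v assume "{v} \<in> rips X r"
  then have v: "v \<in> X" using rips_subset_carrier by blast
  show "tail_list r v \<noteq> [] \<and> hd (tail_list r v) = b \<and> last (tail_list r v) = v \<and>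
      successively (\<lambda>u v. {u, v} \<in> rips X r) (tail_list r v)"
  proof (cases "v = b")
    case True
    then show ?thesis by (simp add: tail_list_def)
  next
    case False
    obtain ts where ts: "tail_list r v = map (tail v) ts" "fine_sample r (tail v) ts" "ts \<noteq> []"
      "hd ts = 0" "last ts = 1"
      using tail_list_sample[OF assms v False] .
    have "set (map (tail v) ts) \<subseteq> X"
      using ts(2) path_pathin_canon(2)[OF tail_facts(1)[OF v]] by (auto simp: fine_sample_def)
    then have "successively (\<lambda>u v. {u, v} \<in> rips X r) (tail_list r v)"
      using successively_rips[OF assms, of "map (tail v) ts" X] fine_successively[OF ts(2)] ts(1)
        by simp
    then show ?thesis
      using ts tail_facts[OF v] by (simp add: hd_map last_map)
  qed
qed

abbreviation "P r \<equiv> pi1_rips X b r"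
abbreviation "pcr r \<equiv> path_class (realization (rips X r)) (vertex b) (complex_tail b (tail_list r))"
abbreviation "E r \<equiv> edge_class (rips X r) b (complex_tail b (tail_list r))"

lemma group_pi1_rips: "r > 0 \<Longrightarrow> group (P r)"
  using edge_connected_complex.tail[OF edge_connected_rips]
  by (intro group_fundamental_group) (simp add: tail_system_def)

lemma E_cocycle:
  assumes "r > 0" shows "rips_cocycle (P r) X r (E r)"
  using complex_cocycle_edge_class[OF is_complex_rips
    edge_connected_complex.tail[OF edge_connected_rips[OF assms]]]
    complex_cocycle_rips[OF assms] by blast

text \<open>The class of an edge path is the product of its edge classes, and along a sample this
  product is the holonomy. The conjugating edge of \<open>r_sample_holonomy\<close> is trivial
  because the sample starts at time 0.\<close>

lemma pi1_sample_class:
  assumes r: "r > 0" and f: "f \<in> based_loops (top_of_set X) b" and ts: "r_sample r f ts" "hd ts = 0"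
  shows "loop_class (realization (rips X r)) (vertex b) (edge_path (sample_loop f ts))
      = holonomy (P r) (E r) f"
    "edge_path (sample_loop f ts) \<in> based_loops (realization (rips X r)) (vertex b)"
    "sample_loop f ts \<noteq> []" "set (sample_loop f ts) \<subseteq> X" "hd (sample_loop f ts) = b"
    "successively (\<lambda>u v. {u, v} \<in> rips X r) (sample_loop f ts)"
proof -
  interpret C: edge_connected_complex "rips X r" b "tail_list r" by (rule edge_connected_rips[OF r])
  have f': "pathin (top_of_set X) f" "f 0 = b" "f 1 = b" using f by (auto simp: based_loops_def)
  note H = r_sample_holonomy[OF group_pi1_rips[OF r] E_cocycle[OF r] r f'(1) _ ts(1)]
  let ?vs = "sample_loop f ts"
  have ne: "ts \<noteq> []" "set ts \<subseteq> {0..1}" using ts(1) by (auto simp: r_sample_def)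
  show vs: "?vs \<noteq> []" "hd ?vs = b" using ne ts(2) f'
    by (auto simp: sample_loop_def hd_append hd_map)
  have l: "last ?vs = b" using ts(2) f' by (simp add: sample_loop_def)
  show X: "set ?vs \<subseteq> X" using ne path_pathin_canon(2)[OF f'(1)] ts(2)
    by (auto simp: sample_loop_def)
  show s: "successively (\<lambda>u v. {u, v} \<in> rips X r) ?vs"
    using H(3) f' successively_rips[OF r X] by simp
  note F = edge_path_facts[OF is_complex_rips vs(1) s]
  show bl: "edge_path ?vs \<in> based_loops (realization (rips X r)) (vertex b)"
    using F vs l C.base by (simp add: based_loops_def)
  have e: "E r b b = \<one>\<^bsub>P r\<^esub>"
    using rips_cocycle_refl[OF group_pi1_rips[OF r] E_cocycle[OF r] r base] .
  have h: "holonomy (P r) (E r) f \<in> carrier (P r)"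
    using holonomy_closed[OF group_pi1_rips[OF r] local_cocycle_rips[OF E_cocycle[OF r] r] f'(1)] .
  have "loop_class (realization (rips X r)) (vertex b) (edge_path ?vs) = pcr r (edge_path ?vs)"
    using path_class_loop[OF C.tail bl] by simp
  also have "\<dots> = edge_prod (P r) (E r) ?vs"
    using path_class_edge_path[OF is_complex_rips C.tail vs(1) s] vs(2) C.base by simp
  also have "\<dots> = holonomy (P r) (E r) f"
    using H(2) f' ts(2) e h by simp
  finally show "loop_class (realization (rips X r)) (vertex b) (edge_path ?vs)
    = holonomy (P r) (E r) f" .
qed

text \<open>All classes in the union that defines \<open>rho_pi1\<close> equal the holonomy, by
  homotopy invariance, and the union is not empty since samples exist.\<close>

lemma rho_pi1_class:
  assumes r: "r > 0" and f: "f \<in> based_loops (top_of_set X) b"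
  shows "rho_pi1 X b r (loop_class (top_of_set X) b f) = holonomy (P r) (E r) f"
proof -
  have *: "loop_class (realization (rips X r)) (vertex b) (edge_path (sample_loop g ts))
    = holonomy (P r) (E r) f"
    if g: "g \<in> loop_class (top_of_set X) b f" and ts: "r_sample r g ts" "hd ts = 0" for g ts
  proof -
    have "path_homotopic (top_of_set X) f g" using g loop_class_path_homotopic[OF f] by simp
    then have "holonomy (P r) (E r) f = holonomy (P r) (E r) g"
      using holonomy_homotopic[OF group_pi1_rips[OF r] local_cocycle_rips[OF E_cocycle[OF r] r]]
        by blast
    moreover have "g \<in> based_loops (top_of_set X) b" using g by (simp add: loop_class_def)
    ultimately show ?thesis using pi1_sample_class(1)[OF r _ ts] by simp
  qed
  obtain ts where "r_sample r f ts" "hd ts = 0"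
    using r_sample_exists[of f r] f r path_pathin_canon(1) by (auto simp: based_loops_def)
  then show ?thesis
    unfolding rho_pi1_def using * in_loop_class[OF f] by blast
qed

lemma rho_pi1_hom:
  assumes r: "r > 0" shows "rho_pi1 X b r \<in> hom PX (P r)"
proof -
  note lc = local_cocycle_rips[OF E_cocycle[OF r] r]
  have "rho_pi1 X b r C = holonomy_map (P r) (E r) C" if "C \<in> carrier PX" for C
    using that rho_pi1_class[OF r] holonomy_map_loop_class[OF group_pi1_rips[OF r] lc]
    by (auto simp: carrier_fundamental_group)
  then show ?thesis
    using holonomy_map_hom[OF group_pi1_rips[OF r] lc, of b] PX.m_closed
      by (simp add: hom_def Pi_iff)
qed

text \<open>\<open>tail_list\<close> is a fine sample of the tail, and its edge path has trivial
  class since it is, up to homotopy, the tail in the realization.\<close>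

lemma tail_holonomy:
  assumes r: "r > 0" and x: "x \<in> X"
  shows "holonomy (P r) (E r) (tail x) = \<one>\<^bsub>P r\<^esub>"
proof (cases "x = b")
  case True
  then show ?thesis
    using holonomy_const[OF group_pi1_rips[OF r] local_cocycle_rips[OF E_cocycle[OF r] r], of b]
      base
    by (simp add: tail_def)
next
  case False
  interpret C: edge_connected_complex "rips X r" b "tail_list r" by (rule edge_connected_rips[OF r])
  obtain ts where ts: "tail_list r x = map (tail x) ts" "fine_sample r (tail x) ts" "ts \<noteq> []"
    "hd ts = 0" "last ts = 1"
    using tail_list_sample[OF r x False] .
  have v: "{x} \<in> rips X r" using rips_edge[OF r, of x x X] x r by simp
  have "holonomy (P r) (E r) (tail x) = edge_prod (P r) (E r) (tail_list r x)"
    using holonomy_fine[OF group_pi1_rips[OF r] E_cocycle[OF r] r tail_facts(1)[OF x] ts(2-5)] ts(1)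
      by simp
  also have "\<dots> = pcr r (edge_path (tail_list r x))"
    using path_class_edge_path[OF is_complex_rips C.tail, of "tail_list r x"] C.L[OF v] C.base
      by simp
  also have "\<dots> = \<one>\<^bsub>P r\<^esub>" using C.path_class_L[OF v] .
  finally show ?thesis .
qed

lemma rho_pi1_path_class:
  assumes r: "r > 0" and f: "pathin (top_of_set X) f"
  shows "rho_pi1 X b r (pc f) = holonomy (P r) (E r) f"
proof -
  interpret Pr: group "P r" by (rule group_pi1_rips[OF r])
  note lc = local_cocycle_rips[OF E_cocycle[OF r] r]
  note J = holonomy_join[OF Pr.group_axioms lc]
  have X: "f 0 \<in> X" "f 1 \<in> X" using path_pathin_canon(2)[OF f] by auto
  note t0 = tail_facts[OF X(1)] and t1 = tail_facts[OF X(2)]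
  note r1 = pathin_reversepath[OF t1(1)]
  have p: "pathin (top_of_set X) (f +++ reversepath (tail (f 1)))"
    using f r1 t1 by (auto intro!: pathin_join)
  have "rho_pi1 X b r (pc f)
    = holonomy (P r) (E r) (tail (f 0) +++ (f +++ reversepath (tail (f 1))))"
    unfolding path_class_def by (rule rho_pi1_class[OF r tail_loop[OF tail_system f]])
  also have "\<dots> = holonomy (P r) (E r) f"
    using J[OF t0(1) p] J[OF f r1] t0 t1 tail_holonomy[OF r X(1)] tail_holonomy[OF r X(2)]
      holonomy_reversepath[OF Pr.group_axioms lc t1(1)] holonomy_closed[OF Pr.group_axioms lc f]
        by simp
  finally show ?thesis .
qed

lemma rho_pi1_surj:
  assumes r: "r > 0" shows "rho_pi1 X b r ` carrier PX = carrier (P r)"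
proof
  interpret C: edge_connected_complex "rips X r" b "tail_list r" by (rule edge_connected_rips[OF r])
  interpret h: group_hom PX "P r" "rho_pi1 X b r"
    using PX.group_axioms group_pi1_rips[OF r] rho_pi1_hom[OF r]
      by (simp add: group_hom_def group_hom_axioms_def)
  show "rho_pi1 X b r ` carrier PX \<subseteq> carrier (P r)" by auto
  show "carrier (P r) \<subseteq> rho_pi1 X b r ` carrier PX"
  proof
    fix A assume "A \<in> carrier (P r)"
    then obtain f where f: "f \<in> based_loops (realization (rips X r)) (vertex b)"
      and A: "A = loop_class (realization (rips X r)) (vertex b) f"
      by (auto simp: carrier_fundamental_group)
    \<comment> \<open>An edge class is the image of the class of a geodesic, and the edge classes
      generate by \<open>path_class_in_subgroup\<close>.\<close>
    have "E r u v \<in> rho_pi1 X b r ` carrier PX" if "{u, v} \<in> rips X r" for u v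
    proof -
      have uv: "u \<in> X" "v \<in> X" "dist u v < r" using that rips_edge[OF r] by auto
      note g = geodesic_facts[OF geodesic_space uv(1,2)]
      have "rho_pi1 X b r (pc (geodesic X u v)) = holonomy (P r) (E r) (geodesic X u v)"
        by (rule rho_pi1_path_class[OF r g(1)])
      also have "\<dots> = E r u v"
        using holonomy_short[OF group_pi1_rips[OF r] E_cocycle[OF r] r g(1)] g uv(3) by fastforce
      finally show ?thesis using path_class_closed[OF tail_system g(1)] by (metis imageI)
    qed
    then have "pcr r f \<in> rho_pi1 X b r ` carrier PX"
      using f by (intro C.path_class_in_subgroup h.img_is_subgroup) (auto simp: based_loops_def)
    then show "A \<in> rho_pi1 X b r ` carrier PX"
      using path_class_loop[OF C.tail f] A by simp
  qed
qed

text \<open>In terms of \<open>path_class\<close> a lasso becomes a conjugate, although its stem and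
  its small loop need not be loops at \<open>b\<close>.\<close>

lemma lasso_class:
  assumes "pathin (top_of_set X) f" "f 0 = b" "pathin (top_of_set X) g" "g 0 = f 1" "g 1 = f 1"
  shows "loop_class (top_of_set X) b (f +++ g +++ reversepath f) = pc f \<otimes>\<^bsub>PX\<^esub> pc g
      \<otimes>\<^bsub>PX\<^esub> inv\<^bsub>PX\<^esub> (pc f)"
    "f +++ g +++ reversepath f \<in> based_loops (top_of_set X) b"
proof -
  note rf = pathin_reversepath[OF assms(1)]
  have gr: "pathin (top_of_set X) (g +++ reversepath f)" using assms rf
    by (auto intro!: pathin_join)
  show bl: "f +++ g +++ reversepath f \<in> based_loops (top_of_set X) b"
    using assms gr by (auto simp: based_loops_def intro!: pathin_join)
  note J = path_class_join[OF tail_system] and cl = path_class_closed[OF tail_system]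
  show "loop_class (top_of_set X) b (f +++ g +++ reversepath f) = pc f \<otimes>\<^bsub>PX\<^esub> pc g
    \<otimes>\<^bsub>PX\<^esub> inv\<^bsub>PX\<^esub> (pc f)"
    using path_class_loop[OF tail_system bl] J[OF assms(1) gr] J[OF assms(3) rf] assms
      path_class_reversepath[OF tail_system assms(1)] cl[OF assms(1)] cl[OF assms(3)]
        by (simp add: PX.m_assoc)
qed

lemma lassos_iff:
  "h \<in> lassos X b d \<longleftrightarrow> (\<exists>f g. h = f +++ g +++ reversepath f \<and> pathin (top_of_set X) f \<and> f 0 = b \<and>
     loop_in_small_ball X d g \<and> g 0 = f 1)"
  unfolding lassos_def pathin_canon_iff by (auto simp: path_image_def pathstart_def pathfinish_def)

lemma loop_in_small_ballD:
  assumes "loop_in_small_ball X d g"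
  shows "pathin (top_of_set X) g" "g 1 = g 0"
  using assms
    by (auto simp: loop_in_small_ball_def pathin_canon_iff path_image_def pathstart_def
      pathfinish_def)

text \<open>The conjugate of a lasso by a loop is again a lasso: the loop is put in front of the
  stem.\<close>

lemma S_pi1_normal: "S_pi1 X b d \<lhd> PX"
  unfolding S_pi1_def
proof (rule PX.normal_generateI)
  show "loop_class (top_of_set X) b ` lassos X b d \<subseteq> carrier PX"
  proof
    fix A assume "A \<in> loop_class (top_of_set X) b ` lassos X b d"
    then obtain f g where A: "A = loop_class (top_of_set X) b (f +++ g +++ reversepath f)"
      and fg: "pathin (top_of_set X) f" "f 0 = b" "loop_in_small_ball X d g" "g 0 = f 1"
      by (auto simp: lassos_iff)
    then show "A \<in> carrier PX"
      using lasso_class(2)[OF fg(1,2)] loop_in_small_ballD[OF fg(3)]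
        by (auto simp: carrier_fundamental_group)
  qed
  fix A C assume "A \<in> loop_class (top_of_set X) b ` lassos X b d" and "C \<in> carrier PX"
  then obtain f g h where A: "A = loop_class (top_of_set X) b (f +++ g +++ reversepath f)"
    and fg: "pathin (top_of_set X) f" "f 0 = b" "loop_in_small_ball X d g" "g 0 = f 1"
    and h: "h \<in> based_loops (top_of_set X) b" "C = loop_class (top_of_set X) b h"
    by (auto simp: lassos_iff carrier_fundamental_group)
  note g = loop_in_small_ballD[OF fg(3)]
  have h': "pathin (top_of_set X) h" "h 0 = b" "h 1 = b" using h(1) by (auto simp: based_loops_def)
  have hf: "pathin (top_of_set X) (h +++ f)" using h' fg by (auto intro!: pathin_join)
  note cl = path_class_closed[OF tail_system]
  have C: "C = pc h" using path_class_loop[OF tail_system h(1)] h(2) by simp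
  have "C \<otimes>\<^bsub>PX\<^esub> A \<otimes>\<^bsub>PX\<^esub> inv\<^bsub>PX\<^esub> C
    = loop_class (top_of_set X) b ((h +++ f) +++ g +++ reversepath (h +++ f))"
    using lasso_class(1)[OF fg(1,2) g(1)] lasso_class(1)[OF hf _ g(1)] g fg h'
      path_class_join[OF tail_system h'(1) fg(1)] cl[OF fg(1)] cl[OF g(1)] cl[OF h'(1)]
    by (simp add: A C PX.m_assoc PX.inv_mult_group)
  moreover have "(h +++ f) +++ g +++ reversepath (h +++ f) \<in> lassos X b d"
    using hf fg h' unfolding lassos_iff by (metis joinpaths_0_1)
  ultimately show "C \<otimes>\<^bsub>PX\<^esub> A \<otimes>\<^bsub>PX\<^esub> inv\<^bsub>PX\<^esub> C \<in> loop_class (top_of_set X) b ` lassos X b d" by blast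
qed

text \<open>The tail to the start of the loop serves as the stem, and its class is trivial.\<close>

lemma small_loop_in_S_pi1:
  assumes "loop_in_small_ball X d g"
  shows "pc g \<in> S_pi1 X b d"
proof -
  note g = loop_in_small_ballD[OF assms]
  have X: "g 0 \<in> X" using path_pathin_canon(2)[OF g(1)] by simp
  note t = tail_facts[OF X]
  have "loop_class (top_of_set X) b (tail (g 0) +++ g +++ reversepath (tail (g 0))) = pc g"
    using lasso_class(1)[OF t(1,2) g(1)] t(3) g(2) path_class_tail[OF tail_system, of "g 0"] X
      path_class_closed[OF tail_system g(1)] by simp
  moreover have "tail (g 0) +++ g +++ reversepath (tail (g 0)) \<in> lassos X b d"
    unfolding lassos_iff using t assms by (intro exI[of _ "tail (g 0)"] exI[of _ g]) simp
  ultimately show ?thesis unfolding S_pi1_def by (metis generate.incl imageI)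
qed

text \<open>The holonomy of this cocycle is the class of the path itself; this gives the injectivity
  of \<open>rho_pi1\<close> modulo small lassos.\<close>

definition geodesic_cocycle :: "real \<Rightarrow> 'a \<Rightarrow> 'a \<Rightarrow> (real \<Rightarrow> 'a) set set" where
  "geodesic_cocycle r x y = S_pi1 X b (3 * r / 2) #>\<^bsub>PX\<^esub> pc (geodesic X x y)"

text \<open>The cocycle law says that geodesic triangles are trivial modulo small lassos, which
  holds by \<open>geodesic_triangle_small\<close>.\<close>

lemma rips_cocycle_geodesic:
  shows "rips_cocycle (PX Mod S_pi1 X b (3 * r / 2)) X r (geodesic_cocycle r)"
  unfolding rips_cocycle_def
proof (intro ballI impI conjI)
  interpret N: normal "S_pi1 X b (3 * r / 2)" PX by (rule S_pi1_normal)
  fix x y z assume X: "x \<in> X" "y \<in> X" "z \<in> X" and d: "dist x y < r" "dist y z < r" "dist x z < r"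
  note gs = geodesic_facts[OF geodesic_space] and ig = is_geodesic_geodesic[OF geodesic_space]
  note g = gs(1-3)[OF X(1,2)] gs(1-3)[OF X(2,3)] gs(1-3)[OF X(1,3)]
  have c: "pc (geodesic X x y) \<in> carrier PX" "pc (geodesic X y z) \<in> carrier PX"
    "pc (geodesic X x z) \<in> carrier PX"
    using path_class_closed[OF tail_system] g by auto
  show "geodesic_cocycle r x y \<in> carrier (PX Mod S_pi1 X b (3 * r / 2))"
    using c by (auto simp: geodesic_cocycle_def carrier_FactGroup)
  have "pc (geodesic X x y +++ (geodesic X y z +++ reversepath (geodesic X x z)))
    \<in> S_pi1 X b (3 * r / 2)"
    by
      (rule small_loop_in_S_pi1[OF geodesic_triangle_small[OF ig[OF X(1,2)] ig[OF X(2,3)]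
        ig[OF X(1,3)] d]])
  moreover have "pc (geodesic X x y +++ (geodesic X y z +++ reversepath (geodesic X x z))) =
      pc (geodesic X x y) \<otimes>\<^bsub>PX\<^esub> pc (geodesic X y z) \<otimes>\<^bsub>PX\<^esub> inv\<^bsub>PX\<^esub> pc (geodesic X x z)"
    using path_class_join[OF tail_system g(1) pathin_join[OF g(4) pathin_reversepath[OF g(7)]]]
      path_class_join[OF tail_system g(4) pathin_reversepath[OF g(7)]]
        path_class_reversepath[OF tail_system g(7)] g c
    by (simp add: PX.m_assoc)
  ultimately have S:
    "pc (geodesic X x y) \<otimes>\<^bsub>PX\<^esub> pc (geodesic X y z) \<otimes>\<^bsub>PX\<^esub> inv\<^bsub>PX\<^esub> pc (geodesic X x z)
      \<in> S_pi1 X b (3 * r / 2)"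
    by simp
  have "pc (geodesic X x y) \<otimes>\<^bsub>PX\<^esub> pc (geodesic X y z)
    \<in> S_pi1 X b (3 * r / 2) #>\<^bsub>PX\<^esub> pc (geodesic X x z)"
    using PX.rcosI[OF S N.subset c(3)] c by (simp add: PX.m_assoc)
  then have "S_pi1 X b (3 * r / 2) #>\<^bsub>PX\<^esub> (pc (geodesic X x y) \<otimes>\<^bsub>PX\<^esub> pc (geodesic X y z)) =
      S_pi1 X b (3 * r / 2) #>\<^bsub>PX\<^esub> pc (geodesic X x z)"
    using PX.repr_independence[OF _ c(3) N.subgroup_axioms] by simp
  then show "geodesic_cocycle r x y \<otimes>\<^bsub>PX Mod S_pi1 X b (3 * r / 2)\<^esub> geodesic_cocycle r y z
    = geodesic_cocycle r x z"
    using c by (simp add: geodesic_cocycle_def FactGroup_def N.rcos_sum)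
qed

text \<open>The coset of the class of \<open>f\<close> on [0, t] is a primitive: over a short time
  \<open>f\<close> and the geodesic between its ends form a loop in a ball of radius below
  r.\<close>

lemma holonomy_geodesic_cocycle:
  assumes r: "r > 0" and f: "f \<in> based_loops (top_of_set X) b"
  shows "holonomy (PX Mod S_pi1 X b (3 * r / 2)) (geodesic_cocycle r) f
      = S_pi1 X b (3 * r / 2) #>\<^bsub>PX\<^esub> loop_class (top_of_set X) b f"
proof -
  let ?S = "S_pi1 X b (3 * r / 2)"
  let ?Q = "PX Mod ?S"
  interpret N: normal ?S PX by (rule S_pi1_normal)
  interpret Q: group ?Q by (rule N.factorgroup_is_group)
  have f': "pathin (top_of_set X) f" "f 0 = b" "f 1 = b" using f by (auto simp: based_loops_def)
  note p = path_pathin_canon[OF f'(1)]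
  note gs = geodesic_facts[OF geodesic_space] and ig = is_geodesic_geodesic[OF geodesic_space]
  note cl = path_class_closed[OF tail_system]
  define \<kappa> where "\<kappa> t = ?S #>\<^bsub>PX\<^esub> pc (restrict_path 0 t f)" for t
  have "uniformly_continuous_on {0..1} f"
    using p(1) by (intro compact_uniformly_continuous) (auto simp: path_def)
  then obtain \<delta>
    where \<delta>: "\<delta> > 0" "\<And>s t. s \<in> {0..1} \<Longrightarrow> t \<in> {0..1} \<Longrightarrow> dist s t < \<delta> \<Longrightarrow> dist (f s) (f t) < r"
    using r unfolding uniformly_continuous_on_def by metis
  have kc: "\<kappa> t \<in> carrier ?Q" if "t \<in> {0..1}" for t
    using cl[OF pathin_restrict_path[OF f'(1) _ that]] by (auto simp: \<kappa>_def carrier_FactGroup)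
  have "primitive ?Q (geodesic_cocycle r) f {0..1} \<kappa>"
    unfolding primitive_def
  proof (intro conjI exI[of _ \<delta>] ballI impI)
    fix s t :: real assume st: "s \<in> {0..1}" "t \<in> {0..1}" "dist s t < \<delta>"
    have X: "f s \<in> X" "f t \<in> X" using p st by auto
    let ?g = "geodesic X (f s) (f t)" and ?h = "restrict_path s t f"
    note g = gs[OF X]
    have h: "pathin (top_of_set X) ?h" using pathin_restrict_path[OF f'(1) st(1,2)] .
    have h0: "pathin (top_of_set X) (restrict_path 0 s f)"
      "pathin (top_of_set X) (restrict_path 0 t f)"
      using pathin_restrict_path[OF f'(1)] st by auto
    have "dist (?h u) (?h v) < r" if "u \<in> {0..1}" "v \<in> {0..1}" for u v
    proof -
      have "dist (linepath s t u) (linepath s t v) \<le> dist s t"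
      proof -
        have "linepath s t u - linepath s t v = (u - v) * (t - s)"
          by (simp add: linepath_def algebra_simps)
        then have "dist (linepath s t u) (linepath s t v) = \<bar>u - v\<bar> * dist s t"
          by (simp add: dist_real_def abs_mult abs_minus_commute)
        also have "\<dots> \<le> 1 * dist s t" using that by (intro mult_right_mono) auto
        finally show ?thesis by simp
      qed
      then show ?thesis
        unfolding restrict_path_def o_def using st linepath_in_01[OF st(1,2)] that
          by (intro \<delta>(2)) auto
    qed
    then have "loop_in_small_ball X r (?h +++ reversepath ?g)"
      using short_path_geodesic_small[OF h] ig[OF X] by simp
    then have "loop_in_small_ball X (3 * r / 2) (?h +++ reversepath ?g)"
      by (rule loop_in_small_ball_mono) (use r in simp)
    from small_loop_in_S_pi1[OF this] have S: "pc ?h \<otimes>\<^bsub>PX\<^esub> inv\<^bsub>PX\<^esub> pc ?g \<in> ?S"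
      using path_class_join[OF tail_system h pathin_reversepath[OF g(1)]]
        path_class_reversepath[OF tail_system g(1)] g by simp
    have "pc ?h \<in> ?S #>\<^bsub>PX\<^esub> pc ?g"
      using PX.rcosI[OF S N.subset cl[OF g(1)]] cl[OF g(1)] cl[OF h] by (simp add: PX.m_assoc)
    then have e: "geodesic_cocycle r (f s) (f t) = ?S #>\<^bsub>PX\<^esub> pc ?h"
      using PX.repr_independence[OF _ cl[OF g(1)] N.subgroup_axioms]
        by (simp add: geodesic_cocycle_def)
    show "geodesic_cocycle r (f s) (f t) \<in> carrier ?Q" using cl[OF h]
      by (auto simp: e carrier_FactGroup)
    have "pc (restrict_path 0 t f) = pc (restrict_path 0 s f) \<otimes>\<^bsub>PX\<^esub> pc ?h"
      using path_class_eq[OF tail_system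
        path_homotopic_restrict_path_join[OF f'(1) _ st(1,2), of 0]]
        path_class_join[OF tail_system h0(1) h] by simp
    then show "\<kappa> s \<otimes>\<^bsub>?Q\<^esub> geodesic_cocycle r (f s) (f t) = \<kappa> t"
      using cl[OF h] cl[OF h0(1)] by (simp add: e \<kappa>_def FactGroup_def N.rcos_sum)
  qed (use kc \<delta> in auto)
  from holonomy_primitive[OF Q.group_axioms this]
  have "holonomy ?Q (geodesic_cocycle r) f = inv\<^bsub>?Q\<^esub> \<kappa> 0 \<otimes>\<^bsub>?Q\<^esub> \<kappa> 1" .
  moreover have "restrict_path 0 0 f = (\<lambda>t. b)" using f'
    by (auto simp: restrict_path_def linepath_def)
  then have "\<kappa> 0 = \<one>\<^bsub>?Q\<^esub>"
    using path_class_const[OF tail_system, of b] base N.subset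
      by (simp add: \<kappa>_def PX.coset_mult_one)
  ultimately have "holonomy ?Q (geodesic_cocycle r) f = \<kappa> 1"
    using kc[of 1]
      by (simp only: Q.inv_one Q.l_one atLeastAtMost_iff order_refl zero_le_one simp_thms)
  also have "\<dots> = ?S #>\<^bsub>PX\<^esub> loop_class (top_of_set X) b f"
    using path_class_loop[OF tail_system f] by (simp add: \<kappa>_def)
  finally show ?thesis .
qed

lemma kernel_rho_pi1:
  assumes r: "r > 0" shows "kernel PX (P r) (rho_pi1 X b r) = S_pi1 X b (3 * r / 2)"
proof
  let ?S = "S_pi1 X b (3 * r / 2)"
  let ?Q = "PX Mod ?S"
  interpret h: group_hom PX "P r" "rho_pi1 X b r"
    using PX.group_axioms group_pi1_rips[OF r] rho_pi1_hom[OF r]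
      by (simp add: group_hom_def group_hom_axioms_def)
  interpret N: normal ?S PX by (rule S_pi1_normal)
  interpret Q: group ?Q by (rule N.factorgroup_is_group)
  note cl = path_class_closed[OF tail_system]
  show "?S \<subseteq> kernel PX (P r) (rho_pi1 X b r)"
    unfolding S_pi1_def
  proof (rule PX.generate_subgroup_incl[OF _ h.subgroup_kernel], rule subsetI)
    fix A assume "A \<in> loop_class (top_of_set X) b ` lassos X b (3 * r / 2)"
    then obtain f g where A: "A = loop_class (top_of_set X) b (f +++ g +++ reversepath f)"
      and fg: "pathin (top_of_set X) f" "f 0 = b" "loop_in_small_ball X (3 * r / 2) g" "g 0 = f 1"
      by (auto simp: lassos_iff)
    note g = loop_in_small_ballD[OF fg(3)]
    have "rho_pi1 X b r (pc g) = \<one>\<^bsub>P r\<^esub>"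
      using rho_pi1_path_class[OF r g(1)]
        loop_in_small_ball_holonomy[OF geodesic_space group_pi1_rips[OF r] E_cocycle[OF r] fg(3)]
          by simp
    moreover have "A = pc f \<otimes>\<^bsub>PX\<^esub> pc g \<otimes>\<^bsub>PX\<^esub> inv\<^bsub>PX\<^esub> (pc f)"
      using lasso_class(1)[OF fg(1,2) g(1)] fg(4) g(2) A by simp
    ultimately show "A \<in> kernel PX (P r) (rho_pi1 X b r)"
      using cl[OF fg(1)] cl[OF g(1)] by (simp add: kernel_def)
  qed
  show "kernel PX (P r) (rho_pi1 X b r) \<subseteq> ?S"
  proof
    fix A assume "A \<in> kernel PX (P r) (rho_pi1 X b r)"
    then have A: "A \<in> carrier PX" "rho_pi1 X b r A = \<one>\<^bsub>P r\<^esub>" by (auto simp: kernel_def)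
    then obtain f where f: "f \<in> based_loops (top_of_set X) b" "A = loop_class (top_of_set X) b f"
      by (auto simp: carrier_fundamental_group)
    have f': "pathin (top_of_set X) f" "f 0 = b" "f 1 = b" using f by (auto simp: based_loops_def)
    obtain ts where ts: "r_sample r f ts" "hd ts = 0"
      using r_sample_exists[of f r] f' r path_pathin_canon(1) by metis
    note S = pi1_sample_class[OF r f(1) ts]
    \<comment> \<open>This cocycle gives a homomorphism from \<open>P r\<close> to the quotient. It
      maps the class of the sample, which is trivial by assumption on \<open>A\<close>, to the
      product of geodesic cosets along the sample, and that product is the coset of
      \<open>A\<close>.\<close>
    let ?c = "star_cocycle ?Q (geodesic_cocycle r)"
    have cc: "complex_cocycle ?Q (rips X r) (geodesic_cocycle r)"
      using complex_cocycle_rips[OF r] rips_cocycle_geodesic by blast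
    note lc = local_cocycle_star[OF Q.group_axioms cc is_complex_rips]
    have "holonomy_map ?Q ?c
      (loop_class (realization (rips X r)) (vertex b) (edge_path (sample_loop f ts))) = \<one>\<^bsub>?Q\<^esub>"
      using A(2) rho_pi1_class[OF r f(1)] f(2) S(1)
        hom_one[OF holonomy_map_hom[OF Q.group_axioms lc] group_pi1_rips[OF r] Q.group_axioms]
          by simp
    then have "holonomy ?Q ?c (edge_path (sample_loop f ts)) = \<one>\<^bsub>?Q\<^esub>"
      using holonomy_map_loop_class[OF Q.group_axioms lc S(2)] by simp
    then have 1: "edge_prod ?Q (geodesic_cocycle r) (sample_loop f ts) = \<one>\<^bsub>?Q\<^esub>"
      using holonomy_edge_path[OF Q.group_axioms cc is_complex_rips S(3,6)] S(5)
        rips_edge[OF r, of b b X] base r by simp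
    then have "holonomy ?Q (geodesic_cocycle r) f = \<one>\<^bsub>?Q\<^esub>"
      using r_sample_holonomy_based[OF Q.group_axioms rips_cocycle_geodesic r f'(1) _ ts] f' by simp
    then have "?S #>\<^bsub>PX\<^esub> A = ?S" using holonomy_geodesic_cocycle[OF r f(1)] f(2) by simp
    then show "A \<in> ?S" using PX.coset_join1[OF _ A(1) N.subgroup_axioms] by simp
  qed
qed

lemma continuous_map_realization_mono:
  assumes "K \<subseteq> K'" shows "continuous_map (realization K) (realization K') (\<lambda>x. x)"
  unfolding continuous_map_def
proof (intro conjI allI impI)
  fix U assume U: "openin (realization K') U"
  have "{x \<in> topspace (realization K). x \<in> U} \<inter> geometric_simplex \<sigma> = U \<inter> geometric_simplex \<sigma>"
    if "\<sigma> \<in> K" for \<sigma>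
    using that by (auto simp: topspace_realization)
  then show "openin (realization K) {x \<in> topspace (realization K). x \<in> U}"
    using U assms unfolding openin_realization[of K]
      by (auto simp: openin_realization topspace_realization)
qed (use assms in \<open>auto simp: topspace_realization\<close>)

text \<open>A sample at scale p is also one at scale q, with the same edge path.\<close>

lemma rho_pi1_natural:
  assumes "0 < p" "p < q" "C \<in> carrier PX"
  shows "fundamental_group_incl (realization (rips X q)) (vertex b) (rho_pi1 X b p C)
      = rho_pi1 X b q C"
proof -
  have q: "0 < q" using assms by linarith
  obtain f where f: "f \<in> based_loops (top_of_set X) b" "C = loop_class (top_of_set X) b f"
    using assms(3) by (auto simp: carrier_fundamental_group)
  obtain ts where ts: "r_sample p f ts" "hd ts = 0"
    using r_sample_exists[of f p] f(1) assms(1) path_pathin_canon(1) by (auto simp: based_loops_def)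
  have ts': "r_sample q f ts" using ts(1) assms(2) by (auto simp: r_sample_def intro: less_trans)
  have "rho_pi1 X b p C
    = loop_class (realization (rips X p)) (vertex b) (edge_path (sample_loop f ts))"
    using rho_pi1_class[OF assms(1) f(1)] pi1_sample_class(1)[OF assms(1) f(1) ts] f(2) by simp
  moreover have "rho_pi1 X b q C
    = loop_class (realization (rips X q)) (vertex b) (edge_path (sample_loop f ts))"
    using rho_pi1_class[OF q f(1)] pi1_sample_class(1)[OF q f(1) ts' ts(2)] f(2) by simp
  moreover have "rips X p \<subseteq> rips X q" using assms by (intro rips_mono) simp
  ultimately show ?thesis
    using fundamental_group_incl_class[OF continuous_map_realization_mono
      pi1_sample_class(2)[OF assms(1) f(1) ts]] by simp
qed

lemma persistence_iso_pi1:
  "persistence_iso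
     (\<lambda>r. pi1_space X b Mod S_pi1 X b (3 * r / 2))
     (\<lambda>p q. quotient_bond (pi1_space X b) (S_pi1 X b (3 * q / 2)))
     (\<lambda>r. pi1_rips X b r)
     (\<lambda>p q. fundamental_group_incl (realization (rips X q)) (vertex b))
     (\<lambda>r. induced_on_cosets (rho_pi1 X b r))"
  by (rule persistence_iso_kernels[where N = "\<lambda>r. S_pi1 X b (3 * r / 2)"])
    (auto simp: PX.group_axioms group_pi1_rips rho_pi1_hom rho_pi1_surj kernel_rho_pi1
      rho_pi1_natural)

end

section \<open>Chains\<close>

text \<open>The extension of a map from generators to chains. The coefficient is an argument of the
  family, since in a general abelian group it cannot be pulled out as a factor.\<close>

definition chain_ext :: "('s \<Rightarrow> 'g::zero \<Rightarrow> 'h::comm_monoid_add) \<Rightarrow> ('s \<Rightarrow>\<^sub>0 'g) \<Rightarrow> 'h" where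
  "chain_ext \<phi> c = (\<Sum>s\<in>Poly_Mapping.keys c. \<phi> s (Poly_Mapping.lookup c s))"

definition additive_family :: "('s \<Rightarrow> 'g::ab_group_add \<Rightarrow> 'h::ab_group_add) \<Rightarrow> bool" where
  "additive_family \<phi> \<longleftrightarrow> (\<forall>s a b. \<phi> s (a + b) = \<phi> s a + \<phi> s b)"

lemma additive_familyD:
  assumes "additive_family \<phi>"
  shows "\<phi> s (a + b) = \<phi> s a + \<phi> s b" "\<phi> s 0 = 0" "\<phi> s (- a) = - \<phi> s a"
      "\<phi> s (a - b) = \<phi> s a - \<phi> s b"
proof -
  have add: "\<phi> s (a + b) = \<phi> s a + \<phi> s b" for a b using assms by (simp add: additive_family_def)
  show "\<phi> s (a + b) = \<phi> s a + \<phi> s b" by (rule add)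
  show zero: "\<phi> s 0 = 0" using add[of 0 0] by simp
  have neg: "\<phi> s (- a) = - \<phi> s a" for a using add[of a "- a"] zero by (simp add: minus_unique)
  show "\<phi> s (- a) = - \<phi> s a" by (rule neg)
  show "\<phi> s (a - b) = \<phi> s a - \<phi> s b" using add[of a "- b"] neg[of b] by simp
qed

lemma chain_ext_superset:
  assumes "additive_family \<phi>" "finite A" "Poly_Mapping.keys c \<subseteq> A"
  shows "chain_ext \<phi> c = (\<Sum>s\<in>A. \<phi> s (Poly_Mapping.lookup c s))"
  unfolding chain_ext_def using assms
  by (intro sum.mono_neutral_left) (auto simp: in_keys_iff additive_familyD)

lemma chain_ext_add:
  assumes "additive_family \<phi>"
  shows "chain_ext \<phi> (c + c') = chain_ext \<phi> c + chain_ext \<phi> c'"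
proof -
  let ?A = "Poly_Mapping.keys c \<union> Poly_Mapping.keys c'"
  have "finite ?A" by simp
  then show ?thesis
    using chain_ext_superset[OF assms, of ?A c] chain_ext_superset[OF assms, of ?A c']
      chain_ext_superset[OF assms, of ?A "c + c'"]
      Poly_Mapping.keys_add[of c c']
    by (simp add: lookup_add additive_familyD[OF assms] sum.distrib)
qed

lemma chain_ext_zero [simp]: "chain_ext \<phi> 0 = 0"
  by (simp add: chain_ext_def)

lemma chain_ext_minus:
  assumes "additive_family \<phi>" shows "chain_ext \<phi> (- c) = - chain_ext \<phi> c"
  using chain_ext_add[OF assms, of c "- c"] by (simp add: minus_unique)

lemma chain_ext_diff:
  assumes "additive_family \<phi>" shows "chain_ext \<phi> (c - c') = chain_ext \<phi> c - chain_ext \<phi> c'"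
  using chain_ext_add[OF assms, of c "- c'"] chain_ext_minus[OF assms, of c'] by simp

lemma chain_ext_single:
  assumes "additive_family \<phi>" shows "chain_ext \<phi> (Poly_Mapping.single s g) = \<phi> s g"
  using additive_familyD(2)[OF assms] by (cases "g = 0") (auto simp: chain_ext_def)

lemma chain_ext_sum:
  assumes "additive_family \<phi>"
  shows "chain_ext \<phi> (\<Sum>i\<in>I. f i) = (\<Sum>i\<in>I. chain_ext \<phi> (f i))"
  by (induction I rule: infinite_finite_induct) (auto simp: chain_ext_add[OF assms])

lemma chain_ext_comp:
  assumes "additive_family \<psi>"
  shows "chain_ext \<psi> (chain_ext \<phi> c) = chain_ext (\<lambda>s g. chain_ext \<psi> (\<phi> s g)) c"
  by (simp add: chain_ext_def[of \<phi>] chain_ext_sum[OF assms]) (simp add: chain_ext_def)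

lemma chain_ext_id: "chain_ext Poly_Mapping.single c = c"
proof (rule poly_mapping_eqI)
  fix t
  show "Poly_Mapping.lookup (chain_ext Poly_Mapping.single c) t = Poly_Mapping.lookup c t"
    by (auto simp: chain_ext_def lookup_sum lookup_single when_def sum.delta' in_keys_iff)
qed

lemma chain_ext_diff_family:
  fixes \<phi> \<psi> :: "'s \<Rightarrow> 'g::zero \<Rightarrow> 'h::ab_group_add"
  shows "chain_ext (\<lambda>s g. \<phi> s g - \<psi> s g) c = chain_ext \<phi> c - chain_ext \<psi> c"
  by (simp add: chain_ext_def sum_subtractf)

lemma chain_ext_cong:
  "(\<And>s g. s \<in> Poly_Mapping.keys c \<Longrightarrow> \<phi> s g = \<psi> s g) \<Longrightarrow> chain_ext \<phi> c = chain_ext \<psi> c"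
  by (simp add: chain_ext_def)

section \<open>Subgroups and residue classes\<close>

definition add_subgroup :: "'c::ab_group_add set \<Rightarrow> bool" where
  "add_subgroup B \<longleftrightarrow> 0 \<in> B \<and> (\<forall>x\<in>B. \<forall>y\<in>B. x - y \<in> B)"

lemma add_subgroupD:
  assumes "add_subgroup B"
  shows "0 \<in> B" "x \<in> B \<Longrightarrow> y \<in> B \<Longrightarrow> x - y \<in> B" "x \<in> B \<Longrightarrow> - x \<in> B" "x \<in> B \<Longrightarrow> y \<in> B \<Longrightarrow> x + y \<in> B"
proof -
  have d: "x - y \<in> B" if "x \<in> B" "y \<in> B" for x y using assms that by (simp add: add_subgroup_def)
  show z: "0 \<in> B" using assms by (simp add: add_subgroup_def)
  show "x \<in> B \<Longrightarrow> y \<in> B \<Longrightarrow> x - y \<in> B" by (rule d)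
  have m: "- x \<in> B" if "x \<in> B" for x using d[OF z that] by simp
  show "x \<in> B \<Longrightarrow> - x \<in> B" by (rule m)
  show "x \<in> B \<Longrightarrow> y \<in> B \<Longrightarrow> x + y \<in> B" using d[of x "- y"] m[of y] by simp
qed

lemma add_subgroup_sum:
  "add_subgroup B \<Longrightarrow> (\<And>i. i \<in> I \<Longrightarrow> f i \<in> B) \<Longrightarrow> sum f I \<in> B"
  by (induction I rule: infinite_finite_induct) (auto intro: add_subgroupD)

definition residue :: "'c::ab_group_add set \<Rightarrow> 'c \<Rightarrow> 'c set" where
  "residue B z = (\<lambda>x. x + z) ` B"

lemma residue_eq_iff:
  assumes "add_subgroup B" shows "residue B z = residue B w \<longleftrightarrow> z - w \<in> B"
proof
  assume "residue B z = residue B w"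
  then have "z \<in> residue B w" using add_subgroupD(1)[OF assms] unfolding residue_def
    by (metis add_0 imageI)
  then show "z - w \<in> B" by (auto simp: residue_def)
next
  assume zw: "z - w \<in> B"
  show "residue B z = residue B w"
  proof (intro equalityI subsetI)
    fix u assume "u \<in> residue B z"
    then obtain x where "x \<in> B" "u = x + z" by (auto simp: residue_def)
    then show "u \<in> residue B w" using add_subgroupD(4)[OF assms _ zw, of x]
      unfolding residue_def by (intro image_eqI[of _ _ "x + (z - w)"]) (auto simp: algebra_simps)
  next
    fix u assume "u \<in> residue B w"
    then obtain x where "x \<in> B" "u = x + w" by (auto simp: residue_def)
    then show "u \<in> residue B z" using add_subgroupD(2)[OF assms _ zw, of x]
      unfolding residue_def by (intro image_eqI[of _ _ "x - (z - w)"]) (auto simp: algebra_simps)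
  qed
qed

lemma residue_zero: "residue B 0 = B"
  by (simp add: residue_def)

definition additive_group :: "'c::ab_group_add monoid" where
  "additive_group = \<lparr>carrier = UNIV, monoid.mult = (+), one = 0\<rparr>"

text \<open>Applied to all chains modulo boundaries, not only to cycles, so that a single edge has a
  class.\<close>

definition residue_group :: "'c::ab_group_add set \<Rightarrow> 'c set monoid" where
  "residue_group B = additive_group Mod B"

lemma comm_group_carrier_add:
  fixes C :: "'c::ab_group_add set"
  assumes "add_subgroup C"
  shows "comm_group \<lparr>carrier = C, monoid.mult = (+), one = 0\<rparr>"
proof (rule comm_groupI)
  fix x assume "x \<in> carrier \<lparr>carrier = C, monoid.mult = (+), one = 0\<rparr>"
  then show "\<exists>y\<in>carrier \<lparr>carrier = C, monoid.mult = (+), one = 0\<rparr>. y \<otimes>\<^bsub>\<lparr>carrier = C, monoid.mult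
    = (+), one = 0\<rparr>\<^esub> x = \<one>\<^bsub>\<lparr>carrier = C, monoid.mult = (+), one = 0\<rparr>\<^esub>"
    using add_subgroupD(3)[OF assms, of x] by (intro bexI[of _ "- x"]) auto
qed (use add_subgroupD[OF assms] in \<open>auto simp: algebra_simps\<close>)

lemma subgroup_carrier_add:
  fixes C :: "'c::ab_group_add set"
  assumes "add_subgroup C" "add_subgroup B" "B \<subseteq> C"
  shows "subgroup B \<lparr>carrier = C, monoid.mult = (+), one = 0\<rparr>" (is "subgroup B ?G")
proof -
  interpret comm_group ?G by (rule comm_group_carrier_add[OF assms(1)])
  show ?thesis
  proof (rule subgroupI)
    fix a assume a: "a \<in> B"
    have "inv\<^bsub>?G\<^esub> a = - a"
      using a assms(3) add_subgroupD(3)[OF assms(2) a] by (intro inv_equality) auto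
    then show "inv\<^bsub>?G\<^esub> a \<in> B" using add_subgroupD(3)[OF assms(2) a] by simp
  qed (use assms add_subgroupD[OF assms(2)] in auto)
qed

text \<open>Treats homology, where \<open>C\<close> consists of the cycles, together with
  \<open>residue_group\<close>, where \<open>C\<close> is everything.\<close>

lemma quotient_carrier_add:
  fixes C :: "'c::ab_group_add set"
  assumes "add_subgroup C" "add_subgroup B" "B \<subseteq> C"
  defines "G \<equiv> \<lparr>carrier = C, monoid.mult = (+), one = 0\<rparr>"
  shows "comm_group (G Mod B)" "carrier (G Mod B) = residue B ` C" "\<one>\<^bsub>G Mod B\<^esub> = B"
    "\<And>z w. z \<in> C \<Longrightarrow> w \<in> C \<Longrightarrow> residue B z \<otimes>\<^bsub>G Mod B\<^esub> residue B w = residue B (z + w)"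
proof -
  interpret comm_group G unfolding G_def by (rule comm_group_carrier_add[OF assms(1)])
  have s: "subgroup B G" unfolding G_def by (rule subgroup_carrier_add[OF assms(1-3)])
  have n: "B \<lhd> G" using s by (simp add: normal_iff_subgroup)
  show "comm_group (G Mod B)" using abelian_FactGroup[OF s] .
  have r: "B #>\<^bsub>G\<^esub> z = residue B z" for z by (auto simp: r_coset_def residue_def G_def)
  show "carrier (G Mod B) = residue B ` C" by (simp add: carrier_FactGroup r) (simp add: G_def)
  show "\<one>\<^bsub>G Mod B\<^esub> = B" by simp
  fix z w assume "z \<in> C" "w \<in> C"
  then show "residue B z \<otimes>\<^bsub>G Mod B\<^esub> residue B w = residue B (z + w)"
    using normal.rcos_sum[OF n, of z w] by (simp add: r[symmetric] FactGroup_def) (simp add: G_def)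
qed

lemma residue_group:
  assumes "add_subgroup B"
  shows "comm_group (residue_group B)" "carrier (residue_group B) = range (residue B)"
      "\<one>\<^bsub>residue_group B\<^esub> = B"
    "residue B z \<otimes>\<^bsub>residue_group B\<^esub> residue B w = residue B (z + w)"
  using quotient_carrier_add[OF _ assms subset_UNIV] unfolding residue_group_def additive_group_def
  by (auto simp: add_subgroup_def)

section \<open>First homology of simplices with face maps\<close>

lemma boundary_1:
    "boundary d 1 c
      = chain_ext (\<lambda>s g. Poly_Mapping.single (d 1 0 s) g - Poly_Mapping.single (d 1 1 s) g) c"
  by (simp add: boundary_def chain_ext_def single_uminus numeral_2_eq_2)

lemma boundary_2:
    "boundary d 2 c
      = chain_ext
        (\<lambda>s g. Poly_Mapping.single (d 2 0 s) g - Poly_Mapping.single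
          (d 2 1 s) g + Poly_Mapping.single (d 2 2 s) g) c"
  by (simp add: boundary_def chain_ext_def single_uminus numeral_2_eq_2)

lemma additive_boundary:
  "additive_family
    (\<lambda>s g. Poly_Mapping.single (d 1 0 s) g - Poly_Mapping.single
      (d 1 1 s) g :: 's \<Rightarrow>\<^sub>0 'g::ab_group_add)"
  "additive_family
    (\<lambda>s g. Poly_Mapping.single (d 2 0 s) g - Poly_Mapping.single (d 2 1 s) g + Poly_Mapping.single
      (d 2 2 s) g :: 's \<Rightarrow>\<^sub>0 'g::ab_group_add)"
  by (auto simp: additive_family_def single_add algebra_simps)

lemma boundary_1_simps:
  fixes c c' :: "'s \<Rightarrow>\<^sub>0 'g::ab_group_add"
  shows "boundary d 1 (c + c') = boundary d 1 c + boundary d 1 c'"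
    "boundary d 1 (c - c') = boundary d 1 c - boundary d 1 c'"
    "boundary d 1 (- c) = - boundary d 1 c"
    "boundary d 1 (sum f I) = (\<Sum>i\<in>I. boundary d 1 (f i :: 's \<Rightarrow>\<^sub>0 'g))"
    "boundary d 1 (Poly_Mapping.single s g) = Poly_Mapping.single (d 1 0 s) g
      - Poly_Mapping.single (d 1 1 s) (g :: 'g)"
    "boundary d 1 (0 :: 's \<Rightarrow>\<^sub>0 'g) = 0"
  unfolding boundary_1
  by (rule chain_ext_add chain_ext_diff chain_ext_minus chain_ext_sum chain_ext_single
    chain_ext_zero additive_boundary)+

lemma boundary_2_simps:
  fixes c c' :: "'s \<Rightarrow>\<^sub>0 'g::ab_group_add"
  shows "boundary d 2 (c - c') = boundary d 2 c - boundary d 2 c'"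
    "boundary d 2 (Poly_Mapping.single s g) =
       Poly_Mapping.single (d 2 0 s) g - Poly_Mapping.single (d 2 1 s) g + Poly_Mapping.single
         (d 2 2 s) (g :: 'g)"
  unfolding boundary_2
  by (rule chain_ext_diff chain_ext_single additive_boundary)+

declare One_nat_def [simp del]

text \<open>The part of a simplicial structure that first homology sees; the three identities make
  the boundary of a boundary vanish. The instances are singular simplices and ordered
  simplices.\<close>

locale face_complex =
  fixes S :: "nat \<Rightarrow> 's set" and d :: "nat \<Rightarrow> nat \<Rightarrow> 's \<Rightarrow> 's"
  assumes face: "\<And>s k. s \<in> S 2 \<Longrightarrow> k \<le> 2 \<Longrightarrow> d 2 k s \<in> S 1"
    and face_face: "\<And>s. s \<in> S 2 \<Longrightarrow> d 1 0 (d 2 1 s) = d 1 0 (d 2 0 s)"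
      "\<And>s. s \<in> S 2 \<Longrightarrow> d 1 1 (d 2 0 s) = d 1 0 (d 2 2 s)"
      "\<And>s. s \<in> S 2 \<Longrightarrow> d 1 1 (d 2 1 s) = d 1 1 (d 2 2 s)"
begin

abbreviation Z :: "('s \<Rightarrow>\<^sub>0 'g::ab_group_add) set" where "Z \<equiv> carrier (cycles S d 1)"
abbreviation B :: "('s \<Rightarrow>\<^sub>0 'g::ab_group_add) set" where "B \<equiv> boundaries S d 1"

lemma Z_iff: "z \<in> Z \<longleftrightarrow> Poly_Mapping.keys z \<subseteq> S 1 \<and> boundary d 1 z = 0"
  by (simp add: cycles_def)

lemma B_eq: "B = boundary d 2 ` {c. Poly_Mapping.keys c \<subseteq> S 2}"
  by (simp add: boundaries_def numeral_2_eq_2)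

lemma Z_subgroup: "add_subgroup (Z :: ('s \<Rightarrow>\<^sub>0 'g::ab_group_add) set)"
  unfolding add_subgroup_def
proof (intro conjI ballI)
  show "0 \<in> Z" by (simp add: Z_iff boundary_1)
  fix x y :: "'s \<Rightarrow>\<^sub>0 'g" assume "x \<in> Z" "y \<in> Z"
  then show "x - y \<in> Z" unfolding Z_iff using keys_diff[of x y] by (auto simp: boundary_1_simps)
qed

lemma B_subgroup: "add_subgroup (B :: ('s \<Rightarrow>\<^sub>0 'g::ab_group_add) set)"
  unfolding add_subgroup_def
proof (intro conjI ballI)
  show "0 \<in> B" unfolding B_eq by (intro image_eqI[of _ _ 0]) (auto simp: boundary_2)
  fix x y :: "'s \<Rightarrow>\<^sub>0 'g" assume "x \<in> B" "y \<in> B"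
  then obtain u v where "x = boundary d 2 u" "Poly_Mapping.keys u \<subseteq> S 2" "y = boundary d 2 v"
    "Poly_Mapping.keys v \<subseteq> S 2"
    unfolding B_eq by blast
  then show "x - y \<in> B" unfolding B_eq using keys_diff[of u v]
    by (intro image_eqI[of _ _ "u - v"]) (auto simp: boundary_2_simps)
qed

lemma triangle_in_B:
  assumes "s \<in> S 2"
  shows "Poly_Mapping.single (d 2 0 s) g - Poly_Mapping.single (d 2 1 s) g
      + Poly_Mapping.single (d 2 2 s) g \<in> B"
  unfolding B_eq using assms
  by (intro image_eqI[of _ _ "Poly_Mapping.single s g"]) (auto simp: boundary_2_simps)

text \<open>Boundaries are sums of boundaries of single 2-simplices with a coefficient. Taking for
  \<open>A\<close> the preimage of a subgroup reduces a statement about chain maps to one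
  triangle.\<close>

lemma boundary_induct:
  assumes "c \<in> B" "add_subgroup A"
    "\<And>s g. s \<in> S 2 \<Longrightarrow> Poly_Mapping.single (d 2 0 s) g - Poly_Mapping.single (d 2 1 s) g
      + Poly_Mapping.single (d 2 2 s) g \<in> A"
  shows "c \<in> A"
proof -
  obtain u where u: "c = boundary d 2 u" "Poly_Mapping.keys u \<subseteq> S 2" using assms(1) unfolding B_eq
    by blast
  show ?thesis unfolding u(1) boundary_2 chain_ext_def
    by (rule add_subgroup_sum[OF assms(2)]) (use u(2) assms(3) in auto)
qed

lemma B_subset_Z: "B \<subseteq> (Z :: ('s \<Rightarrow>\<^sub>0 'g::ab_group_add) set)"
proof
  fix c :: "'s \<Rightarrow>\<^sub>0 'g" assume c: "c \<in> B"
  show "c \<in> Z"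
  proof (rule boundary_induct[OF c Z_subgroup])
    fix s :: 's and g :: 'g assume s: "s \<in> S 2"
    let ?c = "Poly_Mapping.single (d 2 0 s) g - Poly_Mapping.single (d 2 1 s) g
      + Poly_Mapping.single (d 2 2 s) g"
    have "Poly_Mapping.keys ?c \<subseteq> {d 2 0 s, d 2 1 s, d 2 2 s}"
      by (auto simp: in_keys_iff lookup_add lookup_minus lookup_single when_def split: if_splits)
    also have "\<dots> \<subseteq> S 1" using face[OF s] by simp
    finally show "?c \<in> Z"
      unfolding Z_iff using face_face[OF s] by (simp add: boundary_1_simps)
  qed
qed

abbreviation H :: "('s \<Rightarrow>\<^sub>0 'g::ab_group_add) set monoid" where "H \<equiv> homology S d 1"

lemma homology_class_residue: "homology_class S d 1 z = residue B z"
  by (auto simp: homology_class_def residue_def r_coset_def cycles_def)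

lemma homology_facts:
  shows "comm_group H" "carrier H = residue B ` Z" "\<one>\<^bsub>H\<^esub> = B"
    "\<And>z w. z \<in> Z \<Longrightarrow> w \<in> Z \<Longrightarrow> residue B z \<otimes>\<^bsub>H\<^esub> residue B w = residue B (z + w)"
proof -
  have C: "cycles S d 1 = \<lparr>carrier = Z, monoid.mult = (+), one = 0\<rparr>" by (simp add: cycles_def)
  note q = quotient_carrier_add[OF Z_subgroup B_subgroup B_subset_Z, folded C homology_def]
  show "comm_group H" by (rule q(1))
  show "carrier H = residue B ` Z" by (rule q(2))
  show "\<one>\<^bsub>H\<^esub> = B" by (rule q(3))
  show "residue B z \<otimes>\<^bsub>H\<^esub> residue B w = residue B (z + w)" if "z \<in> Z" "w \<in> Z" for z w
    by (rule q(4)[OF that])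
qed

lemma homology_inv:
  assumes "z \<in> Z" shows "inv\<^bsub>H\<^esub> (residue B z) = residue B (- z)"
proof -
  interpret comm_group H by (rule homology_facts)
  have "- z \<in> Z" using add_subgroupD(3)[OF Z_subgroup assms] .
  then show ?thesis
    using assms homology_facts(2,3) homology_facts(4)[of "- z" z] residue_zero[of B]
    by (intro inv_equality) auto
qed

end

section \<open>Singular and ordered simplices of low degree\<close>

type_synonym ('a, 'g) singular_chains = "((nat \<Rightarrow> real) \<Rightarrow> 'a) \<Rightarrow>\<^sub>0 'g"

text \<open>Time is the weight of the second vertex; accordingly face 0 of a 1-simplex is the end of
  its path and face 1 the start.\<close>

definition edge_point :: "real \<Rightarrow> nat \<Rightarrow> real" where
  "edge_point t = (\<lambda>i. if i = 0 then 1 - t else if i = 1 then t else 0)"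

definition triangle_point :: "real \<times> real \<Rightarrow> nat \<Rightarrow> real" where
  "triangle_point z
    = (\<lambda>i. if i = 0 then 1 - fst z - snd z else if i = 1 then fst z else
      if i = 2 then snd z else 0)"

definition path_simplex :: "(real \<Rightarrow> 'a) \<Rightarrow> (nat \<Rightarrow> real) \<Rightarrow> 'a" where
  "path_simplex p = (\<lambda>x\<in>standard_simplex 1. p (x 1))"

definition simplex_path :: "((nat \<Rightarrow> real) \<Rightarrow> 'a) \<Rightarrow> real \<Rightarrow> 'a" where
  "simplex_path \<sigma> t = \<sigma> (edge_point t)"

definition point_simplex :: "'a \<Rightarrow> (nat \<Rightarrow> real) \<Rightarrow> 'a" where
  "point_simplex x = (\<lambda>z\<in>standard_simplex 0. x)"

lemma standard_simplex_1:
  assumes "x \<in> standard_simplex 1"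
  shows "x = edge_point (x 1)" "x 1 \<in> {0..1}"
proof -
  have x: "\<And>i. 0 \<le> x i \<and> x i \<le> 1" "\<And>i. 1 < i \<Longrightarrow> x i = 0" "x 0 + x 1 = 1"
    using assms by (auto simp: standard_simplex_def One_nat_def)
  show "x 1 \<in> {0..1}" using x(1)[of 1] by simp
  show "x = edge_point (x 1)"
  proof
    fix i show "x i = edge_point (x 1) i"
      using x(2)[of i] x(3) by (cases "i = 0"; cases "i = 1") (auto simp: edge_point_def)
  qed
qed

lemma edge_point_in: "t \<in> {0..1} \<Longrightarrow> edge_point t \<in> standard_simplex 1"
  by (auto simp: standard_simplex_def edge_point_def One_nat_def)

lemma triangle_point_in:
  "0 \<le> fst z \<Longrightarrow> 0 \<le> snd z \<Longrightarrow> fst z + snd z \<le> 1 \<Longrightarrow> triangle_point z \<in> standard_simplex 2"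
  by (auto simp: standard_simplex_def triangle_point_def numeral_2_eq_2 One_nat_def)

lemma continuous_map_simplex_linear:
  "continuous_map (subtopology (powertop_real UNIV) (standard_simplex n)) euclideanreal (\<lambda>x. x i)"
  by (intro continuous_map_from_subtopology continuous_map_product_projection) simp

lemma singular_simplexI:
  assumes "continuous_map (top_of_set T) Y f"
      "continuous_map (subtopology (powertop_real UNIV) (standard_simplex n)) euclidean h"
    "\<And>x. x \<in> standard_simplex n \<Longrightarrow> h x \<in> T"
  shows "singular_simplex n Y (\<lambda>x\<in>standard_simplex n. f (h x))"
  unfolding singular_simplex_def
proof
  have "continuous_map (subtopology (powertop_real UNIV) (standard_simplex n)) (top_of_set T) h"
    using assms(2,3) by (auto simp: continuous_map_in_subtopology)
  from continuous_map_compose[OF this assms(1)]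
  show "continuous_map (subtopology (powertop_real UNIV) (standard_simplex n)) Y
    (\<lambda>x\<in>standard_simplex n. f (h x))"
    by (rule continuous_map_eq) auto
qed auto

lemma path_simplex_singular: "pathin Y p \<Longrightarrow> singular_simplex 1 Y (path_simplex p)"
  unfolding path_simplex_def pathin_def
  by (rule singular_simplexI[OF _ continuous_map_simplex_linear]) (use standard_simplex_1 in auto)

lemma pathin_simplex_path:
  assumes "singular_simplex 1 Y \<sigma>" shows "pathin Y (simplex_path \<sigma>)"
proof -
  have "continuous_map (top_of_set {0..1}) (subtopology (powertop_real UNIV) (standard_simplex 1))
    edge_point"
    unfolding continuous_map_in_subtopology continuous_map_componentwise_UNIV
  proof (intro conjI allI)
    show "continuous_map (top_of_set {0..1}) euclideanreal (\<lambda>t. edge_point t k)" for k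
      by (cases "k = 0"; cases "k = 1") (auto simp: edge_point_def intro!: continuous_intros)
  qed (use edge_point_in in auto)
  moreover have "continuous_map (subtopology (powertop_real UNIV) (standard_simplex 1)) Y \<sigma>"
    using assms by (simp add: singular_simplex_def)
  ultimately have "continuous_map (top_of_set {0..1}) Y (\<sigma> \<circ> edge_point)"
    by (rule continuous_map_compose)
  then show ?thesis by (simp add: pathin_def simplex_path_def[abs_def] o_def)
qed

lemma path_simplex_simplex_path:
  assumes "singular_simplex 1 Y \<sigma>" shows "path_simplex (simplex_path \<sigma>) = \<sigma>"
proof
  fix x
  show "path_simplex (simplex_path \<sigma>) x = \<sigma> x"
  proof (cases "x \<in> standard_simplex 1")
    case True
    then show ?thesis using standard_simplex_1(1)[OF True]
      by (simp add: path_simplex_def simplex_path_def)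
  next
    case False
    then show ?thesis using assms
      by (auto simp: path_simplex_def singular_simplex_def extensional_def)
  qed
qed

lemma simplex_path_path_simplex: "t \<in> {0..1} \<Longrightarrow> simplex_path (path_simplex p) t = p t"
  using edge_point_in[of t]
    by (simp add: simplex_path_def path_simplex_def) (simp add: edge_point_def)

lemma path_simplex_cong: "(\<And>t. t \<in> {0..1} \<Longrightarrow> p t = q t) \<Longrightarrow> path_simplex p = path_simplex q"
  unfolding path_simplex_def using standard_simplex_1(2) by (intro restrict_ext) blast

lemma singular_face_1:
  "singular_face 1 0 \<sigma> = point_simplex (simplex_path \<sigma> 1)"
  "singular_face 1 1 \<sigma> = point_simplex (simplex_path \<sigma> 0)"
proof -
  have "simplical_face 0 (\<lambda>j. if j = 0 then 1 else 0) = edge_point 1"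
    "simplical_face 1 (\<lambda>j. if j = 0 then 1 else 0) = edge_point 0"
    by (auto simp: simplical_face_def edge_point_def fun_eq_iff)
  then show "singular_face 1 0 \<sigma> = point_simplex (simplex_path \<sigma> 1)"
    "singular_face 1 1 \<sigma> = point_simplex (simplex_path \<sigma> 0)"
    by (auto simp: singular_face_def point_simplex_def simplex_path_def standard_simplex_0
      One_nat_def)
qed

lemma simplical_face_edge_point:
  "simplical_face 0 (edge_point t) = triangle_point (1 - t, t)"
  "simplical_face 1 (edge_point t) = triangle_point (0, t)"
  "simplical_face 2 (edge_point t) = triangle_point (t, 0)"
  by (auto simp: simplical_face_def edge_point_def triangle_point_def fun_eq_iff)

lemma simplex_path_singular_face:
  assumes "t \<in> {0..1}"
  shows "simplex_path (singular_face 2 0 \<tau>) t = \<tau> (triangle_point (1 - t, t))"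
    "simplex_path (singular_face 2 1 \<tau>) t = \<tau> (triangle_point (0, t))"
    "simplex_path (singular_face 2 2 \<tau>) t = \<tau> (triangle_point (t, 0))"
proof -
  have "simplex_path (singular_face 2 k \<tau>) t = \<tau> (simplical_face k (edge_point t))" for k
    using edge_point_in[OF assms] by (simp add: simplex_path_def singular_face_def One_nat_def)
  then show "simplex_path (singular_face 2 0 \<tau>) t = \<tau> (triangle_point (1 - t, t))"
    "simplex_path (singular_face 2 1 \<tau>) t = \<tau> (triangle_point (0, t))"
    "simplex_path (singular_face 2 2 \<tau>) t = \<tau> (triangle_point (t, 0))"
    by (simp_all add: simplical_face_edge_point)
qed

lemma singular_face_complex: "face_complex (\<lambda>n. singular_simplex_set n Y) singular_face"
proof
  fix s k assume "s \<in> singular_simplex_set 2 Y" "k \<le> (2::nat)"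
  then show "singular_face 2 k s \<in> singular_simplex_set 1 Y"
    using singular_simplex_singular_face[of 2 Y s k] by (simp add: One_nat_def)
qed (simp_all add: singular_face_1 simplex_path_singular_face)

text \<open>An affine map sends the vertices of the triangle to the times a, b, c, and
  \<open>f\<close> carries it to \<open>Y\<close>. Additivity, constants and reversal of paths are
  all read off from this family of 2-simplices.\<close>

lemma singular_triangle:
  assumes "pathin Y f" "a \<in> {0..1}" "b \<in> {0..1}" "c \<in> {0..1}"
  defines "\<tau> \<equiv> (\<lambda>x\<in>standard_simplex 2. f (x 0 * a + x 1 * b + x 2 * c))"
  shows "singular_simplex 2 Y \<tau>"
    "singular_face 2 0 \<tau> = path_simplex (restrict_path b c f)"
    "singular_face 2 1 \<tau> = path_simplex (restrict_path a c f)"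
    "singular_face 2 2 \<tau> = path_simplex (restrict_path a b f)"
proof -
  show s: "singular_simplex 2 Y \<tau>"
    unfolding \<tau>_def
  proof (rule singular_simplexI[OF assms(1)[unfolded pathin_def]])
    show "continuous_map (subtopology (powertop_real UNIV) (standard_simplex 2)) euclidean
      (\<lambda>x. x 0 * a + x 1 * b + x 2 * c)"
      by (intro continuous_map_add continuous_map_real_mult continuous_map_simplex_linear
        continuous_map_const[THEN iffD2]) auto
    fix x :: "nat \<Rightarrow> real" assume x: "x \<in> standard_simplex 2"
    then have x: "\<And>i. 0 \<le> x i" "x 0 + x 1 + x 2 = 1"
      by (auto simp: standard_simplex_def numeral_2_eq_2 One_nat_def)
    have "x 0 * a + x 1 * b + x 2 * c \<le> x 0 * 1 + x 1 * 1 + x 2 * 1"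
      using assms(2-4) x(1) by (intro add_mono mult_left_mono) auto
    moreover have "0 \<le> x 0 * a + x 1 * b + x 2 * c"
      using assms(2-4) x(1) by (intro add_nonneg_nonneg mult_nonneg_nonneg) auto
    ultimately show "x 0 * a + x 1 * b + x 2 * c \<in> {0..1}" using x(2) by simp
  qed
  have t: "\<tau> (triangle_point z) = f ((1 - fst z - snd z) * a + fst z * b + snd z * c)"
    if "0 \<le> fst z" "0 \<le> snd z" "fst z + snd z \<le> 1" for z
    using triangle_point_in[OF that] by (simp add: \<tau>_def) (simp add: triangle_point_def)
  have fs: "singular_face 2 k \<tau> = path_simplex (simplex_path (singular_face 2 k \<tau>))" if "k \<le> 2"
    for k
    using path_simplex_simplex_path[of Y "singular_face 2 k \<tau>"]
      singular_simplex_singular_face[OF s _ that]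
    by (simp add: One_nat_def)
  have "path_simplex (simplex_path (singular_face 2 0 \<tau>)) = path_simplex (restrict_path b c f)"
    by (rule path_simplex_cong)
      (simp add: simplex_path_singular_face t restrict_path_def linepath_def)
  then show "singular_face 2 0 \<tau> = path_simplex (restrict_path b c f)" using fs[of 0] by simp
  have "path_simplex (simplex_path (singular_face 2 1 \<tau>)) = path_simplex (restrict_path a c f)"
    by (rule path_simplex_cong)
      (simp add: simplex_path_singular_face t restrict_path_def linepath_def)
  then show "singular_face 2 1 \<tau> = path_simplex (restrict_path a c f)" using fs[of 1] by simp
  have "path_simplex (simplex_path (singular_face 2 2 \<tau>)) = path_simplex (restrict_path a b f)"
    by (rule path_simplex_cong)
      (simp add: simplex_path_singular_face t restrict_path_def linepath_def)
  then show "singular_face 2 2 \<tau> = path_simplex (restrict_path a b f)" using fs[of 2] by simp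
qed

section \<open>Chains of paths and the relations among them\<close>

abbreviation path_chain :: "(real \<Rightarrow> 'a) \<Rightarrow> 'g::ab_group_add \<Rightarrow> ('a, 'g) singular_chains" where
  "path_chain p g \<equiv> Poly_Mapping.single (path_simplex p) g"

abbreviation singular_boundaries :: "'a topology \<Rightarrow> ('a, 'g::ab_group_add) singular_chains set" where
  "singular_boundaries Y \<equiv> boundaries (\<lambda>n. singular_simplex_set n Y) singular_face 1"

abbreviation singular_cycles :: "'a topology \<Rightarrow> ('a, 'g::ab_group_add) singular_chains set" where
  "singular_cycles Y \<equiv> carrier (cycles (\<lambda>n. singular_simplex_set n Y) singular_face 1)"

lemma boundary_path_chain:
  "boundary singular_face 1 (path_chain p g) =
     Poly_Mapping.single (point_simplex (p 1)) g - Poly_Mapping.single (point_simplex (p 0))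
       (g :: 'g::ab_group_add)"
  by (simp add: boundary_1_simps singular_face_1 simplex_path_path_simplex)

lemma path_chain_restrict:
  fixes g :: "'g::ab_group_add"
  assumes "pathin Y f" "a \<in> {0..1}" "b \<in> {0..1}" "c \<in> {0..1}"
  shows "path_chain (restrict_path b c f) g - path_chain (restrict_path a c f) g
      + path_chain (restrict_path a b f) g
    \<in> singular_boundaries Y"
proof -
  let ?\<tau> = "\<lambda>x\<in>standard_simplex 2. f (x 0 * a + x 1 * b + x 2 * c)"
  have "?\<tau> \<in> singular_simplex_set 2 Y" using singular_triangle(1)[OF assms] by simp
  from face_complex.triangle_in_B[OF singular_face_complex this, of g]
  show ?thesis unfolding singular_triangle(2-4)[OF assms] .
qed

lemma path_chain_join:
  fixes g :: "'g::ab_group_add"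
  assumes "pathin Y p" "pathin Y q" "p 1 = q 0"
  shows "path_chain q g - path_chain (p +++ q) g + path_chain p g \<in> singular_boundaries Y"
proof -
  have "path_simplex (restrict_path 0 (1/2) (p +++ q)) = path_simplex p"
    by (rule path_simplex_cong) (simp add: restrict_path_def linepath_def joinpaths_def)
  moreover have "path_simplex (restrict_path (1/2) 1 (p +++ q)) = path_simplex q"
  proof (rule path_simplex_cong)
    fix t :: real assume t: "t \<in> {0..1}"
    have "linepath (1/2) 1 t = t / 2 + 1 / 2" by (simp add: linepath_def field_simps)
    then show "restrict_path (1/2) 1 (p +++ q) t = q t"
      using t assms(3) by (auto simp: restrict_path_def joinpaths_def)
  qed
  ultimately show ?thesis
    using path_chain_restrict[OF pathin_join[OF assms], of 0 "1/2" 1 g] by simp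
qed

text \<open>The three faces of a constant triangle are equal, and the alternating sum of three equal
  terms is one of them.\<close>

lemma path_chain_const:
  fixes g :: "'g::ab_group_add"
  assumes "y \<in> topspace Y" shows "path_chain (\<lambda>t. y) g \<in> singular_boundaries Y"
proof -
  have "restrict_path 0 0 (\<lambda>t. y) = (\<lambda>t. y)" by (simp add: restrict_path_def o_def)
  then show ?thesis using path_chain_restrict[of Y "\<lambda>t. y" 0 0 0 g] assms by simp
qed

text \<open>The triangle with times 0, 1, 0 has the path, its reverse and a constant path as
  faces.\<close>

lemma path_chain_reversepath:
  fixes g :: "'g::ab_group_add"
  assumes "pathin Y p" shows "path_chain (reversepath p) g + path_chain p g \<in> singular_boundaries Y"
proof -
  note B = face_complex.B_subgroup[OF singular_face_complex]
  have "restrict_path 1 0 p = reversepath p" "restrict_path 0 0 p = (\<lambda>t. p 0)"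
    by (auto simp: restrict_path_def reversepath_def linepath_def)
  then have "path_chain (reversepath p) g - path_chain (\<lambda>t. p 0) g + path_chain p g
    \<in> singular_boundaries Y"
    using path_chain_restrict[OF assms, of 0 1 0 g] by simp
  from add_subgroupD(4)[OF B this path_chain_const[OF pathin_ends(1)[OF assms], of g]]
  show ?thesis by simp
qed

text \<open>A plane triangle is convex, so two sides deform linearly into the third, and \<tau>
  carries this to \<open>Y\<close>. Through this homotopy the invariance of holonomy becomes a
  statement about boundaries.\<close>

lemma singular_face_homotopic:
  assumes "singular_simplex 2 Y \<tau>"
  shows "path_homotopic Y
      (simplex_path (singular_face 2 2 \<tau>) +++ simplex_path (singular_face 2 0 \<tau>))
    (simplex_path (singular_face 2 1 \<tau>))"
proof -
  define \<Delta> where "\<Delta> = {z::real\<times>real. 0 \<le> fst z \<and> 0 \<le> snd z \<and> fst z + snd z \<le> 1}"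
  have conv: "convex \<Delta>"
  proof -
    have "\<Delta> = {z. inner (-1, 0) z \<le> 0} \<inter> {z. inner (0, -1) z \<le> 0} \<inter> {z. inner (1, 1) z \<le> 1}"
      by (auto simp: \<Delta>_def inner_prod_def)
    then show ?thesis by (simp add: convex_halfspace_le convex_Int)
  qed
  let ?p = "linepath (0, 0) (1, 0) +++ linepath (1, 0) (0, 1) :: real \<Rightarrow> real \<times> real"
    and ?q = "linepath (0, 0) (0, 1) :: real \<Rightarrow> real \<times> real"
  have V: "(0, 0) \<in> \<Delta>" "(1, 0) \<in> \<Delta>" "(0, 1) \<in> \<Delta>" by (auto simp: \<Delta>_def)
  have im: "path_image ?p \<subseteq> \<Delta>" "path_image ?q \<subseteq> \<Delta>"
    using closed_segment_subset[OF V(1,2) conv] closed_segment_subset[OF V(2,3) conv]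
      closed_segment_subset[OF V(1,3) conv]
    by (simp_all add: path_image_join)
  have "homotopic_paths \<Delta> ?p ?q"
  proof (rule homotopic_paths_linear)
    fix t :: real assume "t \<in> {0..1}"
    then have "?p t \<in> \<Delta>" "?q t \<in> \<Delta>" using im unfolding path_image_def by blast+
    then show "closed_segment (?p t) (?q t) \<subseteq> \<Delta>" by (rule closed_segment_subset[OF _ _ conv])
  qed (simp_all add: path_join_eq)
  then have h: "path_homotopic (top_of_set \<Delta>) ?p ?q"
    by (simp add: path_homotopic_def homotopic_paths_def pathstart_def pathfinish_def)
  have "continuous_map (top_of_set \<Delta>) (subtopology (powertop_real UNIV) (standard_simplex 2))
    triangle_point"
    unfolding continuous_map_in_subtopology continuous_map_componentwise_UNIV
  proof (intro conjI allI)
    show "continuous_map (top_of_set \<Delta>) euclideanreal (\<lambda>z. triangle_point z k)" for k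
      by (cases "k = 0"; cases "k = 1"; cases "k = 2")
        (auto simp: triangle_point_def intro!: continuous_intros)
  qed (auto simp: \<Delta>_def intro: triangle_point_in)
  moreover have "continuous_map (subtopology (powertop_real UNIV) (standard_simplex 2)) Y \<tau>"
    using assms by (simp add: singular_simplex_def)
  ultimately have c: "continuous_map (top_of_set \<Delta>) Y (\<tau> \<circ> triangle_point)"
    by (rule continuous_map_compose)
  note H = path_homotopic_compose[OF h c]
  note D = path_homotopicD[OF H]
  have "path_homotopic Y ((\<tau> \<circ> triangle_point) \<circ> ?p)
    (simplex_path (singular_face 2 2 \<tau>) +++ simplex_path (singular_face 2 0 \<tau>))"
    by (rule path_homotopic_eq[OF D(1)])
      (auto simp: joinpaths_def simplex_path_singular_face linepath_def)
  moreover have "path_homotopic Y ((\<tau> \<circ> triangle_point) \<circ> ?q) (simplex_path (singular_face 2 1 \<tau>))"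
    by (rule path_homotopic_eq[OF D(2)]) (auto simp: simplex_path_singular_face linepath_def)
  ultimately show ?thesis using H path_homotopic_sym path_homotopic_trans by metis
qed

lemma ordered_face_complex:
  assumes "is_complex K" shows "face_complex (ordered_simplices K) ordered_face"
proof -
  have L: "\<exists>x y z. s = [x, y, z]" if "s \<in> ordered_simplices K 2" for s
  proof -
    have "length s = Suc (Suc (Suc 0))" using that by (simp add: ordered_simplices_def)
    then show ?thesis by (auto simp: length_Suc_conv)
  qed
  show ?thesis
  proof
    fix s k assume s: "s \<in> ordered_simplices K 2" and k: "k \<le> (2::nat)"
    then have sK: "set s \<in> K" "length s = 3" by (auto simp: ordered_simplices_def)
    have l: "length (ordered_face 2 k s) = 2" using sK k by (simp add: ordered_face_def)
    then have "set (ordered_face 2 k s) \<noteq> {}" by auto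
    moreover have "set (ordered_face 2 k s) \<subseteq> set s"
      by (auto simp: ordered_face_def dest: in_set_takeD in_set_dropD)
    ultimately have "set (ordered_face 2 k s) \<in> K" using is_complexD(3)[OF assms sK(1)] by simp
    then show "ordered_face 2 k s \<in> ordered_simplices K 1" using l
      by (simp add: ordered_simplices_def)
  next
    fix s assume "s \<in> ordered_simplices K 2"
    then obtain x y z where [simp]: "s = [x, y, z]" using L by blast
    show "ordered_face 1 0 (ordered_face 2 1 s) = ordered_face 1 0 (ordered_face 2 0 s)"
      "ordered_face 1 1 (ordered_face 2 0 s) = ordered_face 1 0 (ordered_face 2 2 s)"
      "ordered_face 1 1 (ordered_face 2 1 s) = ordered_face 1 1 (ordered_face 2 2 s)"
      by (simp_all add: ordered_face_def One_nat_def numeral_2_eq_2)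
  qed
qed

lemma ordered_face_simps:
  "ordered_face 1 0 [u, v] = [v]" "ordered_face 1 1 [u, v] = [u]"
  "ordered_face 2 0 [x, y, z] = [y, z]" "ordered_face 2 1 [x, y, z] = [x, z]"
    "ordered_face 2 2 [x, y, z] = [x, y]"
  by (simp_all add: ordered_face_def One_nat_def numeral_2_eq_2)

text \<open>The recursive form of the sum in \<open>simplicial_loop_H1\<close>, used also for lists
  that are not closed.\<close>

fun list_chain :: "'g::ab_group_add \<Rightarrow> 'a list \<Rightarrow> ('a list \<Rightarrow>\<^sub>0 'g)" where
  "list_chain g (u # v # vs) = Poly_Mapping.single [u, v] g + list_chain g (v # vs)"
| "list_chain g _ = 0"

lemma list_chain_sum: "(\<Sum>i<length L - 1. Poly_Mapping.single [L ! i, L ! Suc i] g) = list_chain g L"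
proof (induction L rule: induct_list012)
  case (3 u v vs)
  have "(\<Sum>i<length (u # v # vs) - 1. Poly_Mapping.single [(u # v # vs) ! i, (u # v # vs) ! Suc i] g)
    =
      (\<Sum>i<Suc (length (v # vs) - 1). Poly_Mapping.single [(u # v # vs) ! i, (u # v # vs) ! Suc i]
        g)"
    by (simp add: One_nat_def)
  also have "\<dots> = Poly_Mapping.single [u, v] g + list_chain g (v # vs)"
    unfolding sum.lessThan_Suc_shift using 3(2) by simp
  finally show ?case by simp
qed (auto simp: One_nat_def)

lemma list_chain_add: "list_chain (g + h) L = list_chain g L + list_chain h L"
  by (induction L rule: induct_list012) (auto simp: single_add algebra_simps)

lemma boundary_list_chain:
  "L \<noteq> [] \<Longrightarrow> boundary ordered_face 1 (list_chain g L) = Poly_Mapping.single [last L] g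
    - Poly_Mapping.single [hd L] g"
  by (induction L rule: induct_list012) (auto simp: boundary_1_simps ordered_face_simps)

lemma keys_list_chain:
  "successively (\<lambda>u v. {u, v} \<in> K) L \<Longrightarrow> Poly_Mapping.keys (list_chain g L) \<subseteq> ordered_simplices K 1"
proof (induction L rule: induct_list012)
  case (3 u v vs)
  have "Poly_Mapping.keys (list_chain g (u # v # vs)) \<subseteq> {[u, v]} \<union> Poly_Mapping.keys
    (list_chain g (v # vs))"
    using Poly_Mapping.keys_add[of "Poly_Mapping.single [u, v] g" "list_chain g (v # vs)"]
      by (auto split: if_splits)
  moreover have "[u, v] \<in> ordered_simplices K 1" using 3(3)
    by (simp add: ordered_simplices_def One_nat_def)
  ultimately show ?case using 3 by auto
qed auto

section \<open>First homology of the Rips complex\<close>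

lemma fine_sample_mono: "fine_sample p f ts \<Longrightarrow> p \<le> q \<Longrightarrow> fine_sample q f ts"
  by (induction ts rule: induct_list012)
    (auto simp: fine_sample_Cons fine_sample_def intro: order_less_le_trans)

lemma chain_ext_in_subgroup:
  assumes "add_subgroup A" "\<And>s g. s \<in> Poly_Mapping.keys c \<Longrightarrow> \<phi> s g \<in> A"
  shows "chain_ext \<phi> c \<in> A"
  unfolding chain_ext_def by (rule add_subgroup_sum[OF assms(1)]) (rule assms(2))

lemma keys_chain_ext:
  assumes "\<And>s g. s \<in> Poly_Mapping.keys c \<Longrightarrow> Poly_Mapping.keys (\<phi> s g :: 't \<Rightarrow>\<^sub>0 'h::ab_group_add) \<subseteq> A"
  shows "Poly_Mapping.keys (chain_ext \<phi> c) \<subseteq> A"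
proof -
  have "add_subgroup {c :: 't \<Rightarrow>\<^sub>0 'h. Poly_Mapping.keys c \<subseteq> A}"
    unfolding add_subgroup_def by (auto dest: subsetD[OF keys_diff])
  from chain_ext_in_subgroup[OF this, of c \<phi>] assms show ?thesis by simp
qed

definition base_point :: "((nat \<Rightarrow> real) \<Rightarrow> 'a) \<Rightarrow> 'a" where
  "base_point x = x (\<lambda>j. if j = 0 then 1 else 0)"

lemma base_point_simplex [simp]: "base_point (point_simplex x) = x"
  by (simp add: base_point_def point_simplex_def standard_simplex_0)

text \<open>The left-hand side is \<phi>, regarded as a family on 0-simplices, applied to the
  boundary of \<open>z\<close>.\<close>

lemma cycle_telescope:
  fixes z :: "('a, 'g::ab_group_add) singular_chains"
  assumes "boundary singular_face 1 z = 0" "additive_family \<phi>"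
  shows "chain_ext (\<lambda>\<sigma> g. \<phi> (simplex_path \<sigma> 1) g - \<phi> (simplex_path \<sigma> 0) g) z = 0"
proof -
  let ?\<psi> = "\<lambda>x. \<phi> (base_point x)"
  have a: "additive_family ?\<psi>" using assms(2) by (simp add: additive_family_def)
  have "0 = chain_ext ?\<psi> (boundary singular_face 1 z)" using assms(1) by simp
  also have "\<dots> = chain_ext (\<lambda>\<sigma> g. \<phi> (simplex_path \<sigma> 1) g - \<phi> (simplex_path \<sigma> 0) g) z"
    unfolding boundary_1 chain_ext_comp[OF a]
    by (simp add: chain_ext_diff[OF a] chain_ext_single[OF a] singular_face_1)
  finally show ?thesis by simp
qed

definition sample_times :: "real \<Rightarrow> (real \<Rightarrow> 'a::metric_space) \<Rightarrow> real list" where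
  "sample_times r f = (SOME ts. fine_sample r f ts \<and> ts \<noteq> [] \<and> hd ts = 0 \<and> last ts = 1)"

lemma sample_times:
  assumes "path f" "r > 0"
  shows "fine_sample r f (sample_times r f)" "sample_times r f \<noteq> []" "hd (sample_times r f) = 0"
      "last (sample_times r f) = 1"
proof -
  have "\<exists>ts. fine_sample r f ts \<and> ts \<noteq> [] \<and> hd ts = 0 \<and> last ts = 1"
    using fine_exists[OF assms] by metis
  from someI_ex[OF this] show "fine_sample r f (sample_times r f)" "sample_times r f \<noteq> []"
    "hd (sample_times r f) = 0" "last (sample_times r f) = 1"
    unfolding sample_times_def by auto
qed

definition sample_chain ::
    "real \<Rightarrow> ((nat \<Rightarrow> real) \<Rightarrow> 'a::metric_space) \<Rightarrow> 'g::ab_group_add \<Rightarrow> ('a list \<Rightarrow>\<^sub>0 'g)" where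
  "sample_chain r \<sigma> g = list_chain g (map (simplex_path \<sigma>) (sample_times r (simplex_path \<sigma>)))"

definition geodesic_chain ::
    "'a::metric_space set \<Rightarrow> 'a list \<Rightarrow> 'g::ab_group_add \<Rightarrow> ('a, 'g) singular_chains" where
  "geodesic_chain X s g = path_chain (geodesic X (s ! 0) (s ! 1)) g"

lemma additive_sample_chain: "additive_family (sample_chain r)"
  by (simp add: additive_family_def sample_chain_def list_chain_add)

lemma additive_geodesic_chain: "additive_family (geodesic_chain X)"
  by (simp add: additive_family_def geodesic_chain_def single_add)

lemma additive_path_chain: "additive_family (\<lambda>s. path_chain (p s))"
  by (simp add: additive_family_def single_add)

abbreviation rips_boundaries :: "'a::metric_space set \<Rightarrow> real \<Rightarrow> ('a list \<Rightarrow>\<^sub>0 'g::ab_group_add) set"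
  where
  "rips_boundaries X r \<equiv> boundaries (ordered_simplices (rips X r)) ordered_face 1"

abbreviation rips_cycles :: "'a::metric_space set \<Rightarrow> real \<Rightarrow> ('a list \<Rightarrow>\<^sub>0 'g::ab_group_add) set" where
  "rips_cycles X r \<equiv> carrier (cycles (ordered_simplices (rips X r)) ordered_face 1)"

definition chain_cocycle ::
    "'a::metric_space set \<Rightarrow> real \<Rightarrow> 'g::ab_group_add \<Rightarrow> 'a \<Rightarrow> 'a \<Rightarrow> ('a list \<Rightarrow>\<^sub>0 'g) set" where
  "chain_cocycle X r g x y = residue (rips_boundaries X r) (Poly_Mapping.single [x, y] g)"

section \<open>The maps on first homology\<close>

context based_geodesic_space
begin

lemma face_complex_space: "face_complex (\<lambda>n. singular_simplex_set n (top_of_set X)) singular_face"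
  by (rule singular_face_complex)

lemma face_complex_rips: "face_complex (ordered_simplices (rips X r)) ordered_face"
  by (rule ordered_face_complex[OF is_complex_rips])

interpretation SX: face_complex "\<lambda>n. singular_simplex_set n (top_of_set X)" singular_face
  by (rule face_complex_space)

interpretation SR: face_complex "ordered_simplices (rips X r)" ordered_face for r
  by (rule face_complex_rips)

abbreviation Q :: "real \<Rightarrow> ('a list \<Rightarrow>\<^sub>0 'g::ab_group_add) set monoid" where
  "Q r \<equiv> residue_group (rips_boundaries X r)"

lemma comm_group_Q: "comm_group (Q r)"
  by (rule residue_group(1)[OF SR.B_subgroup])

lemma group_Q: "group (Q r)"
  by (rule comm_group.axioms(2)[OF comm_group_Q])

lemma chain_cocycle:
  fixes g :: "'g::ab_group_add"
  assumes "r > 0" shows "rips_cocycle (Q r) X r (chain_cocycle X r g)"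
  unfolding rips_cocycle_def
proof (intro ballI impI conjI)
  fix x y z assume *: "x \<in> X" "y \<in> X" "z \<in> X" "dist x y < r" "dist y z < r" "dist x z < r"
  show "chain_cocycle X r g x y \<in> carrier (Q r)"
    by (simp add: chain_cocycle_def residue_group(2)[OF SR.B_subgroup])
  have "[x, y, z] \<in> ordered_simplices (rips X r) 2"
    using * rips_triangle[OF assms, of x y z X] by (simp add: ordered_simplices_def)
  from SR.triangle_in_B[OF this, of g]
  have "Poly_Mapping.single [x, y] g + Poly_Mapping.single [y, z] g - Poly_Mapping.single [x, z] g
    \<in> rips_boundaries X r"
    unfolding ordered_face_simps by (simp add: algebra_simps)
  then show "chain_cocycle X r g x y \<otimes>\<^bsub>Q r\<^esub> chain_cocycle X r g y z = chain_cocycle X r g x z"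
    by (simp add: chain_cocycle_def residue_group(4)[OF SR.B_subgroup]
      residue_eq_iff[OF SR.B_subgroup])
qed

lemma edge_prod_chain_cocycle:
  "edge_prod (Q r) (chain_cocycle X r g) L = residue (rips_boundaries X r) (list_chain g L)"
  by (induction L rule: induct_list012)
    (auto simp: chain_cocycle_def residue_group(3,4)[OF SR.B_subgroup] residue_zero)

lemma holonomy_list_chain:
  assumes "r > 0" "pathin (top_of_set X) f" "fine_sample r f ts" "ts \<noteq> []" "hd ts = 0" "last ts = 1"
  shows "residue (rips_boundaries X r) (list_chain g (map f ts))
      = holonomy (Q r) (chain_cocycle X r g) f"
  using holonomy_fine[OF group_Q chain_cocycle[OF assms(1)] assms] edge_prod_chain_cocycle by metis

lemma sample_chain_holonomy:
  assumes "0 < p" "p \<le> r" "\<sigma> \<in> sing X 1"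
  shows "residue (rips_boundaries X r) (sample_chain p \<sigma> g)
      = holonomy (Q r) (chain_cocycle X r g) (simplex_path \<sigma>)"
proof -
  have f: "pathin (top_of_set X) (simplex_path \<sigma>)" using assms(3) pathin_simplex_path by blast
  note s = sample_times[OF path_pathin_canon(1)[OF f] assms(1)]
  have r: "r > 0" using assms by linarith
  show ?thesis unfolding sample_chain_def
    by (rule holonomy_list_chain[OF r f fine_sample_mono[OF s(1) assms(2)] s(2-4)])
qed

abbreviation F :: "real \<Rightarrow> ('a, 'g::ab_group_add) singular_chains \<Rightarrow> ('a list \<Rightarrow>\<^sub>0 'g)" where
  "F r \<equiv> chain_ext (sample_chain r)"

lemma sample_chain_facts:
  fixes g :: "'g::ab_group_add"
  assumes "r > 0" "\<sigma> \<in> sing X 1"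
  shows "Poly_Mapping.keys (sample_chain r \<sigma> g) \<subseteq> ordered_simplices (rips X r) 1"
    "boundary ordered_face 1 (sample_chain r \<sigma> g) = Poly_Mapping.single [simplex_path \<sigma> 1] g
      - Poly_Mapping.single [simplex_path \<sigma> 0] g"
proof -
  let ?f = "simplex_path \<sigma>" and ?ts = "sample_times r (simplex_path \<sigma>)"
  have f: "pathin (top_of_set X) ?f" using assms(2) pathin_simplex_path by blast
  note s = sample_times[OF path_pathin_canon(1)[OF f] assms(1)]
  have "set (map ?f ?ts) \<subseteq> X"
    using s(1) path_pathin_canon(2)[OF f] by (auto simp: fine_sample_def)
  then have "successively (\<lambda>u v. {u, v} \<in> rips X r) (map ?f ?ts)"
    using successively_rips[OF assms(1)] fine_successively[OF s(1)] by blast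
  then show "Poly_Mapping.keys (sample_chain r \<sigma> g) \<subseteq> ordered_simplices (rips X r) 1"
    unfolding sample_chain_def by (rule keys_list_chain)
  show "boundary ordered_face 1 (sample_chain r \<sigma> g) = Poly_Mapping.single [simplex_path \<sigma> 1] g
    - Poly_Mapping.single [simplex_path \<sigma> 0] g"
    unfolding sample_chain_def using boundary_list_chain[of "map ?f ?ts" g] s
      by (simp add: hd_map last_map)
qed

lemma F_cycle:
  fixes z :: "('a, 'g::ab_group_add) singular_chains"
  assumes "r > 0" "z \<in> singular_cycles (top_of_set X)"
  shows "F r z \<in> rips_cycles X r"
proof -
  have z: "Poly_Mapping.keys z \<subseteq> sing X 1" "boundary singular_face 1 z = 0" using assms(2)
    by (auto simp: SX.Z_iff)
  have "boundary ordered_face 1 (F r z)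
    = chain_ext (\<lambda>\<sigma> g. boundary ordered_face 1 (sample_chain r \<sigma> g)) z"
    by (simp add: chain_ext_def boundary_1_simps)
  also have "\<dots>
    = chain_ext
      (\<lambda>\<sigma> g. Poly_Mapping.single [simplex_path \<sigma> 1] g - Poly_Mapping.single [simplex_path \<sigma> 0] g) z"
    using sample_chain_facts(2)[OF assms(1)] z(1) by (intro chain_ext_cong) blast
  also have "\<dots> = 0"
    by (rule cycle_telescope[OF z(2), of "\<lambda>x. Poly_Mapping.single [x]"])
      (simp add: additive_family_def single_add)
  finally have "boundary ordered_face 1 (F r z) = 0" .
  moreover have "Poly_Mapping.keys (F r z) \<subseteq> ordered_simplices (rips X r) 1"
    by (rule keys_chain_ext) (use sample_chain_facts(1)[OF assms(1)] z(1) in blast)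
  ultimately show ?thesis by (simp add: SR.Z_iff)
qed

text \<open>Modulo boundaries the sample chain of a face is a holonomy. Homotopy invariance on a
  singular triangle then gives the relation between its three faces, although their samples are
  chosen independently.\<close>

lemma F_boundary:
  fixes c :: "('a, 'g::ab_group_add) singular_chains"
  assumes r: "r > 0" and c: "c \<in> singular_boundaries (top_of_set X)"
  shows "F r c \<in> rips_boundaries X r"
proof -
  let ?B = "rips_boundaries X r :: ('a list \<Rightarrow>\<^sub>0 'g) set"
  have "add_subgroup {c. F r c \<in> ?B}"
    unfolding add_subgroup_def
    using add_subgroupD(1,2)[OF SR.B_subgroup[of r]]
      by (auto simp: chain_ext_diff[OF additive_sample_chain])
  from SX.boundary_induct[OF c this]
  have "c \<in> {c. F r c \<in> ?B}"
  proof this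
    fix \<tau> and g :: 'g assume t: "\<tau> \<in> sing X 2"
    let ?f = "\<lambda>k. singular_face 2 k \<tau>"
    let ?S = "\<lambda>k. sample_chain r (?f k) g"
      and ?h = "\<lambda>k. holonomy (Q r) (chain_cocycle X r g) (simplex_path (?f k))"
    have f: "?f k \<in> sing X 1" if "k \<le> 2" for k using SX.face[OF t that] .
    have p: "pathin (top_of_set X) (simplex_path (?f k))" if "k \<le> 2" for k
      using f[OF that] pathin_simplex_path by blast
    have S: "residue ?B (?S k) = ?h k" if "k \<le> 2" for k
      by (rule sample_chain_holonomy[OF r order_refl f[OF that]])
    note lc = local_cocycle_rips[OF chain_cocycle[OF r] r]
    have "simplex_path (?f 2) 1 = simplex_path (?f 0) 0" by (simp add: simplex_path_singular_face)
    then have "?h 1 = ?h 2 \<otimes>\<^bsub>Q r\<^esub> ?h 0"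
      using holonomy_homotopic[OF group_Q lc singular_face_homotopic[of "top_of_set X" \<tau>]] t
        holonomy_join[OF group_Q lc p[of 2] p[of 0]] by auto
    then have "residue ?B (?S 1) = residue ?B (?S 2 + ?S 0)"
      using S[of 0] S[of 1] S[of 2] by (simp add: residue_group(4)[OF SR.B_subgroup, symmetric])
    then have "?S 1 - (?S 2 + ?S 0) \<in> ?B" by (simp add: residue_eq_iff[OF SR.B_subgroup])
    from add_subgroupD(3)[OF SR.B_subgroup this]
    show "Poly_Mapping.single (?f 0) g - Poly_Mapping.single (?f 1) g + Poly_Mapping.single (?f 2) g
      \<in> {c. F r c \<in> ?B}"
      by (simp add: chain_ext_add[OF additive_sample_chain] chain_ext_diff[OF additive_sample_chain]
          chain_ext_single[OF additive_sample_chain] algebra_simps)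
  qed
  then show ?thesis by simp
qed

lemma F_path:
  fixes g :: "'g::ab_group_add"
  assumes r: "r > 0" and f: "pathin (top_of_set X) f"
  shows "residue (rips_boundaries X r) (F r (path_chain f g))
      = holonomy (Q r) (chain_cocycle X r g) f"
proof -
  have s: "path_simplex f \<in> sing X 1" using path_simplex_singular[OF f] by simp
  have "path_homotopic (top_of_set X) f (simplex_path (path_simplex f))"
    by (rule path_homotopic_eq[OF f]) (simp add: simplex_path_path_simplex)
  from holonomy_homotopic[OF group_Q local_cocycle_rips[OF chain_cocycle[OF r] r] this, of g]
  show ?thesis
    using sample_chain_holonomy[OF r order_refl s, of g]
    by (simp add: chain_ext_single[OF additive_sample_chain])
qed

text \<open>The conjugation in \<open>r_sample_holonomy\<close> disappears because chains commute;
  so a sample may start at any time.\<close>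

lemma F_loop:
  fixes g :: "'g::ab_group_add"
  assumes r: "r > 0" and f: "pathin (top_of_set X) f" "f 0 = f 1" "r_sample r f ts"
  shows "residue (rips_boundaries X r) (F r (path_chain f g))
      = residue (rips_boundaries X r) (list_chain g (sample_loop f ts))"
proof -
  interpret Qr: comm_group "Q r :: ('a list \<Rightarrow>\<^sub>0 'g) set monoid" by (rule comm_group_Q)
  let ?e = "chain_cocycle X r g"
  note H = r_sample_holonomy[OF group_Q chain_cocycle[OF r, of g] r f(1,2,3)]
  have h: "holonomy (Q r) ?e f \<in> carrier (Q r)"
    using holonomy_closed[OF group_Q local_cocycle_rips[OF chain_cocycle[OF r] r] f(1)] .
  have "residue (rips_boundaries X r) (list_chain g (sample_loop f ts))
    = edge_prod (Q r) ?e (sample_loop f ts)"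
    by (simp add: edge_prod_chain_cocycle)
  also have "\<dots> = holonomy (Q r) ?e f"
    unfolding H(2) using H(1) h by (simp add: Qr.m_comm[of _ "holonomy (Q r) ?e f"] Qr.m_assoc)
  finally show ?thesis using F_path[OF r f(1), of g] by simp
qed

lemma path_chain_cycle:
  assumes "pathin (top_of_set X) f" "f 0 = f 1"
  shows "path_chain f g \<in> singular_cycles (top_of_set X)"
  using path_simplex_singular[OF assms(1)] assms(2) by (auto simp: SX.Z_iff boundary_path_chain)

lemma loop_H1_residue:
    "loop_H1 X g f = residue (singular_boundaries (top_of_set X)) (path_chain f g)"
  by (simp add: loop_H1_def SX.homology_class_residue path_simplex_def)

text \<open>The ends of the simplices are joined to the base point; the added tails cancel because the
  chain is a cycle.\<close>

lemma cycle_loops: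
  fixes z :: "('a, 'g::ab_group_add) singular_chains"
  assumes z: "z \<in> singular_cycles (top_of_set X)"
  defines
    "L \<equiv> \<lambda>\<sigma>. tail (simplex_path \<sigma> 0) +++ (simplex_path \<sigma> +++ reversepath (tail (simplex_path \<sigma> 1)))"
  shows "residue (singular_boundaries (top_of_set X)) z =
      residue (singular_boundaries (top_of_set X))
        (\<Sum>\<sigma>\<in>Poly_Mapping.keys z. path_chain (L \<sigma>) (Poly_Mapping.lookup z \<sigma>))"
    "\<sigma> \<in> Poly_Mapping.keys z \<Longrightarrow> L \<sigma> \<in> based_loops (top_of_set X) b"
proof -
  let ?B = "singular_boundaries (top_of_set X) :: ('a, 'g) singular_chains set"
  note D = add_subgroupD[OF SX.B_subgroup]
  have z': "Poly_Mapping.keys z \<subseteq> sing X 1" "boundary singular_face 1 z = 0" using z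
    by (auto simp: SX.Z_iff)
  show "L \<sigma> \<in> based_loops (top_of_set X) b" if "\<sigma> \<in> Poly_Mapping.keys z" for \<sigma>
  proof -
    have f: "pathin (top_of_set X) (simplex_path \<sigma>)" using that z'(1) pathin_simplex_path by blast
    show ?thesis unfolding L_def by (rule tail_loop[OF tail_system f])
  qed
  \<comment> \<open>For each simplex this is a boundary: the relations 1 to 3 below, for two joins
    and a reversal, combine to it.\<close>
  let ?\<phi> = "\<lambda>\<sigma> g. path_chain (L \<sigma>) g - Poly_Mapping.single \<sigma> g +
      (path_chain (tail (simplex_path \<sigma> 1)) g - path_chain (tail (simplex_path \<sigma> 0)) (g :: 'g))"
  have "?\<phi> \<sigma> g \<in> ?B" if s: "\<sigma> \<in> Poly_Mapping.keys z" for \<sigma> g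
  proof -
    let ?f = "simplex_path \<sigma>"
    have s1: "singular_simplex 1 (top_of_set X) \<sigma>" using s z'(1) by blast
    have f: "pathin (top_of_set X) ?f" using pathin_simplex_path[OF s1] .
    have X: "?f 0 \<in> X" "?f 1 \<in> X" using path_pathin_canon(2)[OF f] by auto
    let ?a = "tail (?f 0)" and ?c = "tail (?f 1)"
    note a = tail_facts[OF X(1)] and c = tail_facts[OF X(2)]
    have fc: "pathin (top_of_set X) (?f +++ reversepath ?c)" using f c
      by (auto intro!: pathin_join pathin_reversepath)
    have 1: "path_chain (?f +++ reversepath ?c) g - path_chain (L \<sigma>) g + path_chain ?a g \<in> ?B"
      unfolding L_def using path_chain_join[OF a(1) fc, of g] a by simp
    have 2: "path_chain (reversepath ?c) g - path_chain (?f +++ reversepath ?c) g + path_chain ?f g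
      \<in> ?B"
      using path_chain_join[OF f pathin_reversepath[OF c(1)], of g] c by simp
    have 3: "path_chain (reversepath ?c) g + path_chain ?c g \<in> ?B"
      by (rule path_chain_reversepath[OF c(1)])
    have "?\<phi> \<sigma> g = (path_chain (reversepath ?c) g + path_chain ?c g)
       - (path_chain (?f +++ reversepath ?c) g - path_chain (L \<sigma>) g + path_chain ?a g)
       - (path_chain (reversepath ?c) g - path_chain (?f +++ reversepath ?c) g + path_chain ?f g)"
      using path_simplex_simplex_path[OF s1] by (simp add: algebra_simps)
    then show ?thesis using D(2)[OF D(2)[OF 3 1] 2] by (simp only:)
  qed
  then have "chain_ext ?\<phi> z \<in> ?B" by (rule chain_ext_in_subgroup[OF SX.B_subgroup])
  moreover have "chain_ext ?\<phi> z = chain_ext (\<lambda>\<sigma> g. path_chain (L \<sigma>) g - Poly_Mapping.single \<sigma> g) z +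
      chain_ext
        (\<lambda>\<sigma> g. path_chain (tail (simplex_path \<sigma> 1)) g - path_chain (tail (simplex_path \<sigma> 0)) g) z"
    by (simp add: chain_ext_def sum.distrib)
  moreover have "chain_ext
    (\<lambda>\<sigma> g. path_chain (tail (simplex_path \<sigma> 1)) g - path_chain (tail (simplex_path \<sigma> 0)) g) z = 0"
    by (rule cycle_telescope[OF z'(2) additive_path_chain])
  ultimately have "chain_ext (\<lambda>\<sigma>. path_chain (L \<sigma>)) z - z \<in> ?B"
    by (simp add: chain_ext_diff_family chain_ext_id)
  from D(3)[OF this] have "z - chain_ext (\<lambda>\<sigma>. path_chain (L \<sigma>)) z \<in> ?B" by simp
  then show "residue ?B z
    = residue ?B (\<Sum>\<sigma>\<in>Poly_Mapping.keys z. path_chain (L \<sigma>) (Poly_Mapping.lookup z \<sigma>))"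
    by (simp add: residue_eq_iff[OF SX.B_subgroup] chain_ext_def)
qed

text \<open>By \<open>cycle_loops\<close> every class is a sum of classes of based loops with
  coefficients. This is the uniqueness behind the definite description in
  \<open>rho_H1\<close>.\<close>

lemma hom_H1_unique:
  fixes h h' :: "('a, 'g::ab_group_add) singular_chains set \<Rightarrow> 'h"
  assumes "group G" "h \<in> hom (H1_space X) G" "h' \<in> hom (H1_space X) G"
    "\<And>g f. f \<in> based_loops (top_of_set X) b \<Longrightarrow> h (loop_H1 X g f) = h' (loop_H1 X g f)"
      "c \<in> carrier (H1_space X)"
  shows "h c = h' c"
proof -
  let ?B = "singular_boundaries (top_of_set X) :: ('a, 'g) singular_chains set"
  let ?Z = "singular_cycles (top_of_set X) :: ('a, 'g) singular_chains set"
  interpret H: comm_group "H1_space X :: ('a, 'g) singular_chains set monoid"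
    by (rule SX.homology_facts)
  obtain z where z: "z \<in> ?Z" "c = residue ?B z" using assms(5) unfolding SX.homology_facts(2)
    by blast
  have L: "path_chain f g \<in> ?Z" if "f \<in> based_loops (top_of_set X) b" for f g
    using that by (intro path_chain_cycle) (auto simp: based_loops_def)
  have sum: "(\<Sum>\<sigma>\<in>A. path_chain (l \<sigma>) (w \<sigma>)) \<in> ?Z \<and>
      h (residue ?B (\<Sum>\<sigma>\<in>A. path_chain (l \<sigma>) (w \<sigma>))) = h'
        (residue ?B (\<Sum>\<sigma>\<in>A. path_chain (l \<sigma>) (w \<sigma>)))"
    if "finite A" "\<And>\<sigma>. \<sigma> \<in> A \<Longrightarrow> l \<sigma> \<in> based_loops (top_of_set X) b" for A
      and l :: "((nat \<Rightarrow> real) \<Rightarrow> 'a) \<Rightarrow> real \<Rightarrow> 'a" and w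
    using that
  proof (induction A rule: finite_induct)
    case empty
    have "residue ?B 0 = \<one>\<^bsub>H1_space X\<^esub>" using SX.homology_facts(3) residue_zero by metis
    then show ?case
      using hom_one[OF assms(2) H.group_axioms assms(1)]
        hom_one[OF assms(3) H.group_axioms assms(1)]
        add_subgroupD(1)[OF SX.Z_subgroup] by simp
  next
    case (insert \<sigma> A)
    let ?u = "path_chain (l \<sigma>) (w \<sigma>)" and ?v = "\<Sum>\<sigma>\<in>A. path_chain (l \<sigma>) (w \<sigma>)"
    have u: "?u \<in> ?Z" using L insert by simp
    have v: "?v \<in> ?Z" "h (residue ?B ?v) = h' (residue ?B ?v)" using insert by auto
    have uv: "?u + ?v \<in> ?Z" using add_subgroupD(4)[OF SX.Z_subgroup u v(1)] .
    have car: "residue ?B ?u \<in> carrier (H1_space X)" "residue ?B ?v \<in> carrier (H1_space X)"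
      using u v unfolding SX.homology_facts(2) by blast+
    have "h (residue ?B ?u) = h' (residue ?B ?u)" using assms(4)[of "l \<sigma>" "w \<sigma>"] insert
      by (simp add: loop_H1_residue)
    then have "h (residue ?B (?u + ?v)) = h' (residue ?B (?u + ?v))"
      using hom_mult[OF assms(2) car] hom_mult[OF assms(3) car] v(2) SX.homology_facts(4)[OF u v(1)]
        by simp
    then show ?case using uv insert(1,2) by simp
  qed
  show ?thesis
    unfolding z(2) cycle_loops(1)[OF z(1)]
    by (rule conjunct2[OF sum]) (use cycle_loops(2)[OF z(1)] in auto)
qed

text \<open>The union is over equal residue classes when \<open>C\<close> is a homology class; the
  restriction matches the extensionality asked for in \<open>rho_H1\<close>.\<close>

definition rho_coset :: "real \<Rightarrow> ('a, 'g::ab_group_add) singular_chains set \<Rightarrow> ('a list \<Rightarrow>\<^sub>0 'g) set"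
    where
  "rho_coset r = (\<lambda>C\<in>carrier (H1_space X). \<Union>z\<in>C. residue (rips_boundaries X r) (F r z))"

lemma rho_coset_extensional: "rho_coset r \<in> extensional (carrier (H1_space X))"
  by (simp add: rho_coset_def)

lemma rho_coset_residue:
  fixes z :: "('a, 'g::ab_group_add) singular_chains"
  assumes r: "r > 0" and z: "z \<in> singular_cycles (top_of_set X)"
  shows "rho_coset r (residue (singular_boundaries (top_of_set X)) z)
      = residue (rips_boundaries X r) (F r z)"
proof -
  let ?B = "singular_boundaries (top_of_set X) :: ('a, 'g) singular_chains set"
  let ?c = "residue (rips_boundaries X r) (F r z)"
  have eq: "residue (rips_boundaries X r) (F r w) = ?c" if w: "w \<in> residue ?B z" for w
  proof -
    have "w - z \<in> ?B" using w by (auto simp: residue_def)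
    from F_boundary[OF r this] show ?thesis
      by (simp add: residue_eq_iff[OF SR.B_subgroup] chain_ext_diff[OF additive_sample_chain])
  qed
  have ne: "residue ?B z \<noteq> {}"
  proof -
    have "0 \<in> ?B" by (rule add_subgroupD(1)[OF SX.B_subgroup])
    then show ?thesis unfolding residue_def by blast
  qed
  have "(\<Union>w\<in>residue ?B z. residue (rips_boundaries X r) (F r w)) = (\<Union>w\<in>residue ?B z. ?c)"
    by (rule SUP_cong[OF refl]) (rule eq)
  also have "\<dots> = ?c" using ne by simp
  finally have U: "(\<Union>w\<in>residue ?B z. residue (rips_boundaries X r) (F r w)) = ?c" .
  have "residue ?B z \<in> carrier (H1_space X)" using z unfolding SX.homology_facts(2) by blast
  with U show ?thesis unfolding rho_coset_def by (simp only: restrict_apply if_True)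
qed

lemma rho_coset_hom:
  assumes r: "r > 0"
  shows "(rho_coset r :: ('a, 'g::ab_group_add) singular_chains set \<Rightarrow> _)
      \<in> hom (H1_space X) (H1_rips X r)"
proof (rule homI)
  let ?B = "singular_boundaries (top_of_set X) :: ('a, 'g) singular_chains set"
  let ?Z = "singular_cycles (top_of_set X) :: ('a, 'g) singular_chains set"
  fix C :: "('a, 'g) singular_chains set" assume "C \<in> carrier (H1_space X)"
  then obtain z where z: "z \<in> ?Z" "C = residue ?B z" unfolding SX.homology_facts(2) by blast
  show "rho_coset r C \<in> carrier (H1_rips X r)"
    unfolding z(2) rho_coset_residue[OF r z(1)] SR.homology_facts(2) using F_cycle[OF r z(1)]
      by blast
  fix D :: "('a, 'g) singular_chains set" assume "D \<in> carrier (H1_space X)"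
  then obtain w where w: "w \<in> ?Z" "D = residue ?B w" unfolding SX.homology_facts(2) by blast
  have zw: "z + w \<in> ?Z" by (rule add_subgroupD(4)[OF SX.Z_subgroup z(1) w(1)])
  show "rho_coset r (C \<otimes>\<^bsub>H1_space X\<^esub> D) = rho_coset r C \<otimes>\<^bsub>H1_rips X r\<^esub> rho_coset r D"
    unfolding z(2) w(2) SX.homology_facts(4)[OF z(1) w(1)] rho_coset_residue[OF r z(1)]
      rho_coset_residue[OF r w(1)]
      rho_coset_residue[OF r zw] SR.homology_facts(4)[OF F_cycle[OF r z(1)] F_cycle[OF r w(1)]]
    by (simp add: chain_ext_add[OF additive_sample_chain])
qed

lemma rho_coset_loop:
  assumes r: "r > 0" and f: "path f" "path_image f \<subseteq> X" "pathfinish f = pathstart f"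
      "r_sample r f ts"
  shows "rho_coset r (loop_H1 X g f) = simplicial_loop_H1 (rips X r) g (sample_loop f ts)"
proof -
  have p: "pathin (top_of_set X) f" "f 0 = f 1"
    using f by (auto simp: pathin_canon_iff path_image_def pathstart_def pathfinish_def)
  show ?thesis
    unfolding loop_H1_residue rho_coset_residue[OF r path_chain_cycle[OF p]] F_loop[OF r p f(4)]
      simplicial_loop_H1_def SR.homology_class_residue list_chain_sum ..
qed

lemma rho_H1_eq:
  assumes r: "r > 0"
  shows "(rho_H1 X r :: ('a, 'g::ab_group_add) singular_chains set \<Rightarrow> _) = rho_coset r"
  unfolding rho_H1_def
proof (rule the_equality)
  show "rho_coset r \<in> hom (H1_space X) (H1_rips X r) \<and> rho_coset r
    \<in> extensional (carrier (H1_space X)) \<and>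
      (\<forall>(g::'g) \<alpha> ts. path \<alpha> \<and> path_image \<alpha> \<subseteq> X \<and> pathfinish \<alpha> = pathstart \<alpha> \<and> r_sample r \<alpha> ts \<longrightarrow>
         rho_coset r (loop_H1 X g \<alpha>) = simplicial_loop_H1 (rips X r) g (sample_loop \<alpha> ts))"
  proof (intro conjI allI impI)
    show "rho_coset r \<in> hom (H1_space X) (H1_rips X r)" by (rule rho_coset_hom[OF r])
    show "rho_coset r \<in> extensional (carrier (H1_space X))" by (rule rho_coset_extensional)
  qed (use rho_coset_loop[OF r] in blast)
  fix h :: "('a, 'g) singular_chains set \<Rightarrow> ('a list \<Rightarrow>\<^sub>0 'g) set"
  assume h: "h \<in> hom (H1_space X) (H1_rips X r) \<and> h \<in> extensional (carrier (H1_space X)) \<and>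
      (\<forall>g \<alpha> ts. path \<alpha> \<and> path_image \<alpha> \<subseteq> X \<and> pathfinish \<alpha> = pathstart \<alpha> \<and> r_sample r \<alpha> ts \<longrightarrow>
         h (loop_H1 X g \<alpha>) = simplicial_loop_H1 (rips X r) g (sample_loop \<alpha> ts))"
  show "h = rho_coset r"
  proof (rule extensionalityI)
    show "h \<in> extensional (carrier (H1_space X))" "rho_coset r \<in> extensional (carrier (H1_space X))"
      using h rho_coset_extensional by blast+
    fix c :: "('a, 'g) singular_chains set" assume c: "c \<in> carrier (H1_space X)"
    show "h c = rho_coset r c"
    proof (rule hom_H1_unique[OF _ _ rho_coset_hom[OF r] _ c])
      show "group (H1_rips X r :: ('a list \<Rightarrow>\<^sub>0 'g) set monoid)"
        by (rule comm_group.axioms(2)[OF SR.homology_facts(1)])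
      show "h \<in> hom (H1_space X) (H1_rips X r)" using h by blast
      fix g f assume f: "f \<in> based_loops (top_of_set X) b"
      then have p: "path f" "path_image f \<subseteq> X" "pathfinish f = pathstart f" "f 0 = f 1"
        by (auto simp: based_loops_def pathin_canon_iff path_image_def pathstart_def pathfinish_def)
      obtain ts where "r_sample r f ts" using r_sample_exists[OF p(1,4) r] by blast
      then show "h (loop_H1 X g f) = rho_coset r (loop_H1 X g f)"
        using h rho_coset_loop[OF r p(1-3)] p by metis
    qed
  qed
qed

lemma rho_H1_residue:
  assumes "r > 0" "z \<in> singular_cycles (top_of_set X)"
  shows "rho_H1 X r (residue (singular_boundaries (top_of_set X)) z)
      = residue (rips_boundaries X r) (F r z)"
  unfolding rho_H1_eq[OF assms(1)] by (rule rho_coset_residue[OF assms])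

end

section \<open>Geodesic chains, surjectivity and the kernel\<close>

context based_geodesic_space
begin

interpretation SX: face_complex "\<lambda>n. singular_simplex_set n (top_of_set X)" singular_face
  by (rule face_complex_space)

interpretation SR: face_complex "ordered_simplices (rips X r)" ordered_face for r
  by (rule face_complex_rips)

text \<open>The preimage of \<open>S_H1\<close> in the cycles; it lets computations modulo small
  loops take place on chains.\<close>

definition small_cycles :: "real \<Rightarrow> ('a, 'g::ab_group_add) singular_chains set" where
  "small_cycles d
    = {z \<in> singular_cycles
      (top_of_set X). residue (singular_boundaries (top_of_set X)) z \<in> S_H1 X d}"

lemma S_H1_subgroup:
  "subgroup (S_H1 X d :: ('a, 'g::ab_group_add) singular_chains set set) (H1_space X)"
proof -
  interpret H: comm_group "H1_space X :: ('a, 'g) singular_chains set monoid"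
    by (rule SX.homology_facts)
  show ?thesis
    unfolding S_H1_def
  proof (rule H.generate_is_subgroup, rule subsetI)
    fix A assume "A \<in> {loop_H1 X (g::'g) \<beta> |g \<beta>. loop_in_small_ball X d \<beta>}"
    then obtain g :: 'g and \<beta> where A: "A = loop_H1 X g \<beta>" "loop_in_small_ball X d \<beta>" by blast
    note b = loop_in_small_ballD[OF A(2)]
    show "A \<in> carrier (H1_space X)"
      unfolding A(1) loop_H1_residue SX.homology_facts(2) using path_chain_cycle[OF b(1), of g] b(2)
        by simp
  qed
qed

lemma small_cycles_subgroup:
    "add_subgroup (small_cycles d :: ('a, 'g::ab_group_add) singular_chains set)"
  unfolding add_subgroup_def
proof (intro conjI ballI)
  let ?B = "singular_boundaries (top_of_set X) :: ('a, 'g) singular_chains set"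
  interpret H: comm_group "H1_space X :: ('a, 'g) singular_chains set monoid"
    by (rule SX.homology_facts)
  interpret S: subgroup "S_H1 X d :: ('a, 'g) singular_chains set set" "H1_space X"
    by (rule S_H1_subgroup)
  note D = add_subgroupD[OF SX.Z_subgroup]
  have one: "residue ?B 0 = \<one>\<^bsub>H1_space X\<^esub>" by (simp only: SX.homology_facts(3) residue_zero)
  show "(0 :: ('a, 'g) singular_chains) \<in> small_cycles d"
    unfolding small_cycles_def mem_Collect_eq one using D(1) S.one_closed by blast
  fix x y :: "('a, 'g) singular_chains" assume "x \<in> small_cycles d" "y \<in> small_cycles d"
  then have x: "x \<in> singular_cycles (top_of_set X)" "residue ?B x \<in> S_H1 X d"
    and y: "y \<in> singular_cycles (top_of_set X)" "residue ?B y \<in> S_H1 X d"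
    unfolding small_cycles_def by blast+
  have "residue ?B (x - y) = residue ?B x \<otimes>\<^bsub>H1_space X\<^esub> inv\<^bsub>H1_space X\<^esub> (residue ?B y)"
    unfolding SX.homology_inv[OF y(1)] SX.homology_facts(4)[OF x(1) D(3)[OF y(1)]] by simp
  also have "\<dots> \<in> S_H1 X d" using x y by (intro S.m_closed S.m_inv_closed)
  finally show "x - y \<in> small_cycles d" using D(2)[OF x(1) y(1)] unfolding small_cycles_def by blast
qed

lemma boundaries_small:
  assumes "c \<in> singular_boundaries (top_of_set X)" shows "c \<in> small_cycles d"
proof -
  have "residue (singular_boundaries (top_of_set X)) c = singular_boundaries (top_of_set X)"
    using assms residue_eq_iff[OF SX.B_subgroup, of c 0] by (simp add: residue_zero)
  then show ?thesis
    using SX.B_subset_Z assms subgroup.one_closed[OF S_H1_subgroup]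
      unfolding small_cycles_def SX.homology_facts(3) by auto
qed

lemma small_loop_small_cycle:
  assumes "loop_in_small_ball X d f" shows "path_chain f g \<in> small_cycles d"
proof -
  note b = loop_in_small_ballD[OF assms]
  have "loop_H1 X g f \<in> S_H1 X d" unfolding S_H1_def by (rule generate.incl) (use assms in blast)
  then show ?thesis
    using path_chain_cycle[OF b(1), of g] b(2) unfolding small_cycles_def loop_H1_residue by simp
qed

text \<open>The path followed by the reversed geodesic is a small loop, and its chain splits by the
  relations for joins and reversal.\<close>

lemma short_path_small_cycle:
  assumes f: "pathin (top_of_set X) f"
      and short: "\<And>s t. s \<in> {0..1} \<Longrightarrow> t \<in> {0..1} \<Longrightarrow> dist (f s) (f t) < r" and r: "r > 0"
  shows "path_chain f g - path_chain (geodesic X (f 0) (f 1)) g \<in> small_cycles (3 * r / 2)"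
proof -
  let ?\<gamma> = "geodesic X (f 0) (f 1)"
  have X: "f 0 \<in> X" "f 1 \<in> X" using path_pathin_canon(2)[OF f] by auto
  note g = geodesic_facts[OF geodesic_space X] and D = add_subgroupD[OF small_cycles_subgroup]
  have "loop_in_small_ball X (3 * r / 2) (f +++ reversepath ?\<gamma>)"
    using loop_in_small_ball_mono[OF short_path_geodesic_small[OF f
      is_geodesic_geodesic[OF geodesic_space X] short]] r by simp
  then have 1: "path_chain (f +++ reversepath ?\<gamma>) g \<in> small_cycles (3 * r / 2)"
    by (rule small_loop_small_cycle)
  have 2: "path_chain (reversepath ?\<gamma>) g - path_chain (f +++ reversepath ?\<gamma>) g + path_chain f g
    \<in> small_cycles (3 * r / 2)"
    by (rule boundaries_small[OF path_chain_join[OF f pathin_reversepath[OF g(1)]]]) (simp add: g)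
  have 3: "path_chain (reversepath ?\<gamma>) g + path_chain ?\<gamma> g \<in> small_cycles (3 * r / 2)"
    by (rule boundaries_small[OF path_chain_reversepath[OF g(1)]])
  have "path_chain f g - path_chain ?\<gamma> g =
      (path_chain (reversepath ?\<gamma>) g - path_chain (f +++ reversepath ?\<gamma>) g + path_chain f g)
        + path_chain (f +++ reversepath ?\<gamma>) g
      - (path_chain (reversepath ?\<gamma>) g + path_chain ?\<gamma> g)"
    by simp
  then show ?thesis using D(2)[OF D(4)[OF 2 1] 3] by (simp only:)
qed

text \<open>Up to boundaries this alternating sum is the chain of the loop around the geodesic
  triangle, which lies in a ball of radius below 3r/2.\<close>

lemma triangle_small_cycle:
  fixes g :: "'g::ab_group_add"
  assumes X: "x \<in> X" "y \<in> X" "z \<in> X" and d: "dist x y < r" "dist y z < r" "dist x z < r"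
  shows "path_chain (geodesic X y z) g - path_chain (geodesic X x z) g
      + path_chain (geodesic X x y) g \<in> small_cycles (3 * r / 2)"
proof -
  let ?S = "small_cycles (3 * r / 2) :: ('a, 'g) singular_chains set"
  let ?a = "geodesic X x y" and ?b = "geodesic X y z" and ?c = "geodesic X x z"
  note gs = geodesic_facts[OF geodesic_space] and ig = is_geodesic_geodesic[OF geodesic_space]
  note a = gs(1-3)[OF X(1,2)] and b = gs(1-3)[OF X(2,3)] and c = gs(1-3)[OF X(1,3)]
  note D = add_subgroupD[OF small_cycles_subgroup]
  note rc = pathin_reversepath[OF c(1)]
  have bc: "pathin (top_of_set X) (?b +++ reversepath ?c)" using b c
    by (auto intro!: pathin_join pathin_reversepath)
  have 1: "path_chain (?a +++ (?b +++ reversepath ?c)) g \<in> ?S"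
    by
      (rule small_loop_small_cycle[OF geodesic_triangle_small[OF ig[OF X(1,2)] ig[OF X(2,3)]
        ig[OF X(1,3)] d]])
  have 2: "path_chain (?b +++ reversepath ?c) g - path_chain (?a +++ (?b +++ reversepath ?c)) g
    + path_chain ?a g \<in> ?S"
    by (rule boundaries_small[OF path_chain_join[OF a(1) bc]]) (simp add: a b)
  have 3: "path_chain (reversepath ?c) g - path_chain (?b +++ reversepath ?c) g + path_chain ?b g
    \<in> ?S"
    by (rule boundaries_small[OF path_chain_join[OF b(1) rc]]) (simp add: b c)
  have 4: "path_chain (reversepath ?c) g + path_chain ?c g \<in> ?S"
    by (rule boundaries_small[OF path_chain_reversepath[OF c(1)]])
  have "path_chain ?b g - path_chain ?c g + path_chain ?a g =
      (path_chain
        (?b +++ reversepath ?c) g - path_chain (?a +++ (?b +++ reversepath ?c)) g + path_chain ?a g)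
      + (path_chain (reversepath ?c) g - path_chain (?b +++ reversepath ?c) g + path_chain ?b g)
      + path_chain (?a +++ (?b +++ reversepath ?c)) g
        - (path_chain (reversepath ?c) g + path_chain ?c g)"
    by simp
  then show ?thesis using D(2)[OF D(4)[OF D(4)[OF 2 3] 1] 4] by (simp only:)
qed

abbreviation G :: "('a list \<Rightarrow>\<^sub>0 'g::ab_group_add) \<Rightarrow> ('a, 'g) singular_chains" where
  "G \<equiv> chain_ext (geodesic_chain X)"

lemma ordered_simplices_1:
  assumes "r > 0" "s \<in> ordered_simplices (rips X r) 1"
  obtains x y where "s = [x, y]" "x \<in> X" "y \<in> X" "dist x y < r"
proof -
  have "length s = Suc (Suc 0)" using assms(2) by (simp add: ordered_simplices_def One_nat_def)
  then obtain x y where s: "s = [x, y]" by (auto simp: length_Suc_conv)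
  then have "{x, y} \<in> rips X r" using assms(2) by (simp add: ordered_simplices_def)
  then show thesis using that s rips_edge[OF assms(1)] by blast
qed

lemma geodesic_chain_pair: "geodesic_chain X [x, y] g = path_chain (geodesic X x y) g"
  by (simp add: geodesic_chain_def)

text \<open>On one ordered triangle this is \<open>triangle_small_cycle\<close>. Tuples with
  repeated vertices are covered, a geodesic from a point to itself being allowed.\<close>

lemma G_boundary:
  fixes c :: "'a list \<Rightarrow>\<^sub>0 'g::ab_group_add"
  assumes r: "r > 0" and c: "c \<in> rips_boundaries X r"
  shows "G c \<in> small_cycles (3 * r / 2)"
proof -
  let ?S = "small_cycles (3 * r / 2) :: ('a, 'g) singular_chains set"
  have "add_subgroup {c. G c \<in> ?S}"
    unfolding add_subgroup_def
    using add_subgroupD(1,2)[OF small_cycles_subgroup]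
      by (auto simp: chain_ext_diff[OF additive_geodesic_chain])
  from SR.boundary_induct[OF c this]
  have "c \<in> {c. G c \<in> ?S}"
  proof this
    fix s and g :: 'g assume s: "s \<in> ordered_simplices (rips X r) 2"
    then have "length s = Suc (Suc (Suc 0))" by (simp add: ordered_simplices_def)
    then obtain x y z where [simp]: "s = [x, y, z]" by (auto simp: length_Suc_conv)
    have "{x, y, z} \<in> rips X r" using s by (simp add: ordered_simplices_def)
    then have t: "x \<in> X" "y \<in> X" "z \<in> X" "dist x y < r" "dist y z < r" "dist x z < r"
      using rips_triangle[OF r] by blast+
    show "Poly_Mapping.single (ordered_face 2 0 s) g - Poly_Mapping.single (ordered_face 2 1 s) g +
        Poly_Mapping.single (ordered_face 2 2 s) g \<in> {c. G c \<in> ?S}"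
      using triangle_small_cycle[OF t, of g]
      by (simp add: ordered_face_simps chain_ext_add[OF additive_geodesic_chain]
        chain_ext_diff[OF additive_geodesic_chain]
          chain_ext_single[OF additive_geodesic_chain] geodesic_chain_pair)
  qed
  then show ?thesis by simp
qed

text \<open>\<open>G\<close> commutes with the boundary if the list [x] is sent to the point simplex
  at x, because a geodesic has the ends of its edge.\<close>

lemma G_cycle:
  fixes c :: "'a list \<Rightarrow>\<^sub>0 'g::ab_group_add"
  assumes r: "r > 0" and c: "c \<in> rips_cycles X r"
  shows "G c \<in> singular_cycles (top_of_set X)"
proof -
  have c': "Poly_Mapping.keys c \<subseteq> ordered_simplices (rips X r) 1" "boundary ordered_face 1 c = 0"
    using c by (auto simp: SR.Z_iff)
  let ?\<psi> = "\<lambda>s. Poly_Mapping.single (point_simplex (hd s)) :: 'g \<Rightarrow> _"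
  have a: "additive_family ?\<psi>" by (simp add: additive_family_def single_add)
  have "boundary singular_face 1 (G c)
    = chain_ext (\<lambda>s g. boundary singular_face 1 (geodesic_chain X s g)) c"
    by (simp add: chain_ext_def boundary_1_simps)
  also have "\<dots> = chain_ext (\<lambda>s g. ?\<psi> (ordered_face 1 0 s) g - ?\<psi> (ordered_face 1 1 s) g) c"
  proof (rule chain_ext_cong)
    fix s and g :: 'g assume "s \<in> Poly_Mapping.keys c"
    then obtain x y where s: "s = [x, y]" "x \<in> X" "y \<in> X" using ordered_simplices_1[OF r] c'(1)
      by blast
    note g = geodesic_facts(2,3)[OF geodesic_space s(2,3)]
    show "boundary singular_face 1 (geodesic_chain X s g) = ?\<psi> (ordered_face 1 0 s) g
      - ?\<psi> (ordered_face 1 1 s) g"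
      unfolding s(1) geodesic_chain_pair boundary_path_chain ordered_face_simps g by simp
  qed
  also have "\<dots> = chain_ext ?\<psi> (boundary ordered_face 1 c)"
    unfolding boundary_1 chain_ext_comp[OF a]
    by (simp add: chain_ext_diff[OF a] chain_ext_single[OF a])
  finally have "boundary singular_face 1 (G c) = 0" using c'(2) by simp
  moreover have "Poly_Mapping.keys (G c) \<subseteq> sing X 1"
  proof (rule keys_chain_ext)
    fix s and g :: 'g assume "s \<in> Poly_Mapping.keys c"
    then obtain x y where s: "s = [x, y]" "x \<in> X" "y \<in> X" using ordered_simplices_1[OF r] c'(1)
      by blast
    show "Poly_Mapping.keys (geodesic_chain X s g) \<subseteq> sing X 1"
      using path_simplex_singular[OF geodesic_facts(1)[OF geodesic_space s(2,3)]]
      unfolding s(1) geodesic_chain_pair by simp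
  qed
  ultimately show ?thesis unfolding SX.Z_iff by blast
qed

text \<open>Points of a geodesic shorter than r are within r of each other, so its holonomy is the
  single edge between its ends, whatever sample is chosen for it.\<close>

lemma F_G:
  fixes c :: "'a list \<Rightarrow>\<^sub>0 'g::ab_group_add"
  assumes r: "r > 0" and c: "Poly_Mapping.keys c \<subseteq> ordered_simplices (rips X r) 1"
  shows "F r (G c) - c \<in> rips_boundaries X r"
proof -
  have "chain_ext (\<lambda>s g. F r (geodesic_chain X s g) - Poly_Mapping.single s g) c
    \<in> rips_boundaries X r"
  proof (rule chain_ext_in_subgroup[OF SR.B_subgroup])
    fix s and g :: 'g assume "s \<in> Poly_Mapping.keys c"
    then obtain x y where s: "s = [x, y]" "x \<in> X" "y \<in> X" "dist x y < r"
      using ordered_simplices_1[OF r] c by blast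
    note g = geodesic_facts[OF geodesic_space s(2,3)]
    have "residue (rips_boundaries X r) (F r (path_chain (geodesic X x y) g))
      = holonomy (Q r) (chain_cocycle X r g) (geodesic X x y)"
      by (rule F_path[OF r g(1)])
    also have "\<dots> = chain_cocycle X r g (geodesic X x y 0) (geodesic X x y 1)"
      by (rule holonomy_short[OF group_Q chain_cocycle[OF r] r g(1)])
        (use g(4) s(4) in \<open>auto intro: order_le_less_trans\<close>)
    also have "\<dots> = residue (rips_boundaries X r) (Poly_Mapping.single [x, y] g)"
      by (simp add: chain_cocycle_def g(2,3))
    finally show "F r (geodesic_chain X s g) - Poly_Mapping.single s g \<in> rips_boundaries X r"
      unfolding s(1) geodesic_chain_pair residue_eq_iff[OF SR.B_subgroup] .
  qed
  then show ?thesis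
    unfolding chain_ext_diff_family chain_ext_id chain_ext_comp[OF additive_sample_chain] .
qed

text \<open>Between consecutive sample times the path is short, so each piece may be exchanged for
  the geodesic between its ends, at the cost of a small cycle.\<close>

lemma G_list_chain:
  fixes g :: "'g::ab_group_add"
  assumes r: "r > 0" and f: "pathin (top_of_set X) f" and ts: "fine_sample r f ts" "ts \<noteq> []"
  shows "G (list_chain g (map f ts)) - path_chain (restrict_path (hd ts) (last ts) f) g
      \<in> small_cycles (3 * r / 2)"
  using ts
proof (induction ts rule: induct_list012)
  case (2 s)
  have "f s \<in> X" using 2 path_pathin_canon(2)[OF f, of s] by (auto simp: fine_sample_def)
  then have "path_chain (\<lambda>t. f s) g \<in> small_cycles (3 * r / 2)"
    by (intro boundaries_small path_chain_const) simp
  moreover have "restrict_path s s f = (\<lambda>t. f s)"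
    by (auto simp: restrict_path_def linepath_def algebra_simps)
  ultimately show ?case using add_subgroupD(3)[OF small_cycles_subgroup] by simp
next
  case (3 s t ts)
  let ?S = "small_cycles (3 * r / 2) :: ('a, 'g) singular_chains set"
  note D = add_subgroupD[OF small_cycles_subgroup]
  let ?l = "last (t # ts)"
  have ft: "fine_sample r f (t # ts)" and st: "s \<le> t" "s \<in> {0..1}"
    and short: "\<And>u v. u \<in> {s..t} \<Longrightarrow> v \<in> {s..t} \<Longrightarrow> dist (f u) (f v) < r"
    using 3(3) by (auto simp: fine_sample_Cons)
  have t: "t \<in> {0..1}" "?l \<in> {0..1}" using ft last_in_set[of "t # ts"] unfolding fine_sample_def
    by auto
  let ?h = "restrict_path s t f"
  have h: "pathin (top_of_set X) ?h" by (rule pathin_restrict_path[OF f st(2) t(1)])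
  have "dist (?h u) (?h v) < r" if "u \<in> {0..1}" "v \<in> {0..1}" for u v
    using linepath_in_path[OF that(1), of s t] linepath_in_path[OF that(2), of s t] short st(1)
    by (simp add: restrict_path_def closed_segment_eq_real_ivl)
  from short_path_small_cycle[OF h this r, of g]
  have 1: "path_chain ?h g - path_chain (geodesic X (f s) (f t)) g \<in> ?S" by simp
  have 2: "G (list_chain g (map f (t # ts))) - path_chain (restrict_path t ?l f) g \<in> ?S"
    using 3(2)[OF ft] by simp
  have 3: "path_chain (restrict_path t ?l f) g - path_chain (restrict_path s ?l f) g
    + path_chain ?h g \<in> ?S"
    by (rule boundaries_small[OF path_chain_restrict[OF f st(2) t]])
  have "G (list_chain g (map f (s # t # ts))) = path_chain (geodesic X (f s) (f t)) g
    + G (list_chain g (map f (t # ts)))"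
    by (simp add: chain_ext_add[OF additive_geodesic_chain]
      chain_ext_single[OF additive_geodesic_chain] geodesic_chain_pair)
  then have "G (list_chain g (map f (s # t # ts))) - path_chain (restrict_path s ?l f) g =
      (G (list_chain g (map f (t # ts))) - path_chain (restrict_path t ?l f) g)
      + (path_chain (restrict_path t ?l f) g - path_chain (restrict_path s ?l f) g + path_chain ?h
        g)
      - (path_chain ?h g - path_chain (geodesic X (f s) (f t)) g)"
    by simp
  also have "\<dots> \<in> ?S" by (rule D(2)[OF D(4)[OF 2 3] 1])
  finally show ?case by simp
qed simp

text \<open>This holds for all 1-chains: a simplex and the chain of geodesics that replaces it have
  the same ends, so already their difference is a cycle.\<close>

lemma G_F:
  fixes z :: "('a, 'g::ab_group_add) singular_chains"
  assumes r: "r > 0" and z: "Poly_Mapping.keys z \<subseteq> sing X 1"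
  shows "G (F r z) - z \<in> small_cycles (3 * r / 2)"
proof -
  have "chain_ext (\<lambda>\<sigma> g. G (sample_chain r \<sigma> g) - Poly_Mapping.single \<sigma> g) z
    \<in> small_cycles (3 * r / 2)"
  proof (rule chain_ext_in_subgroup[OF small_cycles_subgroup])
    fix \<sigma> and g :: 'g assume "\<sigma> \<in> Poly_Mapping.keys z"
    then have s: "singular_simplex 1 (top_of_set X) \<sigma>" using z by blast
    note f = pathin_simplex_path[OF s]
    note t = sample_times[OF path_pathin_canon(1)[OF f] r]
    show "G (sample_chain r \<sigma> g) - Poly_Mapping.single \<sigma> g \<in> small_cycles (3 * r / 2)"
      using G_list_chain[OF r f t(1,2), of g] t(3,4) path_simplex_simplex_path[OF s]
        by (simp add: sample_chain_def)
  qed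
  then show ?thesis
    unfolding chain_ext_diff_family chain_ext_id chain_ext_comp[OF additive_geodesic_chain] .
qed

lemma group_H1:
  "group (H1_space X :: ('a, 'g::ab_group_add) singular_chains set monoid)"
  "group (H1_rips X r :: ('a list \<Rightarrow>\<^sub>0 'g::ab_group_add) set monoid)"
  by (rule comm_group.axioms(2)[OF SX.homology_facts(1)],
    rule comm_group.axioms(2)[OF SR.homology_facts(1)])

text \<open>Replacing edges by geodesics turns a cycle \<open>c\<close> into a singular cycle, and
  sampling that gives \<open>c\<close> back up to boundaries.\<close>

lemma rho_H1_surj:
  assumes r: "r > 0"
  shows "(rho_H1 X r :: ('a, 'g::ab_group_add) singular_chains set \<Rightarrow> _) ` carrier (H1_space X)
      = carrier (H1_rips X r)"
proof
  show "(rho_H1 X r :: ('a, 'g) singular_chains set \<Rightarrow> _) ` carrier (H1_space X) \<subseteq> carrier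
    (H1_rips X r)"
    unfolding rho_H1_eq[OF r] using hom_carrier[OF rho_coset_hom[OF r]] .
  show "carrier (H1_rips X r) \<subseteq> (rho_H1 X r :: ('a, 'g) singular_chains set \<Rightarrow> _) ` carrier
    (H1_space X)"
  proof
    fix C :: "('a list \<Rightarrow>\<^sub>0 'g) set" assume "C \<in> carrier (H1_rips X r)"
    then obtain c where c: "c \<in> rips_cycles X r" "C = residue (rips_boundaries X r) c"
      unfolding SR.homology_facts(2) by blast
    note Gc = G_cycle[OF r c(1)]
    have "F r (G c) - c \<in> rips_boundaries X r" by (rule F_G[OF r]) (use c(1) SR.Z_iff in blast)
    then have "rho_H1 X r (residue (singular_boundaries (top_of_set X)) (G c)) = C"
      unfolding rho_H1_residue[OF r Gc] c(2) residue_eq_iff[OF SR.B_subgroup] .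
    moreover have "residue (singular_boundaries (top_of_set X)) (G c) \<in> carrier (H1_space X)"
      unfolding SX.homology_facts(2) using Gc by blast
    ultimately show "C \<in> (rho_H1 X r :: ('a, 'g) singular_chains set \<Rightarrow> _) ` carrier (H1_space X)"
      by blast
  qed
qed

lemma kernel_rho_H1:
  assumes r: "r > 0"
  shows "kernel (H1_space X) (H1_rips X r) (rho_H1 X r)
      = (S_H1 X (3 * r / 2) :: ('a, 'g::ab_group_add) singular_chains set set)"
proof
  let ?BX = "singular_boundaries (top_of_set X) :: ('a, 'g) singular_chains set"
  let ?B = "rips_boundaries X r :: ('a list \<Rightarrow>\<^sub>0 'g) set"
  interpret h: group_hom "H1_space X :: ('a, 'g) singular_chains set monoid" "H1_rips X r"
    "rho_H1 X r"
    unfolding group_hom_def group_hom_axioms_def rho_H1_eq[OF r] using group_H1 rho_coset_hom[OF r]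
      by blast
  show "(S_H1 X (3 * r / 2) :: ('a, 'g) singular_chains set set) \<subseteq> kernel (H1_space X) (H1_rips X r)
    (rho_H1 X r)"
    unfolding S_H1_def
  proof (rule group.generate_subgroup_incl[OF group_H1(1) _ h.subgroup_kernel], rule subsetI)
    fix A assume "A \<in> {loop_H1 X (g::'g) \<beta> |g \<beta>. loop_in_small_ball X (3 * r / 2) \<beta>}"
    then obtain g :: 'g and \<beta> where A: "A = residue ?BX (path_chain \<beta> g)"
      "loop_in_small_ball X (3 * r / 2) \<beta>"
      unfolding loop_H1_residue by blast
    note b = loop_in_small_ballD[OF A(2)]
    have z: "path_chain \<beta> g \<in> singular_cycles (top_of_set X)"
      by (rule path_chain_cycle[OF b(1)]) (simp add: b)
    have "rho_H1 X r A = holonomy (Q r) (chain_cocycle X r g) \<beta>"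
      unfolding A(1) rho_H1_residue[OF r z] by (rule F_path[OF r b(1)])
    also have "\<dots> = \<one>\<^bsub>Q r\<^esub>"
      by (rule loop_in_small_ball_holonomy[OF geodesic_space group_Q chain_cocycle[OF r] A(2)])
    also have "\<dots> = \<one>\<^bsub>H1_rips X r\<^esub>"
      unfolding residue_group(3)[OF SR.B_subgroup] SR.homology_facts(3) ..
    finally show "A \<in> kernel (H1_space X) (H1_rips X r) (rho_H1 X r)"
      unfolding kernel_def mem_Collect_eq A(1) SX.homology_facts(2) using z by blast
  qed
  show "kernel (H1_space X) (H1_rips X r) (rho_H1 X r) \<subseteq>
    (S_H1 X (3 * r / 2) :: ('a, 'g) singular_chains set set)"
  proof
    fix A :: "('a, 'g) singular_chains set"
    assume "A \<in> kernel (H1_space X) (H1_rips X r) (rho_H1 X r)"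
    then have A: "A \<in> carrier (H1_space X)" "rho_H1 X r A = ?B"
      unfolding kernel_def SR.homology_facts(3) by auto
    then obtain z where z: "z \<in> singular_cycles (top_of_set X)" "A = residue ?BX z"
      unfolding SX.homology_facts(2) by blast
    have "residue ?B (F r z) = residue ?B 0" using A(2)
      unfolding z(2) rho_H1_residue[OF r z(1)] residue_zero .
    then have "F r z \<in> ?B" unfolding residue_eq_iff[OF SR.B_subgroup] by simp
    from G_boundary[OF r this] have 1: "G (F r z) \<in> small_cycles (3 * r / 2)" .
    have 2: "G (F r z) - z \<in> small_cycles (3 * r / 2)"
      by (rule G_F[OF r]) (use z(1) SX.Z_iff in blast)
    \<comment> \<open>\<open>z\<close> is the difference of the two small cycles: the first is small
      because \<open>F r z\<close> is a boundary, the second measures the replacement of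
      \<open>z\<close> by geodesics.\<close>
    have "z \<in> small_cycles (3 * r / 2)" using add_subgroupD(2)[OF small_cycles_subgroup 1 2] by simp
    then show "A \<in> S_H1 X (3 * r / 2)" unfolding z(2) small_cycles_def by blast
  qed
qed

lemma rips_boundaries_mono:
  assumes "p \<le> q"
      shows "rips_boundaries X p \<subseteq> (rips_boundaries X q :: ('a list \<Rightarrow>\<^sub>0 'g::ab_group_add) set)"
  using rips_mono[OF assms] by (auto simp: boundaries_def ordered_simplices_def)

lemma simplicial_H1_incl_residue:
  fixes z :: "'a list \<Rightarrow>\<^sub>0 'g::ab_group_add"
  assumes "p \<le> q"
  shows "simplicial_H1_incl (rips X q) (residue (rips_boundaries X p) z)
      = residue (rips_boundaries X q) z"
proof -
  let ?P = "residue (rips_boundaries X p) z" and ?c = "residue (rips_boundaries X q) z"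
  have eq: "residue (rips_boundaries X q) w = ?c" if w: "w \<in> ?P" for w
  proof -
    have "w - z \<in> rips_boundaries X p" using w by (auto simp: residue_def)
    then have "w - z \<in> rips_boundaries X q" using rips_boundaries_mono[OF assms] by blast
    then show ?thesis unfolding residue_eq_iff[OF SR.B_subgroup] .
  qed
  have ne: "?P \<noteq> {}"
  proof -
    have "0 \<in> (rips_boundaries X p :: ('a list \<Rightarrow>\<^sub>0 'g) set)"
      by (rule add_subgroupD(1)[OF SR.B_subgroup])
    then show ?thesis unfolding residue_def by blast
  qed
  have "simplicial_H1_incl (rips X q) ?P = (\<Union>w\<in>?P. ?c)"
    unfolding simplicial_H1_incl_def SR.homology_class_residue by (rule SUP_cong[OF refl]) (rule eq)
  also have "\<dots> = ?c" using ne by simp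
  finally show ?thesis .
qed

text \<open>The samples chosen at the scales p and q may be unrelated, but at scale q both chains
  represent the same holonomy.\<close>

lemma rho_H1_natural:
  fixes c :: "('a, 'g::ab_group_add) singular_chains set"
  assumes pq: "0 < p" "p < q" and c: "c \<in> carrier (H1_space X)"
  shows "simplicial_H1_incl (rips X q) (rho_H1 X p c) = rho_H1 X q c"
proof -
  have q: "0 < q" "p \<le> q" using pq by auto
  obtain z where z: "z \<in> singular_cycles (top_of_set X)"
    "c = residue (singular_boundaries (top_of_set X)) z"
    using c unfolding SX.homology_facts(2) by blast
  have "chain_ext (\<lambda>\<sigma> g. sample_chain p \<sigma> g - sample_chain q \<sigma> g) z \<in> rips_boundaries X q"
  proof (rule chain_ext_in_subgroup[OF SR.B_subgroup])
    fix \<sigma> and g :: 'g assume "\<sigma> \<in> Poly_Mapping.keys z"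
    then have s: "\<sigma> \<in> sing X 1" using z(1) SX.Z_iff by blast
    show "sample_chain p \<sigma> g - sample_chain q \<sigma> g \<in> rips_boundaries X q"
      using sample_chain_holonomy[OF pq(1) q(2) s, of g]
        sample_chain_holonomy[OF q(1) order_refl s, of g]
      unfolding residue_eq_iff[OF SR.B_subgroup, symmetric] by (simp only:)
  qed
  then have "residue (rips_boundaries X q) (F p z) = residue (rips_boundaries X q) (F q z)"
    unfolding residue_eq_iff[OF SR.B_subgroup] chain_ext_diff_family .
  then show ?thesis
    unfolding z(2) rho_H1_residue[OF pq(1) z(1)] rho_H1_residue[OF q(1) z(1)]
      simplicial_H1_incl_residue[OF q(2)] .
qed

lemma persistence_iso_H1:
  "persistence_iso
     (\<lambda>r. (H1_space X :: ('a, 'g::ab_group_add) singular_chains set monoid)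
            Mod S_H1 X (3 * r / 2))
     (\<lambda>p q. quotient_bond (H1_space X) (S_H1 X (3 * q / 2)))
     (\<lambda>r. H1_rips X r)
     (\<lambda>p q. simplicial_H1_incl (rips X q))
     (\<lambda>r. induced_on_cosets (rho_H1 X r))"
proof (rule persistence_iso_kernels[where N = "\<lambda>r. S_H1 X (3 * r / 2)"])
  show "group (H1_space X :: ('a, 'g) singular_chains set monoid)" by (rule group_H1(1))
  fix r :: real assume r: "r > 0"
  show "group (H1_rips X r :: ('a list \<Rightarrow>\<^sub>0 'g) set monoid)" by (rule group_H1(2))
  show "(rho_H1 X r :: ('a, 'g) singular_chains set \<Rightarrow> _) \<in> hom (H1_space X) (H1_rips X r)"
    unfolding rho_H1_eq[OF r] by (rule rho_coset_hom[OF r])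
  show "(rho_H1 X r :: ('a, 'g) singular_chains set \<Rightarrow> _) ` carrier (H1_space X)
    = carrier (H1_rips X r)"
    by (rule rho_H1_surj[OF r])
  show "kernel (H1_space X) (H1_rips X r) (rho_H1 X r)
    = (S_H1 X (3 * r / 2) :: ('a, 'g) singular_chains set set)"
    by (rule kernel_rho_H1[OF r])
qed (rule rho_H1_natural)

end

theorem theorem5p4:
  fixes X :: "'a::metric_space set" and b :: 'a
  assumes "geodesic_space X" and "b \<in> X"
  shows
    "persistence_iso
       (\<lambda>r. pi1_space X b Mod S_pi1 X b (3 * r / 2))
       (\<lambda>p q. quotient_bond (pi1_space X b) (S_pi1 X b (3 * q / 2)))
       (\<lambda>r. pi1_rips X b r)
       (\<lambda>p q. fundamental_group_incl (realization (rips X q)) (vertex b))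
       (\<lambda>r. induced_on_cosets (rho_pi1 X b r))
     \<and>
     persistence_iso
       (\<lambda>r. (H1_space X :: (((nat \<Rightarrow> real) \<Rightarrow> 'a) \<Rightarrow>\<^sub>0 'g::ab_group_add) set monoid)
              Mod S_H1 X (3 * r / 2))
       (\<lambda>p q. quotient_bond (H1_space X) (S_H1 X (3 * q / 2)))
       (\<lambda>r. H1_rips X r)
       (\<lambda>p q. simplicial_H1_incl (rips X q))
       (\<lambda>r. induced_on_cosets (rho_H1 X r))"
proof -
  interpret based_geodesic_space X b using assms by unfold_locales
  show ?thesis using persistence_iso_pi1 persistence_iso_H1 ..
qed

end
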